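(* For every finite connected weighted graph $G=(V,(c_{xy})_{x,y\in V})$, all positive site weights $\alpha=(\alpha_x)_{x\in V}$, and all non-negative site weights $\omega=(\omega_x)_{x\in V}$ with $\omega\ne0$ (not identically zero), $${\rm gap}_{\rm SIP}(G,\alpha,\omega,\varrho)={\rm gap}_{\rm RW}(G,\alpha,\omega),\qquad\text{for all }\varrho>0.$$
   Context: $G$ is a finite graph with symmetric conductances $c_{xy}=c_{yx}\ge 0$, $c_{xx}=0$, connected (any two distinct sites are joined by a sequence of sites with positive consecutive conductances). $|\alpha|=\sum_x\alpha_x$, $|\eta|=\sum_x\eta_x$, $\Xi=\{\eta\in\mathbb N_0^V\}$. For $\varrho>0$, the open symmetric inclusion process with constant reservoir parameter $\theta\equiv\varrho$ is the (non-explosive) continuous-time Markov chain on $\Xi$ with generator $$L_{G,\alpha,\omega,\varrho}f(\eta)=\sum_{x,y\in V}c_{xy}\eta_x(\alpha_y+\eta_y)\big(f(\eta-\delta_x+\delta_y)-f(\eta)\big)+\sum_{x\in V}\omega_x\Big\{\eta_x(1+\varrho)\big(f(\eta-\delta_x)-f(\eta)\big)+\varrho(\alpha_x+\eta_x)\big(f(\eta+\delta_x)-f(\eta)\big)\Big\}.$$ When $\omega\neq0$, its unique stationary measure is the reversible product measure $\nu_{\alpha,\varrho}(\eta)=(1+\varrho)^{-|\alpha|}\big(\frac{\varrho}{1+\varrho}\big)^{|\eta|}\prod_{x\in V}\frac{\Gamma(\alpha_x+\eta_x)}{\Gamma(\alpha_x)\,\eta_x!}$. Regard $L_{G,\alpha,\omega,\varrho}$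 as the self-adjoint generator of the associated Markov semigroup on $L^2(\nu_{\alpha,\varrho})$. Then ${\rm gap}_{\rm SIP}(G,\alpha,\omega,\varrho)$ denotes its spectral gap, i.e. the infimum of the spectrum of $-L_{G,\alpha,\omega,\varrho}$ in $L^2(\nu_{\alpha,\varrho})$ with the eigenvalue $0$ removed. ${\rm gap}_{\rm RW}(G,\alpha,\omega)$ is the smallest eigenvalue of minus the generator of the random walk on $V$ with killing, i.e. of the operator on $\mathbb R^V$ given by $f\mapsto -\sum_{y\in V}c_{xy}\alpha_y(f(y)-f(x))+\omega_xf(x)$, $x\in V$. *)

theory Defs
  imports "HOL-Analysis.Analysis"
begin

section \<open>Semigroup of a continuous-time Markov chain on a countable state space\<close>

text \<open>The rate matrix of a Markov generator \<open>L\<close> on a discrete space is read off from its action on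
  indicator functions: for \<open>x \<noteq> y\<close> the entry is the jump rate from \<open>x\<close> to \<open>y\<close>, and the diagonal
  entry is minus the total jump rate out of \<open>x\<close>.\<close>

definition rate_matrix :: "(('s \<Rightarrow> real) \<Rightarrow> 's \<Rightarrow> real) \<Rightarrow> 's \<Rightarrow> 's \<Rightarrow> real" where
  "rate_matrix L x y = L (indicator {y}) x"

text \<open>\<open>feller_iter q n t x y\<close> is the probability that the chain with rate matrix \<open>q\<close> started in \<open>x\<close>
  is in \<open>y\<close> at time \<open>t\<close> and has made fewer than \<open>n\<close> jumps up to then. The recursion conditions on
  the time \<open>s\<close> and the target \<open>z\<close> of the first jump.\<close>

primrec feller_iter :: "('s \<Rightarrow> 's \<Rightarrow> real) \<Rightarrow> nat \<Rightarrow> real \<Rightarrow> 's \<Rightarrow> 's \<Rightarrow> ennreal" where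
  "feller_iter q 0 t x y = 0"
| "feller_iter q (Suc n) t x y =
     ennreal (exp (q x x * t)) * indicator {y} x +
     (\<integral>\<^sup>+ s. ennreal (exp (q x x * s)) *
        (\<integral>\<^sup>+ z. ennreal (q x z) * feller_iter q n (t - s) z y \<partial>count_space (- {x}))
        * indicator {0..t} s \<partial>lborel)"

text \<open>The limit is Feller's minimal transition function. For a non-explosive chain it is the
  transition function of the chain.\<close>

definition transition_prob :: "('s \<Rightarrow> 's \<Rightarrow> real) \<Rightarrow> real \<Rightarrow> 's \<Rightarrow> 's \<Rightarrow> real" where
  "transition_prob q t x y = enn2real (SUP n. feller_iter q n t x y)"

definition markov_semigroup ::
    "('s \<Rightarrow> 's \<Rightarrow> real) \<Rightarrow> real \<Rightarrow> ('s \<Rightarrow> complex) \<Rightarrow> 's \<Rightarrow> complex" where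
  "markov_semigroup q t f x =
     (\<integral>y. complex_of_real (transition_prob q t x y) * f y \<partial>count_space UNIV)"

section \<open>Unbounded operators on $L^2$ and their spectrum\<close>

text \<open>Elements of the complex Hilbert space \<open>L\<^sup>2(M)\<close> are represented by functions, not by classes of
  almost everywhere equal functions. These notions are therefore only meant for measures on a
  discrete space giving positive mass to every point.\<close>

definition L2 :: "'s measure \<Rightarrow> ('s \<Rightarrow> complex) set" where
  "L2 M = {f \<in> borel_measurable M. integrable M (\<lambda>x. (cmod (f x))\<^sup>2)}"

definition L2_norm :: "'s measure \<Rightarrow> ('s \<Rightarrow> complex) \<Rightarrow> real" where
  "L2_norm M f = sqrt (\<integral>x. (cmod (f x))\<^sup>2 \<partial>M)"

text \<open>An unbounded operator is given by its graph, a set of pairs \<open>(f, A f)\<close> with \<open>f\<close> in the domain.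
  The following is the infinitesimal generator of the semigroup \<open>P\<close> acting on \<open>L\<^sup>2(M)\<close>.\<close>

definition L2_generator ::
    "'s measure \<Rightarrow> (real \<Rightarrow> ('s \<Rightarrow> complex) \<Rightarrow> 's \<Rightarrow> complex) \<Rightarrow>
     (('s \<Rightarrow> complex) \<times> ('s \<Rightarrow> complex)) set" where
  "L2_generator M P =
     {(f, g). f \<in> L2 M \<and> g \<in> L2 M \<and>
        ((\<lambda>t. L2_norm M (\<lambda>x. (P t f x - f x) / complex_of_real t - g x)) \<longlongrightarrow> 0) (at_right 0)}"

definition neg_graph ::
    "(('s \<Rightarrow> complex) \<times> ('s \<Rightarrow> complex)) set \<Rightarrow> (('s \<Rightarrow> complex) \<times> ('s \<Rightarrow> complex)) set" where
  "neg_graph T = (\<lambda>(f, g). (f, \<lambda>x. - g x)) ` T"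

text \<open>\<open>z\<close> is in the resolvent set of \<open>A\<close> iff \<open>A - z\<close> maps the domain bijectively onto \<open>L\<^sup>2(M)\<close> with
  bounded inverse.\<close>

definition L2_resolvent_set ::
    "'s measure \<Rightarrow> (('s \<Rightarrow> complex) \<times> ('s \<Rightarrow> complex)) set \<Rightarrow> complex set" where
  "L2_resolvent_set M T =
     {z. bij_betw (\<lambda>(f, g). \<lambda>x. g x - z * f x) T (L2 M) \<and>
         (\<exists>K. \<forall>(f, g) \<in> T. L2_norm M f \<le> K * L2_norm M (\<lambda>x. g x - z * f x))}"

definition L2_spectrum ::
    "'s measure \<Rightarrow> (('s \<Rightarrow> complex) \<times> ('s \<Rightarrow> complex)) set \<Rightarrow> complex set" where
  "L2_spectrum M T = - L2_resolvent_set M T"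

section \<open>The open symmetric inclusion process\<close>

definition add_particle :: "'v \<Rightarrow> ('v \<Rightarrow> nat) \<Rightarrow> 'v \<Rightarrow> nat" where
  "add_particle x \<eta> = \<eta>(x := \<eta> x + 1)"

text \<open>On an empty site this does nothing; in the generator such a term has rate zero.\<close>

definition remove_particle :: "'v \<Rightarrow> ('v \<Rightarrow> nat) \<Rightarrow> 'v \<Rightarrow> nat" where
  "remove_particle x \<eta> = \<eta>(x := \<eta> x - 1)"

definition sip_generator ::
    "('v::finite \<Rightarrow> 'v \<Rightarrow> real) \<Rightarrow> ('v \<Rightarrow> real) \<Rightarrow> ('v \<Rightarrow> real) \<Rightarrow> real \<Rightarrow>
     (('v \<Rightarrow> nat) \<Rightarrow> real) \<Rightarrow> ('v \<Rightarrow> nat) \<Rightarrow> real" where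
  "sip_generator c \<alpha> \<omega> \<rho> f \<eta> =
     (\<Sum>x\<in>UNIV. \<Sum>y\<in>UNIV. c x y * real (\<eta> x) * (\<alpha> y + real (\<eta> y)) *
        (f (add_particle y (remove_particle x \<eta>)) - f \<eta>)) +
     (\<Sum>x\<in>UNIV. \<omega> x *
        (real (\<eta> x) * (1 + \<rho>) * (f (remove_particle x \<eta>) - f \<eta>) +
         \<rho> * (\<alpha> x + real (\<eta> x)) * (f (add_particle x \<eta>) - f \<eta>)))"

definition sip_stationary :: "('v::finite \<Rightarrow> real) \<Rightarrow> real \<Rightarrow> ('v \<Rightarrow> nat) measure" where
  "sip_stationary \<alpha> \<rho> = point_measure UNIV (\<lambda>\<eta>. ennreal (
     (1 + \<rho>) powr (- (\<Sum>x\<in>UNIV. \<alpha> x)) * (\<rho> / (1 + \<rho>)) ^ (\<Sum>x\<in>UNIV. \<eta> x) *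
     (\<Prod>x\<in>UNIV. Gamma (\<alpha> x + real (\<eta> x)) / (Gamma (\<alpha> x) * fact (\<eta> x)))))"

definition sip_L2_generator ::
    "('v::finite \<Rightarrow> 'v \<Rightarrow> real) \<Rightarrow> ('v \<Rightarrow> real) \<Rightarrow> ('v \<Rightarrow> real) \<Rightarrow> real \<Rightarrow>
     ((('v \<Rightarrow> nat) \<Rightarrow> complex) \<times> (('v \<Rightarrow> nat) \<Rightarrow> complex)) set" where
  "sip_L2_generator c \<alpha> \<omega> \<rho> =
     L2_generator (sip_stationary \<alpha> \<rho>) (markov_semigroup (rate_matrix (sip_generator c \<alpha> \<omega> \<rho>)))"

text \<open>The generator is self-adjoint and non-positive, so the spectrum below is a subset of the
  non-negative reals and taking real parts is only a coercion.\<close>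

definition gap_SIP ::
    "('v::finite \<Rightarrow> 'v \<Rightarrow> real) \<Rightarrow> ('v \<Rightarrow> real) \<Rightarrow> ('v \<Rightarrow> real) \<Rightarrow> real \<Rightarrow> real" where
  "gap_SIP c \<alpha> \<omega> \<rho> =
     Inf (Re ` (L2_spectrum (sip_stationary \<alpha> \<rho>) (neg_graph (sip_L2_generator c \<alpha> \<omega> \<rho>)) - {0}))"

section \<open>The random walk with killing\<close>

definition rw_neg_generator ::
    "('v::finite \<Rightarrow> 'v \<Rightarrow> real) \<Rightarrow> ('v \<Rightarrow> real) \<Rightarrow> ('v \<Rightarrow> real) \<Rightarrow> ('v \<Rightarrow> real) \<Rightarrow> 'v \<Rightarrow> real" where
  "rw_neg_generator c \<alpha> \<omega> f x = - (\<Sum>y\<in>UNIV. c x y * \<alpha> y * (f y - f x)) + \<omega> x * f x"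

definition gap_RW ::
    "('v::finite \<Rightarrow> 'v \<Rightarrow> real) \<Rightarrow> ('v \<Rightarrow> real) \<Rightarrow> ('v \<Rightarrow> real) \<Rightarrow> real" where
  "gap_RW c \<alpha> \<omega> =
     Min {l. \<exists>f. f \<noteq> (\<lambda>_. 0) \<and> rw_neg_generator c \<alpha> \<omega> f = (\<lambda>x. l * f x)}"

section \<open>Connected weighted graphs\<close>

definition connected_conductances :: "('v \<Rightarrow> 'v \<Rightarrow> real) \<Rightarrow> bool" where
  "connected_conductances c \<longleftrightarrow>
     (\<forall>x y. c x y = c y x) \<and> (\<forall>x y. 0 \<le> c x y) \<and> (\<forall>x. c x x = 0) \<and>
     (\<forall>x y. (\<lambda>u v. 0 < c u v)\<^sup>*\<^sup>* x y)"

end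

theory Submission
  imports Defs
begin

text \<open>Let \<open>l\<close> be the principal eigenvalue of the random walk with killing and \<open>\<psi> > 0\<close> its
  eigenfunction. The linear function \<open>\<Sum>x. \<psi> x * \<eta> x\<close>, suitably centred, is an
  eigenfunction of minus the generator of the inclusion process with eigenvalue \<open>l\<close>, which gives
  one inequality between the gaps. The other one says that the semigroup \<open>P t\<close> contracts the
  functions of mean zero in \<open>L\<^sup>2\<close> by the factor \<open>exp (- l * t)\<close>, and rests on duality.

  Products \<open>dual \<xi> \<eta>\<close> of rescaled falling factorials satisfy \<open>L (dual \<xi>) \<eta> = L' (\<lambda>\<xi>. dual \<xi> \<eta>) \<xi>\<close>
  (lemma \<open>duality\<close>), where \<open>L'\<close> is the same generator with \<open>\<rho> = 0\<close>: the reservoirs only absorb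
  particles. The number of dual particles never grows, so the dual chain lives on finite
  sets, and \<open>F \<xi> = \<Sum>x. \<psi> x * \<xi> x\<close> is an exact eigenfunction of it: \<open>L' F = - l * F\<close>. The function \<open>F\<close>
  vanishes only at the empty configuration, and \<open>dual \<xi> = 1\<close> there. Hence \<open>\<bar>dual \<xi> \<eta> - 1\<bar>\<close> is at most a multiple
  of \<open>F \<xi>\<close> on each finite level set, and positivity of the dual dynamics turns this into
  \<open>\<bar>P t (dual \<xi>) \<eta> - 1\<bar> \<le> C * exp (- l * t) * F \<xi>\<close> with \<open>C\<close> depending on \<open>\<eta>\<close> and
  the size of \<open>\<xi>\<close> (lemma \<open>dual_decaying\<close>).

  Two soft arguments extend this to all of \<open>L\<^sup>2\<close>. By reversibility
  \<open>\<parallel>P t f\<parallel>\<^sup>2 \<le> \<parallel>f\<parallel> * \<parallel>P (2 * t) f\<parallel>\<close>, so decay at rate \<open>l\<close> with any constant, possibly depending on \<open>f\<close>, is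
  decay with constant one (lemma \<open>decay_constant_normalised\<close>). In particular the functions that decay at
  rate \<open>l\<close> form a closed subspace. The stationary measure has exponential moments, so a closed
  subspace that contains all duality functions, that is all polynomials, is everything (lemma
  \<open>dominated_closure_contains_indicators\<close>).

  The transition function is the minimal one, so it has to be shown that it gives the
  semigroup generated by \<open>L\<close>. The function \<open>V \<eta> = ((1 + \<rho>) / \<rho>) ^ \<bar>\<eta>\<bar>\<close> satisfies \<open>L V \<le> K * V\<close>. This yields uniqueness of
  non-negative solutions of the backward equation that grow more slowly than \<open>V\<close> (lemma
  \<open>backward_equation_unique\<close>), and with it conservation of mass, the semigroup property, and the
  identification of \<open>P t (dual \<xi>)\<close> with an exponential series. Reversibility comes from
  reversing jump paths (lemma \<open>feller_iter_reversible\<close>).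

  Finally, if \<open>\<parallel>P t f\<parallel> \<le> exp (- l * t) * \<parallel>f\<parallel>\<close> on mean-zero functions, then \<open>- L - z\<close> is inverted for \<open>Re z < l\<close> and \<open>z \<noteq> 0\<close> on
  these functions by the Laplace transform of the semigroup, and on constants by \<open>- 1 / z\<close>
  (lemma \<open>spectral_gap_resolvent\<close>).\<close>

section \<open>Minimal transition functions and the first-jump equation\<close>

lemma borel_measurable_nn_integral_countable [measurable (raw)]:
  fixes f :: "'a \<Rightarrow> 's::countable \<Rightarrow> ennreal"
  assumes "\<And>z. (\<lambda>x. f x z) \<in> borel_measurable M"
  shows "(\<lambda>x. \<integral>\<^sup>+z. f x z \<partial>count_space A) \<in> borel_measurable M"
proof -
  interpret sigma_finite_measure "count_space A"
    by (intro sigma_finite_measure_count_space_countable) auto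
  have "(\<lambda>p. f (fst p) (snd p)) \<in> borel_measurable (M \<Otimes>\<^sub>M count_space A)"
    by (rule measurable_compose_countable'[where I=A and f="\<lambda>z p. f (fst p) z" and g=snd])
      (auto intro: assms measurable_compose[OF measurable_fst])
  then show ?thesis
    by (intro borel_measurable_nn_integral) (simp add: case_prod_unfold)
qed

text \<open>This is the part of the recursion for \<open>feller_iter\<close> that conditions on a first jump before time
  \<open>t\<close>. Its fixed-point equation \<open>u = exp (q x x * t) * f x + first_jump q u\<close> is the
  integrated form of the backward equation \<open>u' = q u\<close> with initial value \<open>f\<close>, and
  makes sense for functions with values in \<open>[0, \<infinity>]\<close>.\<close>

definition first_jump ::
    "('s \<Rightarrow> 's \<Rightarrow> real) \<Rightarrow> (real \<Rightarrow> 's \<Rightarrow> ennreal) \<Rightarrow> real \<Rightarrow> 's \<Rightarrow> ennreal" where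
  "first_jump q v t x = (\<integral>\<^sup>+ s. ennreal (exp (q x x * s)) *
        (\<integral>\<^sup>+ z. ennreal (q x z) * v (t - s) z \<partial>count_space (- {x}))
        * indicator {0..t} s \<partial>lborel)"

lemma feller_iter_Suc:
  "feller_iter q (Suc n) t x y =
     ennreal (exp (q x x * t)) * indicator {y} x + first_jump q (\<lambda>t z. feller_iter q n t z y) t x"
  by (simp add: first_jump_def)

lemma first_jump_mono:
  assumes "\<And>s z. 0 \<le> s \<Longrightarrow> s \<le> t \<Longrightarrow> v s z \<le> v' s z"
  shows "first_jump q v t x \<le> first_jump q v' t x"
  unfolding first_jump_def
proof (rule nn_integral_mono)
  fix s
  show "ennreal (exp (q x x * s)) * (\<integral>\<^sup>+ z. ennreal (q x z) * v (t - s) z \<partial>count_space (- {x})) * indicator {0..t} s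
     \<le> ennreal (exp (q x x * s)) * (\<integral>\<^sup>+ z. ennreal (q x z) * v' (t - s) z \<partial>count_space (- {x})) * indicator {0..t} s"
    by (cases "s \<in> {0..t}") (auto intro!: mult_left_mono nn_integral_mono assms)
qed

lemma measurable_first_jump [measurable]:
  fixes q :: "'s::countable \<Rightarrow> 's \<Rightarrow> real"
  assumes [measurable]: "\<And>z. (\<lambda>t. v t z) \<in> borel_measurable borel"
  shows "(\<lambda>t. first_jump q v t x) \<in> borel_measurable borel"
proof -
  have ind: "indicator {0..t} s = (if 0 \<le> s \<and> s \<le> t then 1 else (0::ennreal))" for s t :: real
    by (auto split: split_indicator)
  show ?thesis
    unfolding first_jump_def ind by measurable
qed

lemma measurable_feller_iter [measurable]:
  fixes q :: "'s::countable \<Rightarrow> 's \<Rightarrow> real"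
  shows "(\<lambda>t. feller_iter q n t x y) \<in> borel_measurable borel"
  by (induction n arbitrary: x) (simp_all only: feller_iter_Suc feller_iter.simps(1), measurable)

lemma first_jump_add:
  fixes q :: "'s::countable \<Rightarrow> 's \<Rightarrow> real"
  assumes [measurable]: "\<And>z. (\<lambda>t. v t z) \<in> borel_measurable borel" "\<And>z. (\<lambda>t. u t z) \<in> borel_measurable borel"
  shows "first_jump q (\<lambda>t z. v t z + u t z) t x = first_jump q v t x + first_jump q u t x"
  unfolding first_jump_def
  by (subst nn_integral_add[symmetric]) (auto simp: nn_integral_add distrib_left distrib_right)

lemma first_jump_cmult:
  fixes q :: "'s::countable \<Rightarrow> 's \<Rightarrow> real"
  assumes [measurable]: "\<And>z. (\<lambda>t. v t z) \<in> borel_measurable borel"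
  shows "first_jump q (\<lambda>t z. c * v t z) t x = c * first_jump q v t x"
  unfolding first_jump_def
  by (subst nn_integral_cmult[symmetric]) (auto simp: nn_integral_cmult mult_ac)

lemma first_jump_nn_integral:
  fixes q :: "'s::countable \<Rightarrow> 's \<Rightarrow> real" and v :: "'s \<Rightarrow> real \<Rightarrow> 's \<Rightarrow> ennreal"
  assumes [measurable]: "\<And>y z. (\<lambda>t. v y t z) \<in> borel_measurable borel"
  shows "first_jump q (\<lambda>t z. \<integral>\<^sup>+y. v y t z \<partial>count_space UNIV) t x =
    (\<integral>\<^sup>+y. first_jump q (v y) t x \<partial>count_space UNIV)"
  unfolding first_jump_def
  apply (subst nn_integral_count_space_nn_integral[symmetric])
    apply (auto intro!: nn_integral_cong)
  apply (subst nn_integral_multc, simp, subst nn_integral_cmult, simp)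
  apply (subst nn_integral_count_space_nn_integral)
    apply (auto simp: nn_integral_cmult)
  done

lemma first_jump_SUP:
  fixes q :: "'s::countable \<Rightarrow> 's \<Rightarrow> real" and v :: "nat \<Rightarrow> real \<Rightarrow> 's \<Rightarrow> ennreal"
  assumes [measurable]: "\<And>n z. (\<lambda>t. v n t z) \<in> borel_measurable borel"
    and inc: "\<And>t z. incseq (\<lambda>n. v n t z)"
  shows "first_jump q (\<lambda>t z. SUP n. v n t z) t x = (SUP n. first_jump q (v n) t x)"
proof -
  have 1: "(\<integral>\<^sup>+ z. ennreal (q x z) * (SUP n. v n s z) \<partial>count_space (- {x})) =
     (SUP n. \<integral>\<^sup>+ z. ennreal (q x z) * v n s z \<partial>count_space (- {x}))" for s
  proof -
    have "(\<integral>\<^sup>+ z. ennreal (q x z) * (SUP n. v n s z) \<partial>count_space (- {x})) =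
       (\<integral>\<^sup>+ z. (SUP n. ennreal (q x z) * v n s z) \<partial>count_space (- {x}))"
      by (simp only: SUP_mult_left_ennreal)
    also have "\<dots> = (SUP n. \<integral>\<^sup>+ z. ennreal (q x z) * v n s z \<partial>count_space (- {x}))"
      using inc by (intro nn_integral_monotone_convergence_SUP) (auto simp: incseq_def le_fun_def intro!: mult_left_mono)
    finally show ?thesis .
  qed
  have "first_jump q (\<lambda>t z. SUP n. v n t z) t x = (\<integral>\<^sup>+ s. (SUP n. ennreal (exp (q x x * s)) *
        (\<integral>\<^sup>+ z. ennreal (q x z) * v n (t - s) z \<partial>count_space (- {x})) * indicator {0..t} s) \<partial>lborel)"
    unfolding first_jump_def 1 by (simp only: SUP_mult_left_ennreal SUP_mult_right_ennreal)
  also have "\<dots> = (SUP n. first_jump q (v n) t x)"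
    unfolding first_jump_def
    by (rule nn_integral_monotone_convergence_SUP)
      (use inc in \<open>auto simp: incseq_def le_fun_def intro!: mult_right_mono mult_left_mono nn_integral_mono\<close>)
  finally show ?thesis .
qed

definition feller_lim :: "('s \<Rightarrow> 's \<Rightarrow> real) \<Rightarrow> real \<Rightarrow> 's \<Rightarrow> 's \<Rightarrow> ennreal" where
  "feller_lim q t x y = (SUP n. feller_iter q n t x y)"

lemma transition_prob_eq: "transition_prob q t x y = enn2real (feller_lim q t x y)"
  by (simp add: transition_prob_def feller_lim_def)

lemma incseq_feller_iter: "incseq (\<lambda>n. feller_iter q n t x y)"
proof (rule incseq_SucI)
  show "feller_iter q n t x y \<le> feller_iter q (Suc n) t x y" for n
  proof (induction n arbitrary: t x)
    case (Suc n)
    show ?case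
      by (subst (1 2) feller_iter_Suc) (intro add_left_mono first_jump_mono Suc.IH)
  qed simp
qed

lemma measurable_feller_lim [measurable]:
  fixes q :: "'s::countable \<Rightarrow> 's \<Rightarrow> real"
  shows "(\<lambda>t. feller_lim q t x y) \<in> borel_measurable borel"
  unfolding feller_lim_def by measurable

definition feller_apply :: "('s \<Rightarrow> 's \<Rightarrow> real) \<Rightarrow> ('s \<Rightarrow> ennreal) \<Rightarrow> real \<Rightarrow> 's \<Rightarrow> ennreal" where
  "feller_apply q f t x = (\<integral>\<^sup>+y. feller_lim q t x y * f y \<partial>count_space UNIV)"

lemma measurable_feller_apply [measurable]:
  fixes q :: "'s::countable \<Rightarrow> 's \<Rightarrow> real"
  shows "(\<lambda>t. feller_apply q f t x) \<in> borel_measurable borel"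
  unfolding feller_apply_def by measurable

lemma feller_iter_apply_Suc:
  fixes q :: "'s::countable \<Rightarrow> 's \<Rightarrow> real"
  shows "(\<integral>\<^sup>+y. feller_iter q (Suc n) t x y * f y \<partial>count_space UNIV) =
     ennreal (exp (q x x * t)) * f x +
     first_jump q (\<lambda>t z. \<integral>\<^sup>+y. feller_iter q n t z y * f y \<partial>count_space UNIV) t x"
proof -
  have 1: "first_jump q (\<lambda>t z. feller_iter q n t z y) t x * f y
      = first_jump q (\<lambda>t z. feller_iter q n t z y * f y) t x" for y
    using first_jump_cmult[of "\<lambda>t z. feller_iter q n t z y" q "f y" t x] by (simp add: mult_ac)
  have 2: "(\<integral>\<^sup>+y. ennreal (exp (q x x * t)) * indicator {y} x * f y \<partial>count_space UNIV) = ennreal (exp (q x x * t)) * f x"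
    by (subst nn_integral_count_space'[where A="{x}"]) auto
  show ?thesis
    unfolding feller_iter_Suc
    by (subst first_jump_nn_integral) (auto simp: distrib_right nn_integral_add 1 2)
qed

lemma feller_apply_SUP:
  "feller_apply q f t x = (SUP n. \<integral>\<^sup>+y. feller_iter q n t x y * f y \<partial>count_space UNIV)"
proof -
  have "feller_apply q f t x = (\<integral>\<^sup>+y. (SUP n. feller_iter q n t x y * f y) \<partial>count_space UNIV)"
    unfolding feller_apply_def feller_lim_def by (simp add: SUP_mult_right_ennreal)
  also have "\<dots> = (SUP n. \<integral>\<^sup>+y. feller_iter q n t x y * f y \<partial>count_space UNIV)"
    using incseq_feller_iter[of q t x]
    by (intro nn_integral_monotone_convergence_SUP) (auto simp: incseq_def le_fun_def intro!: mult_right_mono)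
  finally show ?thesis .
qed

lemma feller_apply_first_jump:
  fixes q :: "'s::countable \<Rightarrow> 's \<Rightarrow> real"
  shows "feller_apply q f t x = ennreal (exp (q x x * t)) * f x + first_jump q (feller_apply q f) t x"
proof -
  let ?F = "\<lambda>n t x. \<integral>\<^sup>+y. feller_iter q n t x y * f y \<partial>count_space UNIV"
  have inc: "incseq (\<lambda>n. ?F n t x)" for t x
    using incseq_feller_iter[of q t x]
    by (auto simp: incseq_def intro!: nn_integral_mono mult_right_mono)
  have "feller_apply q f t x = (SUP n. ?F (Suc n) t x)"
    unfolding feller_apply_SUP
  proof (rule antisym)
    show "(SUP n. ?F n t x) \<le> (SUP n. ?F (Suc n) t x)"
    proof (rule SUP_mono)
      show "\<exists>m\<in>UNIV. ?F n t x \<le> ?F (Suc m) t x" for n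
        by (intro bexI[of _ n] incseqD[OF inc]) auto
    qed
    show "(SUP n. ?F (Suc n) t x) \<le> (SUP n. ?F n t x)"
    proof (rule SUP_mono)
      show "\<exists>m\<in>UNIV. ?F (Suc n) t x \<le> ?F m t x" for n
        by (intro bexI[of _ "Suc n"] order_refl UNIV_I)
    qed
  qed
  also have "\<dots> = (SUP n. ennreal (exp (q x x * t)) * f x + first_jump q (?F n) t x)"
    by (simp only: feller_iter_apply_Suc)
  also have "\<dots> = ennreal (exp (q x x * t)) * f x + (SUP n. first_jump q (?F n) t x)"
    by (rule ennreal_SUP_add_right[symmetric]) simp
  also have "(SUP n. first_jump q (?F n) t x) = first_jump q (\<lambda>t z. SUP n. ?F n t z) t x"
    by (rule first_jump_SUP[symmetric]) (use inc in auto)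
  finally show ?thesis by (simp add: feller_apply_SUP[abs_def])
qed

text \<open>The transition function is the smallest solution, because every iterate stays below any supersolution.\<close>

lemma feller_apply_le_supersolution:
  fixes q :: "'s::countable \<Rightarrow> 's \<Rightarrow> real"
  assumes super: "\<And>t x. 0 \<le> t \<Longrightarrow> ennreal (exp (q x x * t)) * f x + first_jump q u t x \<le> u t x"
    and t: "0 \<le> t"
  shows "feller_apply q f t x \<le> u t x"
proof -
  have "(\<integral>\<^sup>+y. feller_iter q n t x y * f y \<partial>count_space UNIV) \<le> u t x" for n
    using t
  proof (induction n arbitrary: t x)
    case (Suc n)
    have "first_jump q (\<lambda>t z. \<integral>\<^sup>+y. feller_iter q n t z y * f y \<partial>count_space UNIV) t x \<le> first_jump q u t x"
      by (intro first_jump_mono Suc.IH)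
    then have "(\<integral>\<^sup>+y. feller_iter q (Suc n) t x y * f y \<partial>count_space UNIV)
        \<le> ennreal (exp (q x x * t)) * f x + first_jump q u t x"
      unfolding feller_iter_apply_Suc by (intro add_left_mono)
    also have "\<dots> \<le> u t x" by (rule super[OF Suc.prems])
    finally show ?case .
  qed simp
  then show ?thesis unfolding feller_apply_SUP by (intro SUP_least)
qed

lemma feller_lim_eq_apply: "feller_lim q t x y = feller_apply q (indicator {y}) t x"
  unfolding feller_apply_def
  by (subst nn_integral_count_space'[where A="{y}"]) auto

lemma feller_lim_first_jump:
  fixes q :: "'s::countable \<Rightarrow> 's \<Rightarrow> real"
  shows "feller_lim q t x y = ennreal (exp (q x x * t)) * indicator {y} x + first_jump q (\<lambda>t z. feller_lim q t z y) t x"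
  using feller_apply_first_jump[of q "indicator {y}" t x]
  unfolding feller_lim_eq_apply[of q] .

section \<open>Time reversal of the minimal transition function\<close>

text \<open>The counterpart of \<open>first_jump\<close> that conditions on the last jump of the path. Here
  \<open>s\<close> is the time spent in the final state.\<close>

definition last_jump ::
    "('s \<Rightarrow> 's \<Rightarrow> real) \<Rightarrow> (real \<Rightarrow> 's \<Rightarrow> 's \<Rightarrow> ennreal) \<Rightarrow> real \<Rightarrow> 's \<Rightarrow> 's \<Rightarrow> ennreal" where
  "last_jump q v t x y = (\<integral>\<^sup>+ s. ennreal (exp (q y y * s)) *
        (\<integral>\<^sup>+ z. ennreal (q z y) * v (t - s) x z \<partial>count_space (- {y}))
        * indicator {0..t} s \<partial>lborel)"

text \<open>Stripping off the first and the last jump of a path can be done in either order. Both sides integrate the same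
  function over the holding times \<open>s\<close>, \<open>r\<close> with \<open>s + r \<le> t\<close>, and
  Tonelli applies.\<close>

lemma first_jump_last_jump_commute:
  fixes q :: "'s::countable \<Rightarrow> 's \<Rightarrow> real"
  assumes [measurable]: "\<And>x y. (\<lambda>t. v t x y) \<in> borel_measurable borel"
  shows "first_jump q (\<lambda>t z. last_jump q v t z y) t x =
    last_jump q (\<lambda>t x z. first_jump q (\<lambda>t z'. v t z' z) t x) t x y"
proof -
  define \<Phi> where "\<Phi> s r z z' = ennreal (exp (q x x * s)) * (ennreal (exp (q y y * r)) *
      (ennreal (q x z) * (ennreal (q z' y) * v (t - s - r) z z'))) *
      (if 0 \<le> s \<and> 0 \<le> r \<and> s + r \<le> t then 1 else 0)" for s r z z'
  have [measurable]: "(\<lambda>p. \<Phi> (snd p) (fst p) z z') \<in> borel_measurable (lborel \<Otimes>\<^sub>M lborel)"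
    and [measurable]: "(\<lambda>s. \<Phi> s r z z') \<in> borel_measurable borel"
    and [measurable]: "(\<lambda>r. \<Phi> s r z z') \<in> borel_measurable borel" for z z' s r
    unfolding \<Phi>_def by measurable
  have "first_jump q (\<lambda>t z. last_jump q v t z y) t x =
      (\<integral>\<^sup>+s. \<integral>\<^sup>+z. \<integral>\<^sup>+r. \<integral>\<^sup>+z'. \<Phi> s r z z' \<partial>count_space (-{y}) \<partial>lborel \<partial>count_space (-{x}) \<partial>lborel)"
    unfolding first_jump_def last_jump_def
    apply (rule nn_integral_cong)
    apply (subst nn_integral_cmult[symmetric], simp)
    apply (subst nn_integral_multc[symmetric], simp)
    apply (rule nn_integral_cong)
    apply (subst nn_integral_cmult[symmetric], measurable)
    apply (subst nn_integral_cmult[symmetric], measurable)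
    apply (subst nn_integral_multc[symmetric], measurable)
    apply (rule nn_integral_cong)
    apply (subst nn_integral_cmult[symmetric], simp)
    apply (subst nn_integral_multc[symmetric], simp)
    apply (subst nn_integral_cmult[symmetric], simp)
    apply (subst nn_integral_cmult[symmetric], simp)
    apply (subst nn_integral_multc[symmetric], simp)
    apply (rule nn_integral_cong)
    apply (auto simp: \<Phi>_def mult_ac split: split_indicator)
    done
  also have "\<dots> = (\<integral>\<^sup>+s. \<integral>\<^sup>+r. \<integral>\<^sup>+z. \<integral>\<^sup>+z'. \<Phi> s r z z' \<partial>count_space (-{y}) \<partial>count_space (-{x}) \<partial>lborel \<partial>lborel)"
    by (rule nn_integral_cong, rule nn_integral_count_space_nn_integral[symmetric]) auto
  also have "\<dots> = (\<integral>\<^sup>+r. \<integral>\<^sup>+s. \<integral>\<^sup>+z. \<integral>\<^sup>+z'. \<Phi> s r z z' \<partial>count_space (-{y}) \<partial>count_space (-{x}) \<partial>lborel \<partial>lborel)"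
    by (rule lborel_pair.Fubini') (unfold case_prod_unfold, measurable)
  also have "\<dots> = (\<integral>\<^sup>+r. \<integral>\<^sup>+s. \<integral>\<^sup>+z'. \<integral>\<^sup>+z. \<Phi> s r z z' \<partial>count_space (-{x}) \<partial>count_space (-{y}) \<partial>lborel \<partial>lborel)"
    by (intro nn_integral_cong, rule nn_integral_count_space_nn_integral) auto
  also have "\<dots> = (\<integral>\<^sup>+r. \<integral>\<^sup>+z'. \<integral>\<^sup>+s. \<integral>\<^sup>+z. \<Phi> s r z z' \<partial>count_space (-{x}) \<partial>lborel \<partial>count_space (-{y}) \<partial>lborel)"
    by (rule nn_integral_cong, rule nn_integral_count_space_nn_integral) auto
  also have "\<dots> = last_jump q (\<lambda>t x z. first_jump q (\<lambda>t z'. v t z' z) t x) t x y"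
    unfolding first_jump_def last_jump_def
    apply (rule nn_integral_cong)
    apply (subst nn_integral_cmult[symmetric], simp)
    apply (subst nn_integral_multc[symmetric], simp)
    apply (rule nn_integral_cong)
    apply (subst nn_integral_cmult[symmetric], measurable)
    apply (subst nn_integral_cmult[symmetric], measurable)
    apply (subst nn_integral_multc[symmetric], measurable)
    apply (rule nn_integral_cong)
    apply (subst nn_integral_cmult[symmetric], simp)
    apply (subst nn_integral_multc[symmetric], simp)
    apply (subst nn_integral_cmult[symmetric], simp)
    apply (subst nn_integral_cmult[symmetric], simp)
    apply (subst nn_integral_multc[symmetric], simp)
    apply (rule nn_integral_cong)
    apply (auto simp: \<Phi>_def mult_ac algebra_simps split: split_indicator)
    done
  finally show ?thesis .
qed

lemma first_jump_stay_eq_last_jump_stay: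
  fixes q :: "'s::countable \<Rightarrow> 's \<Rightarrow> real"
  shows "first_jump q (\<lambda>t z. ennreal (exp (q z z * t)) * indicator {y} z) t x =
    last_jump q (\<lambda>t x z. ennreal (exp (q x x * t)) * indicator {z} x) t x y"
proof -
  have 1: "(\<integral>\<^sup>+ z. ennreal (q x z) * (ennreal (exp (q z z * (t - s))) * indicator {y} z) \<partial>count_space (- {x}))
     = ennreal (exp (q y y * (t - s))) * (if x = y then 0 else ennreal (q x y))" for s
    by (subst nn_integral_count_space'[where A="{y} - {x}"]) (auto simp: mult_ac)
  have 2: "(\<integral>\<^sup>+ z. ennreal (q z y) * (ennreal (exp (q x x * (t - s))) * indicator {z} x) \<partial>count_space (- {y}))
     = ennreal (exp (q x x * (t - s))) * (if x = y then 0 else ennreal (q x y))" for s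
    by (subst nn_integral_count_space'[where A="{x} - {y}"]) (auto simp: mult_ac)
  show ?thesis
    unfolding first_jump_def last_jump_def 1 2
    by (subst nn_integral_real_affine[where c="-1" and t=t])
      (auto intro!: nn_integral_cong simp: mult_ac split: split_indicator)
qed

text \<open>The recursion that conditions on the last jump produces the same iterates. In the induction the first-jump
  recursion is used on the outside and the last-jump recursion on the inside.\<close>

lemma feller_iter_last_jump:
  fixes q :: "'s::countable \<Rightarrow> 's \<Rightarrow> real"
  shows "feller_iter q (Suc n) t x y =
    ennreal (exp (q x x * t)) * indicator {y} x + last_jump q (feller_iter q n) t x y"
proof (induction n arbitrary: t x)
  case 0
  then show ?case by (simp add: last_jump_def)
next
  case (Suc n)
  let ?E = "\<lambda>t x y. ennreal (exp (q x x * t)) * indicator {y} x"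
  have lj_add: "last_jump q (\<lambda>t x z. u t x z + v t x z) t x y = last_jump q u t x y + last_jump q v t x y"
    if [measurable]: "\<And>x y. (\<lambda>t. u t x y) \<in> borel_measurable borel" "\<And>x y. (\<lambda>t. v t x y) \<in> borel_measurable borel"
    for u v
    unfolding last_jump_def
    by (subst nn_integral_add[symmetric]) (auto simp: nn_integral_add distrib_left distrib_right)
  have lj_meas [measurable]: "(\<lambda>t. last_jump q (feller_iter q n) t x y) \<in> borel_measurable borel" for x y
  proof -
    have ind: "indicator {0..t} s = (if 0 \<le> s \<and> s \<le> t then 1 else (0::ennreal))" for s t :: real
      by (auto split: split_indicator)
    show ?thesis unfolding last_jump_def ind by measurable
  qed
  have "feller_iter q (Suc (Suc n)) t x y = ?E t x y + first_jump q (\<lambda>t z. feller_iter q (Suc n) t z y) t x"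
    by (rule feller_iter_Suc)
  also have "first_jump q (\<lambda>t z. feller_iter q (Suc n) t z y) t x =
      first_jump q (\<lambda>t z. ?E t z y + last_jump q (feller_iter q n) t z y) t x"
    by (simp only: Suc.IH)
  also have "\<dots> = last_jump q ?E t x y + last_jump q (\<lambda>t x z. first_jump q (\<lambda>t z'. feller_iter q n t z' z) t x) t x y"
    by (subst first_jump_add) (simp_all add: first_jump_stay_eq_last_jump_stay first_jump_last_jump_commute)
  also have "\<dots> = last_jump q (feller_iter q (Suc n)) t x y"
    by (subst lj_add[symmetric]) (simp_all add: feller_iter_Suc[abs_def] del: feller_iter.simps)
  finally show ?case .
qed

text \<open>By detailed balance, weighting the last-jump recursion by \<open>w\<close> at the starting point gives the
  first-jump recursion of the reversed path.\<close>

lemma feller_iter_reversible: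
  fixes q :: "'s::countable \<Rightarrow> 's \<Rightarrow> real"
  assumes w: "\<And>x. 0 < w x" and db: "\<And>x y. w x * q x y = w y * q y x"
  shows "ennreal (w x) * feller_iter q n t x y = ennreal (w y) * feller_iter q n t y x"
proof (induction n arbitrary: t x y)
  case (Suc n)
  have db': "ennreal (w z) * ennreal (q z y) = ennreal (w y) * ennreal (q y z)" for z y
    using w by (simp add: db ennreal_mult'[symmetric] less_imp_le)
  have "ennreal (w x) * last_jump q (feller_iter q n) t x y = 
     (\<integral>\<^sup>+ s. ennreal (exp (q y y * s)) *
        (\<integral>\<^sup>+ z. ennreal (q z y) * (ennreal (w x) * feller_iter q n (t - s) x z) \<partial>count_space (- {y}))
        * indicator {0..t} s \<partial>lborel)"
    unfolding last_jump_def
    by (subst nn_integral_cmult[symmetric]) (auto simp: nn_integral_cmult[symmetric] mult_ac)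
  also have "\<dots> = (\<integral>\<^sup>+ s. ennreal (exp (q y y * s)) *
        (\<integral>\<^sup>+ z. ennreal (w y) * (ennreal (q y z) * feller_iter q n (t - s) z x) \<partial>count_space (- {y}))
        * indicator {0..t} s \<partial>lborel)"
    by (simp only: Suc.IH[of x] mult.assoc[symmetric] mult.commute[of "ennreal (q _ y)"] db')
  also have "\<dots> = ennreal (w y) * first_jump q (\<lambda>t z. feller_iter q n t z x) t y"
    unfolding first_jump_def
    by (subst nn_integral_cmult[symmetric]) (auto simp: nn_integral_cmult mult_ac)
  finally have *: "ennreal (w x) * last_jump q (feller_iter q n) t x y =
      ennreal (w y) * first_jump q (\<lambda>t z. feller_iter q n t z x) t y" .
  show ?case
    by (subst feller_iter_last_jump, subst feller_iter_Suc)
      (auto simp: distrib_left * split: split_indicator)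
qed simp

lemma feller_lim_reversible:
  fixes q :: "'s::countable \<Rightarrow> 's \<Rightarrow> real"
  assumes w: "\<And>x. 0 < w x" and db: "\<And>x y. w x * q x y = w y * q y x"
  shows "ennreal (w x) * feller_lim q t x y = ennreal (w y) * feller_lim q t y x"
  unfolding feller_lim_def SUP_mult_left_ennreal
  by (simp only: feller_iter_reversible[of w q, OF w db])

section \<open>Uniqueness for the backward equation under a Lyapunov function\<close>

definition rate_apply :: "('s \<Rightarrow> 's \<Rightarrow> real) \<Rightarrow> ('s \<Rightarrow> real) \<Rightarrow> 's \<Rightarrow> real" where
  "rate_apply q f x = (\<Sum>y | q x y \<noteq> 0. q x y * f y)"

text \<open>The Lyapunov function \<open>V\<close> with finite sublevel sets rules out explosion: along the chain,
  \<open>exp (- K * t) * V\<close> is a supermartingale.\<close>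

locale nonexplosive_chain =
  fixes q :: "'s::countable \<Rightarrow> 's \<Rightarrow> real" and V :: "'s \<Rightarrow> real" and K :: real
  assumes rate_nonneg: "x \<noteq> y \<Longrightarrow> 0 \<le> q x y"
    and finite_row: "finite {y. q x y \<noteq> 0}"
    and row_sum: "(\<Sum>y | q x y \<noteq> 0. q x y) = 0"
    and V_pos: "0 < V x"
    and V_sublevel: "finite {x. V x \<le> a}"
    and K_nonneg: "0 \<le> K"
    and Lyapunov: "rate_apply q V x \<le> K * V x"
begin

lemma diag_nonpos: "q x x \<le> 0"
proof (cases "q x x = 0")
  case False
  have "0 = q x x + (\<Sum>y\<in>{y. q x y \<noteq> 0} - {x}. q x y)"
    using row_sum[of x] False finite_row[of x] by (subst (asm) sum.remove[of _ x]) auto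
  moreover have "0 \<le> (\<Sum>y\<in>{y. q x y \<noteq> 0} - {x}. q x y)"
    by (intro sum_nonneg rate_nonneg) auto
  ultimately show ?thesis by linarith
qed simp

lemma rate_apply_off_diagonal:
  "(\<Sum>z\<in>{z. q x z \<noteq> 0} - {x}. q x z * g z) = rate_apply q g x - q x x * g x"
  unfolding rate_apply_def using finite_row[of x]
  by (cases "q x x = 0") (auto simp: sum_diff1)

lemma nn_integral_off_diagonal:
  assumes "\<And>z. 0 \<le> g z"
  shows "(\<integral>\<^sup>+ z. ennreal (q x z) * ennreal (g z) \<partial>count_space (- {x})) = ennreal (rate_apply q g x - q x x * g x)"
proof -
  have "(\<integral>\<^sup>+ z. ennreal (q x z) * ennreal (g z) \<partial>count_space (- {x})) =
      (\<Sum>z\<in>{z. q x z \<noteq> 0} - {x}. ennreal (q x z) * ennreal (g z))"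
    by (rule nn_integral_count_space') (use finite_row in auto)
  also have "\<dots> = (\<Sum>z\<in>{z. q x z \<noteq> 0} - {x}. ennreal (q x z * g z))"
  proof (intro sum.cong refl)
    fix z assume "z \<in> {z. q x z \<noteq> 0} - {x}"
    then have "0 \<le> q x z" by (intro rate_nonneg) auto
    then show "ennreal (q x z) * ennreal (g z) = ennreal (q x z * g z)"
      using assms by (simp add: ennreal_mult)
  qed
  also have "\<dots> = ennreal (\<Sum>z\<in>{z. q x z \<noteq> 0} - {x}. q x z * g z)"
    by (rule sum_ennreal) (use assms rate_nonneg in \<open>auto intro!: mult_nonneg_nonneg\<close>)
  finally show ?thesis by (simp add: rate_apply_off_diagonal)
qed

lemma off_diagonal_nonneg:
  assumes "\<And>z. 0 \<le> g z" shows "0 \<le> rate_apply q g x - q x x * g x"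
  unfolding rate_apply_off_diagonal[symmetric]
  by (intro sum_nonneg mult_nonneg_nonneg assms rate_nonneg) auto

text \<open>The derivative of \<open>s \<mapsto> exp (q x x * s) * u (t - s) x\<close> is minus the integrand of
  \<open>first_jump\<close>.\<close>

lemma first_jump_of_solution:
  fixes u :: "real \<Rightarrow> 's \<Rightarrow> real"
  assumes nonneg: "\<And>t x. 0 \<le> t \<Longrightarrow> 0 \<le> u t x"
    and deriv: "\<And>t x. ((\<lambda>t. u t x) has_real_derivative rate_apply q (u t) x) (at t)"
    and t: "0 \<le> t"
  shows "ennreal (u t x) = ennreal (exp (q x x * t)) * ennreal (u 0 x) + first_jump q (\<lambda>t z. ennreal (u t z)) t x"
proof -
  define f where "f s = exp (q x x * s) * (rate_apply q (u (t - s)) x - q x x * u (t - s) x)" for s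
  define F where "F s = - (exp (q x x * s) * u (t - s) x)" for s
  have contu: "continuous_on UNIV (\<lambda>t. u t z)" for z
    by (intro continuous_at_imp_continuous_on ballI DERIV_isCont[OF deriv])
  have contu': "continuous_on UNIV (\<lambda>s. u (t - s) z)" for z
    by (rule continuous_on_compose2[OF contu]) (auto intro!: continuous_intros)
  have "continuous_on UNIV f"
    unfolding f_def rate_apply_def by (intro continuous_intros contu')
  then have [measurable]: "f \<in> borel_measurable borel"
    by (rule borel_measurable_continuous_onI)
  have dF: "DERIV F s :> f s" for s
  proof -
    have 1: "((\<lambda>s. u (t - s) x) has_real_derivative - rate_apply q (u (t - s)) x) (at s)"
    proof -
      have "((\<lambda>s. t - s) has_real_derivative - 1) (at s)" by (auto intro!: derivative_eq_intros)
      from DERIV_chain2[where f="\<lambda>t. u t x" and g="\<lambda>s. t - s", OF deriv this]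
      show ?thesis by simp
    qed
    show ?thesis unfolding F_def f_def
      by (rule derivative_eq_intros 1 refl)+ (simp add: algebra_simps)
  qed
  have f0: "0 \<le> f s" if "s \<in> {0..t}" for s
    unfolding f_def using that nonneg by (intro mult_nonneg_nonneg off_diagonal_nonneg) auto
  have "first_jump q (\<lambda>t z. ennreal (u t z)) t x = (\<integral>\<^sup>+ s. ennreal (f s) * indicator {0..t} s \<partial>lborel)"
    unfolding first_jump_def
  proof (rule nn_integral_cong)
    fix s
    show "ennreal (exp (q x x * s)) * (\<integral>\<^sup>+ z. ennreal (q x z) * ennreal (u (t - s) z) \<partial>count_space (- {x})) *
        indicator {0..t} s = ennreal (f s) * indicator {0..t} s"
      by (cases "s \<in> {0..t}") (auto simp: f_def nn_integral_off_diagonal nonneg ennreal_mult' off_diagonal_nonneg)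
  qed
  also have "\<dots> = ennreal (F t - F 0)"
    by (rule nn_integral_FTC_Icc) (use dF f0 t in auto)
  also have "F t - F 0 = u t x - exp (q x x * t) * u 0 x"
    by (simp add: F_def)
  finally have fj: "first_jump q (\<lambda>t z. ennreal (u t z)) t x = ennreal (u t x - exp (q x x * t) * u 0 x)" .
  have "F 0 \<le> F t"
    by (rule DERIV_nonneg_imp_nondecreasing[OF t]) (use dF f0 in auto)
  then have "0 \<le> u t x - exp (q x x * t) * u 0 x" by (simp add: F_def)
  then show ?thesis
    unfolding fj using nonneg[of 0 x] by (simp add: ennreal_mult'[symmetric] ennreal_plus[symmetric] del: ennreal_plus)
qed

text \<open>The subtracted exponential is what makes \<open>first_jump\<close> a strict contraction in the norm weighted
  by \<open>exp (K * t) * V\<close> wherever \<open>q x x\<close> is bounded from below.\<close>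

lemma first_jump_Lyapunov:
  assumes t: "0 \<le> t"
  shows "first_jump q (\<lambda>t z. ennreal (exp (K * t) * V z)) t x \<le> ennreal ((exp (K * t) - exp (q x x * t)) * V x)"
proof -
  define f where "f s = exp (K * t) * (exp ((q x x - K) * s) * ((K - q x x) * V x))" for s
  have "first_jump q (\<lambda>t z. ennreal (exp (K * t) * V z)) t x \<le> (\<integral>\<^sup>+ s. ennreal (f s) * indicator {0..t} s \<partial>lborel)"
    unfolding first_jump_def
  proof (rule nn_integral_mono)
    fix s
    have "rate_apply q (\<lambda>z. exp (K * (t - s)) * V z) x = exp (K * (t - s)) * rate_apply q V x"
      by (simp add: rate_apply_def sum_distrib_left mult_ac)
    also have "\<dots> \<le> exp (K * (t - s)) * (K * V x)"
      using Lyapunov by simp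
    finally have "exp (q x x * s) * (rate_apply q (\<lambda>z. exp (K * (t - s)) * V z) x - q x x * (exp (K * (t - s)) * V x)) \<le> 
      exp (q x x * s) * (exp (K * (t - s)) * (K * V x) - q x x * (exp (K * (t - s)) * V x))"
      by simp
    also have "\<dots> = f s"
      unfolding f_def by (simp add: exp_diff[symmetric] exp_add algebra_simps exp_minus) (simp add: field_simps exp_diff exp_add)
    finally show "ennreal (exp (q x x * s)) * (\<integral>\<^sup>+ z. ennreal (q x z) * ennreal (exp (K * (t - s)) * V z) \<partial>count_space (- {x})) *
        indicator {0..t} s \<le> ennreal (f s) * indicator {0..t} s"
      using V_pos by (subst nn_integral_off_diagonal)
        (auto simp: less_imp_le ennreal_mult'[symmetric] off_diagonal_nonneg intro!: mult_right_mono ennreal_leI)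
  qed
  also have "\<dots> = ennreal (- exp (K * t) * exp ((q x x - K) * t) * V x - (- exp (K * t) * exp ((q x x - K) * 0) * V x))"
  proof (rule nn_integral_FTC_Icc)
    show "DERIV (\<lambda>s. - exp (K * t) * exp ((q x x - K) * s) * V x) s :> f s" for s
      unfolding f_def by (auto intro!: derivative_eq_intros simp: algebra_simps)
    show "0 \<le> f s" for s
      unfolding f_def using K_nonneg diag_nonpos[of x] V_pos[of x] by (intro mult_nonneg_nonneg) auto
  qed (use t in \<open>auto simp: f_def\<close>)
  also have "- exp (K * t) * exp ((q x x - K) * t) * V x - (- exp (K * t) * exp ((q x x - K) * 0) * V x)
     = (exp (K * t) - exp (q x x * t)) * V x"
    by (simp add: exp_add[symmetric] algebra_simps)
  finally show ?thesis .
qed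

text \<open>Minimality gives one inequality. For the other one, suppose that \<open>u\<close> exceeds the minimal solution
  \<open>G\<close> by at most \<open>a * W\<close> with \<open>W = exp (K * t) * V\<close>. Off a finite set,
  \<open>u \<le> \<epsilon> * W\<close> because \<open>U\<close> is small compared with \<open>V\<close>. On the
  finite set the exit rates are bounded, so inserting the bound into the first-jump equation improves
  \<open>a\<close> by a factor \<open>1 - \<delta>\<close>. Iterating leaves the excess
  \<open>\<epsilon> * W\<close>.\<close>

lemma backward_equation_unique:
  fixes u :: "real \<Rightarrow> 's \<Rightarrow> ennreal"
  assumes sol: "\<And>t x. 0 \<le> t \<Longrightarrow> u t x = ennreal (exp (q x x * t)) * f x + first_jump q u t x"
    and bound: "\<And>t x. 0 \<le> t \<Longrightarrow> u t x \<le> ennreal (U x)"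
    and small: "\<And>\<epsilon>. 0 < \<epsilon> \<Longrightarrow> finite {x. \<epsilon> * V x < U x}"
    and t: "0 \<le> t"
  shows "feller_apply q f t x = u t x"
proof (rule antisym)
  show "feller_apply q f t x \<le> u t x"
    by (rule feller_apply_le_supersolution) (use sol t in auto)
  define T where "T = t"
  let ?G = "feller_apply q f"
  define W where "W t x = ennreal (exp (K * t) * V x)" for t x
  have [measurable]: "(\<lambda>t. W t x) \<in> borel_measurable borel" for x
    unfolding W_def by measurable
  have VW: "ennreal (V x) \<le> W t x" if "0 \<le> t" for t x
    unfolding W_def using V_pos[of x] K_nonneg that by (intro ennreal_leI) auto
  have "u T x \<le> ?G T x + ennreal \<epsilon> * W T x" if \<epsilon>: "0 < \<epsilon>" for \<epsilon>
  proof -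
    define S where "S = {x. \<epsilon> * V x < U x}"
    have finS: "finite S" unfolding S_def by (rule small[OF \<epsilon>])
    obtain m where m: "0 \<le> m" "\<And>x. x \<in> S \<Longrightarrow> - q x x \<le> m"
    proof
      show "- q x x \<le> (\<Sum>x\<in>S. - q x x)" if "x \<in> S" for x
        by (rule member_le_sum) (use that finS diag_nonpos in auto)
      show "0 \<le> (\<Sum>x\<in>S. - q x x)"
        by (rule sum_nonneg) (use diag_nonpos in auto)
    qed
    \<comment> \<open>On the finite set and up to time \<open>T\<close>, this is a lower bound for the ratio of
      \<open>exp (q x x * t)\<close> to \<open>exp (K * t)\<close>.\<close>
    define \<delta> where "\<delta> = exp (- (K + m) * T)"
    have \<delta>: "0 < \<delta>" "\<delta> \<le> 1" unfolding \<delta>_def using m(1) K_nonneg t by (auto simp: T_def mult_nonpos_nonneg)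
    \<comment> \<open>A starting value for the iteration: \<open>U \<le> \<epsilon> * V\<close> off the finite set, and on it
      \<open>U / V\<close> is bounded.\<close>
    obtain r0 where r0: "0 \<le> r0" "\<And>x. U x \<le> max \<epsilon> r0 * V x"
    proof
      let ?r = "\<Sum>x\<in>S. \<bar>U x\<bar> / V x"
      show "0 \<le> ?r" using V_pos by (intro sum_nonneg) (auto simp: less_imp_le)
      show "U x \<le> max \<epsilon> ?r * V x" for x
      proof (cases "x \<in> S")
        case True
        have "\<bar>U x\<bar> / V x \<le> ?r"
          by (rule member_le_sum) (use True finS V_pos in \<open>auto simp: less_imp_le\<close>)
        then have "\<bar>U x\<bar> \<le> ?r * V x" using V_pos[of x] by (simp add: field_simps)
        also have "\<dots> \<le> max \<epsilon> ?r * V x" using V_pos[of x] by (intro mult_right_mono) auto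
        finally show ?thesis by linarith
      next
        case False
        then have "U x \<le> \<epsilon> * V x" by (simp add: S_def)
        also have "\<dots> \<le> max \<epsilon> ?r * V x" using V_pos[of x] by (intro mult_right_mono) auto
        finally show ?thesis .
      qed
    qed
    have step: "u t x \<le> ?G t x + ennreal (max \<epsilon> ((1 - \<delta>) ^ n * r0)) * W t x" if "0 \<le> t" "t \<le> T" for n t x
      using that
    proof (induction n arbitrary: t x)
      case 0
      have "u t x \<le> ennreal (max \<epsilon> r0 * V x)"
        by (rule order_trans[OF bound ennreal_leI]) (use 0 r0 in auto)
      also have "\<dots> = ennreal (max \<epsilon> r0) * ennreal (V x)"
        using \<epsilon> by (intro ennreal_mult') auto
      also have "\<dots> \<le> ennreal (max \<epsilon> r0) * W t x"
        by (intro mult_left_mono VW 0) auto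
      finally show ?case by (simp add: add_increasing)
    next
      case (Suc n)
      let ?r = "max \<epsilon> ((1 - \<delta>) ^ n * r0)"
      have r: "0 \<le> ?r" using \<epsilon> by auto
      show ?case
      proof (cases "x \<in> S")
        case False
        have "u t x \<le> ennreal (\<epsilon> * V x)"
          by (rule order_trans[OF bound ennreal_leI]) (use False Suc.prems in \<open>auto simp: S_def\<close>)
        also have "\<dots> = ennreal \<epsilon> * ennreal (V x)"
          using \<epsilon> by (intro ennreal_mult') auto
        also have "\<dots> \<le> ennreal (max \<epsilon> ((1 - \<delta>) ^ Suc n * r0)) * W t x"
          by (rule mult_mono[OF ennreal_leI VW[OF Suc.prems(1)]]) auto
        finally show ?thesis by (simp add: add_increasing)
      next
        case True
        have "(1 - \<delta>) * ?r \<le> max \<epsilon> ((1 - \<delta>) ^ Suc n * r0)"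
        proof (cases "\<epsilon> \<le> (1 - \<delta>) ^ n * r0")
          case False
          have "(1 - \<delta>) * \<epsilon> \<le> 1 * \<epsilon>" using \<delta> \<epsilon> by (intro mult_right_mono) auto
          then show ?thesis using False by auto
        qed (auto simp: max_def mult_ac)
        have "exp (K * t) - exp (q x x * t) \<le> (1 - \<delta>) * exp (K * t)"
        proof -
          have "- m * t \<le> q x x * t" using m(2)[OF True] Suc.prems by (intro mult_right_mono) auto
          moreover have "- (K + m) * T \<le> - (K + m) * t"
            using Suc.prems m(1) K_nonneg by (intro mult_left_mono_neg) auto
          ultimately have "- (K + m) * T + K * t \<le> q x x * t"
            by (simp add: algebra_simps)
          then have "\<delta> * exp (K * t) \<le> exp (q x x * t)"
            unfolding \<delta>_def exp_add[symmetric] by (subst exp_le_cancel_iff)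
          then show ?thesis by (simp add: algebra_simps)
        qed
        then have le: "(exp (K * t) - exp (q x x * t)) * V x \<le> (1 - \<delta>) * (exp (K * t) * V x)"
          using V_pos[of x] mult_right_mono[of _ _ "V x"] by (fastforce simp: mult_ac)
        have "first_jump q W t x \<le> ennreal ((1 - \<delta>) * (exp (K * t) * V x))"
          unfolding W_def by (rule order_trans[OF first_jump_Lyapunov ennreal_leI[OF le]]) (use Suc.prems in auto)
        also have "\<dots> = ennreal (1 - \<delta>) * W t x"
          unfolding W_def using \<delta> by (intro ennreal_mult') auto
        finally have fW: "first_jump q W t x \<le> ennreal (1 - \<delta>) * W t x" .
        have "u t x = ennreal (exp (q x x * t)) * f x + first_jump q u t x"
          using sol Suc.prems by auto
        also have "\<dots> \<le> ennreal (exp (q x x * t)) * f x + first_jump q (\<lambda>t z. ?G t z + ennreal ?r * W t z) t x"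
          by (intro add_left_mono first_jump_mono Suc.IH) (use Suc.prems in auto)
        also have "\<dots> = ?G t x + ennreal ?r * first_jump q W t x"
          by (subst first_jump_add, measurable, subst first_jump_cmult, measurable)
            (simp add: feller_apply_first_jump[of q f t x] add.assoc)
        also have "\<dots> \<le> ?G t x + ennreal ?r * (ennreal (1 - \<delta>) * W t x)"
          by (intro add_left_mono mult_left_mono fW) auto
        also have "\<dots> = ?G t x + ennreal ((1 - \<delta>) * ?r) * W t x"
          using \<delta> by (simp add: ennreal_mult' mult_ac)
        also have "\<dots> \<le> ?G t x + ennreal (max \<epsilon> ((1 - \<delta>) ^ Suc n * r0)) * W t x"
          by (intro add_left_mono mult_right_mono ennreal_leI zero_le) fact
        finally show ?thesis .
      qed
    qed
    have "(\<lambda>n. (1 - \<delta>) ^ n * r0) \<longlonglongrightarrow> 0 * r0"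
      using \<delta> by (intro tendsto_mult tendsto_const LIMSEQ_power_zero) auto
    then have "\<forall>\<^sub>F n in sequentially. (1 - \<delta>) ^ n * r0 < \<epsilon>"
      using \<epsilon> by (intro order_tendstoD) auto
    then obtain n where n: "(1 - \<delta>) ^ n * r0 < \<epsilon>"
      by (auto simp: eventually_sequentially)
    show ?thesis using step[of T x n] n t by (simp add: T_def max_def)
  qed
  note le = this
  show "u t x \<le> ?G t x"
  proof (rule ennreal_le_epsilon)
    fix e :: real assume e: "0 < e"
    have c: "0 < exp (K * T) * V x" using V_pos by simp
    have "u T x \<le> ?G T x + ennreal (e / (exp (K * T) * V x)) * W T x"
      by (rule le) (use e c in auto)
    also have "ennreal (e / (exp (K * T) * V x)) * W T x = ennreal e"
      unfolding W_def using c e by (subst ennreal_mult'[symmetric]) (auto simp: less_imp_le)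
    finally show "u t x \<le> ?G t x + ennreal e" by (simp add: T_def)
  qed
qed

lemma finite_bounded_over_V: "0 < \<epsilon> \<Longrightarrow> finite {x. \<epsilon> * V x < c}"
  by (rule finite_subset[OF _ V_sublevel[of "c / \<epsilon>"]]) (auto simp: field_simps)

lemma feller_apply_one:
  assumes "0 \<le> t" shows "feller_apply q (\<lambda>_. 1) t x = 1"
proof (rule backward_equation_unique[where U="\<lambda>_. 1"])
  show "(1::ennreal) = ennreal (exp (q x x * t)) * 1 + first_jump q (\<lambda>_ _. 1) t x" if "0 \<le> t" for t x
    using first_jump_of_solution[of "\<lambda>_ _. 1" t x] that
    by (simp add: rate_apply_def row_sum)
qed (use assms finite_bounded_over_V in auto)

lemma feller_lim_le_1: "0 \<le> t \<Longrightarrow> feller_lim q t x y \<le> 1"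
proof -
  assume t: "0 \<le> t"
  have "feller_lim q t x y = feller_apply q (indicator {y}) t x" by (rule feller_lim_eq_apply)
  also have "\<dots> \<le> feller_apply q (\<lambda>_. 1) t x"
    unfolding feller_apply_def by (intro nn_integral_mono mult_left_mono) (auto split: split_indicator)
  finally show ?thesis using feller_apply_one[OF t] by simp
qed

text \<open>The first-jump equation at time \<open>t + s\<close>, split according to whether the first jump happens before
  \<open>t\<close>: the later part is \<open>exp (q x x * t)\<close> times the first-jump integral at time
  \<open>s\<close>. So \<open>t \<mapsto> feller_lim q (t + s)\<close> solves the backward equation with initial
  value \<open>feller_lim q s\<close>, which gives the semigroup property by uniqueness.\<close>

lemma feller_lim_shift:
  assumes t: "0 \<le> t" and s: "0 \<le> s"
  shows "feller_lim q (t + s) x y =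
    ennreal (exp (q x x * t)) * feller_lim q s x y + first_jump q (\<lambda>t z. feller_lim q (t + s) z y) t x"
proof -
  define g where "g r = ennreal (exp (q x x * r)) *
        (\<integral>\<^sup>+ z. ennreal (q x z) * feller_lim q (t + s - r) z y \<partial>count_space (- {x}))" for r
  have [measurable]: "g \<in> borel_measurable borel" unfolding g_def by measurable
  have "first_jump q (\<lambda>t z. feller_lim q t z y) (t + s) x = (\<integral>\<^sup>+ r. g r * indicator {0..t + s} r \<partial>lborel)"
    by (simp add: first_jump_def g_def)
  also have "\<dots> = (\<integral>\<^sup>+ r. g r * indicator {0..<t} r + g r * indicator {t..t + s} r \<partial>lborel)"
    using t s by (intro nn_integral_cong) (auto split: split_indicator)
  also have "\<dots> = (\<integral>\<^sup>+ r. g r * indicator {0..<t} r \<partial>lborel) + (\<integral>\<^sup>+ r. g r * indicator {t..t + s} r \<partial>lborel)"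
    by (rule nn_integral_add) auto
  also have "(\<integral>\<^sup>+ r. g r * indicator {0..<t} r \<partial>lborel) = first_jump q (\<lambda>t z. feller_lim q (t + s) z y) t x"
    unfolding first_jump_def
    by (rule nn_integral_cong_AE, rule AE_mp[OF AE_lborel_singleton[of t]], rule AE_I2)
      (auto simp: g_def algebra_simps split: split_indicator)
  also have "(\<integral>\<^sup>+ r. g r * indicator {t..t + s} r \<partial>lborel) =
      ennreal (exp (q x x * t)) * first_jump q (\<lambda>t z. feller_lim q t z y) s x"
    unfolding first_jump_def
    by (subst nn_integral_real_affine[where c=1 and t=t], measurable)
      (auto simp: nn_integral_cmult[symmetric] g_def distrib_left distrib_right exp_add ennreal_mult' mult_ac intro!: nn_integral_cong split: split_indicator)
  finally have *: "first_jump q (\<lambda>t z. feller_lim q t z y) (t + s) x = first_jump q (\<lambda>t z. feller_lim q (t + s) z y) t x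
     + ennreal (exp (q x x * t)) * first_jump q (\<lambda>t z. feller_lim q t z y) s x" .
  show ?thesis
    unfolding feller_lim_first_jump[of q "t + s"] * feller_lim_first_jump[of q s]
    by (simp add: distrib_left distrib_right exp_add ennreal_mult' add_ac mult_ac)
qed

lemma Chapman_Kolmogorov_feller_lim:
  assumes t: "0 \<le> t" and s: "0 \<le> s"
  shows "feller_apply q (\<lambda>z. feller_lim q s z y) t x = feller_lim q (t + s) x y"
proof (rule backward_equation_unique[where U="\<lambda>_. 1" and u="\<lambda>t z. feller_lim q (t + s) z y"])
  show "feller_lim q (t + s) x y \<le> ennreal 1" if "0 \<le> t" for t x
    using feller_lim_le_1[of "t + s" x y] that s by simp
  show "feller_lim q (t + s) x y = ennreal (exp (q x x * t)) * feller_lim q s x y +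
      first_jump q (\<lambda>t z. feller_lim q (t + s) z y) t x" if "0 \<le> t" for t x
    by (rule feller_lim_shift[OF that s])
qed (use t finite_bounded_over_V in auto)

end

section \<open>Weighted square-summable functions\<close>

lemma ennreal_power2_le_imp_le:
  fixes a :: ennreal
  assumes "a\<^sup>2 \<le> ennreal (b\<^sup>2)" "0 \<le> b"
  shows "a \<le> ennreal b"
proof (cases a)
  case (real r)
  then have "r\<^sup>2 \<le> b\<^sup>2" using assms by (simp add: ennreal_power)
  then show ?thesis using real assms(2) by (auto intro!: ennreal_leI intro: power2_le_imp_le)
next
  case top
  then show ?thesis using assms(1) by (simp add: power2_eq_square top_unique)
qed

lemma Fubini_count_space:
  fixes F :: "'a \<Rightarrow> 's::countable \<Rightarrow> complex"
  assumes M: "sigma_finite_measure M"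
    and meas: "\<And>y. (\<lambda>x. F x y) \<in> borel_measurable M"
    and fin: "(\<integral>\<^sup>+x. \<integral>\<^sup>+y. ennreal (cmod (F x y)) \<partial>count_space UNIV \<partial>M) < \<infinity>"
  shows "(\<integral>x. \<integral>y. F x y \<partial>count_space UNIV \<partial>M) = (\<integral>y. \<integral>x. F x y \<partial>M \<partial>count_space UNIV)"
    and "integrable M (\<lambda>x. \<integral>y. F x y \<partial>count_space UNIV)"
    and "integrable (count_space UNIV) (\<lambda>y. \<integral>x. F x y \<partial>M)"
proof -
  interpret M: sigma_finite_measure M by fact
  interpret C: sigma_finite_measure "count_space (UNIV :: 's set)"
    by (intro sigma_finite_measure_count_space_countable) auto
  interpret MC: pair_sigma_finite M "count_space (UNIV :: 's set)" ..
  have [measurable]: "(\<lambda>p. F (fst p) (snd p)) \<in> borel_measurable (M \<Otimes>\<^sub>M count_space UNIV)"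
    by (rule measurable_compose_countable'[where I=UNIV and f="\<lambda>z p. F (fst p) z" and g=snd])
      (auto intro: meas measurable_compose[OF measurable_fst])
  have int: "integrable (M \<Otimes>\<^sub>M count_space UNIV) (\<lambda>(x, y). F x y)"
  proof (rule integrableI_bounded)
    show "(\<integral>\<^sup>+ p. ennreal (norm (case p of (x, y) \<Rightarrow> F x y)) \<partial>(M \<Otimes>\<^sub>M count_space UNIV)) < \<infinity>"
      using fin by (subst C.nn_integral_fst[symmetric]) (auto simp: case_prod_unfold)
  qed (simp add: case_prod_unfold)
  show "(\<integral>x. \<integral>y. F x y \<partial>count_space UNIV \<partial>M) = (\<integral>y. \<integral>x. F x y \<partial>M \<partial>count_space UNIV)"
    using MC.Fubini_integral[OF int] by simp
  show "integrable M (\<lambda>x. \<integral>y. F x y \<partial>count_space UNIV)"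
    using MC.integrable_fst[OF int] by simp
  show "integrable (count_space UNIV) (\<lambda>y. \<integral>x. F x y \<partial>M)"
    using MC.integrable_snd[OF int] by simp
qed

text \<open>Positive weights make every null set empty, so that functions represent their own \<open>L\<^sup>2\<close>
  classes.\<close>

locale weighted_points =
  fixes w :: "'s::countable \<Rightarrow> real"
  assumes w_pos: "0 < w x"
begin

abbreviation M :: "'s measure" where "M \<equiv> point_measure UNIV (\<lambda>x. ennreal (w x))"

lemma measurable_M [simp]: "f \<in> borel_measurable M"
  by (simp add: point_measure_def)

lemma nn_integral_M: "(\<integral>\<^sup>+x. f x \<partial>M) = (\<integral>\<^sup>+x. ennreal (w x) * f x \<partial>count_space UNIV)"
  unfolding point_measure_def by (subst nn_integral_density) auto

lemma integral_M:
  fixes f :: "'s \<Rightarrow> 'b::{banach, second_countable_topology}"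
  shows "(\<integral>x. f x \<partial>M) = (\<integral>x. w x *\<^sub>R f x \<partial>count_space UNIV)"
  unfolding point_measure_def using w_pos by (subst integral_density) (auto simp: less_imp_le)

lemma L2_iff: "f \<in> L2 M \<longleftrightarrow> (\<integral>\<^sup>+x. ennreal ((cmod (f x))\<^sup>2) \<partial>M) < \<infinity>"
  by (simp add: L2_def integrable_iff_bounded)

lemma L2_norm_nonneg [simp]: "0 \<le> L2_norm M f"
  by (simp add: L2_norm_def)

lemma L2_norm_square: "f \<in> L2 M \<Longrightarrow> ennreal ((L2_norm M f)\<^sup>2) = (\<integral>\<^sup>+x. ennreal ((cmod (f x))\<^sup>2) \<partial>M)"
  by (simp add: L2_norm_def L2_def nn_integral_eq_integral)

lemma L2_boundI:
  assumes "(\<integral>\<^sup>+x. ennreal ((cmod (f x))\<^sup>2) \<partial>M) \<le> ennreal (B\<^sup>2)" "0 \<le> B"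
  shows "f \<in> L2 M" "L2_norm M f \<le> B"
proof -
  show "f \<in> L2 M" using assms(1) by (simp add: L2_iff order_le_less_trans)
  then have "ennreal ((L2_norm M f)\<^sup>2) \<le> ennreal (B\<^sup>2)" using assms by (simp add: L2_norm_square)
  then have "(L2_norm M f)\<^sup>2 \<le> B\<^sup>2" by simp
  then show "L2_norm M f \<le> B" using assms(2) by (rule power2_le_imp_le)
qed

lemma L2_Cauchy_Schwarz:
  assumes f: "f \<in> L2 M" and g: "g \<in> L2 M"
  shows "(\<integral>\<^sup>+x. ennreal (cmod (f x) * cmod (g x)) \<partial>M) \<le> ennreal (L2_norm M f * L2_norm M g)"
proof (rule ennreal_power2_le_imp_le)
  have "(\<integral>\<^sup>+x. ennreal (cmod (f x) * cmod (g x)) \<partial>M)\<^sup>2 = (\<integral>\<^sup>+x. ennreal (cmod (f x)) * ennreal (cmod (g x)) \<partial>M)\<^sup>2"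
    by (simp add: ennreal_mult)
  also have "\<dots> \<le> (\<integral>\<^sup>+x. ennreal (cmod (f x)) ^ 2 \<partial>M) * (\<integral>\<^sup>+x. ennreal (cmod (g x)) ^ 2 \<partial>M)"
    by (rule Cauchy_Schwarz_nn_integral) auto
  also have "\<dots> = ennreal ((L2_norm M f)\<^sup>2) * ennreal ((L2_norm M g)\<^sup>2)"
    using f g by (simp add: L2_norm_square ennreal_power)
  finally show "(\<integral>\<^sup>+x. ennreal (cmod (f x) * cmod (g x)) \<partial>M)\<^sup>2 \<le> ennreal ((L2_norm M f * L2_norm M g)\<^sup>2)"
    by (simp add: ennreal_mult power_mult_distrib)
qed simp

lemma L2_add:
  assumes f: "f \<in> L2 M" and g: "g \<in> L2 M"
  shows "(\<lambda>x. f x + g x) \<in> L2 M" "L2_norm M (\<lambda>x. f x + g x) \<le> L2_norm M f + L2_norm M g"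
proof -
  have "(\<integral>\<^sup>+x. ennreal ((cmod (f x + g x))\<^sup>2) \<partial>M) \<le>
     (\<integral>\<^sup>+x. ennreal ((cmod (f x))\<^sup>2) + ennreal ((cmod (g x))\<^sup>2) + ennreal 2 * ennreal (cmod (f x) * cmod (g x)) \<partial>M)"
  proof (rule nn_integral_mono)
    fix x
    have "(cmod (f x + g x))\<^sup>2 \<le> (cmod (f x) + cmod (g x))\<^sup>2"
      by (intro power_mono norm_triangle_ineq) auto
    also have "\<dots> = (cmod (f x))\<^sup>2 + (cmod (g x))\<^sup>2 + 2 * (cmod (f x) * cmod (g x))"
      by (simp add: power2_sum)
    finally show "ennreal ((cmod (f x + g x))\<^sup>2) \<le>
      ennreal ((cmod (f x))\<^sup>2) + ennreal ((cmod (g x))\<^sup>2) + ennreal 2 * ennreal (cmod (f x) * cmod (g x))"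
      by (subst ennreal_mult'[symmetric], simp, (subst ennreal_plus[symmetric], simp, simp)+, rule ennreal_leI)
  qed
  also have "\<dots> = ennreal ((L2_norm M f)\<^sup>2) + ennreal ((L2_norm M g)\<^sup>2) +
      ennreal 2 * (\<integral>\<^sup>+x. ennreal (cmod (f x) * cmod (g x)) \<partial>M)"
    by (simp add: nn_integral_add nn_integral_cmult L2_norm_square f g)
  also have "\<dots> \<le> ennreal ((L2_norm M f)\<^sup>2) + ennreal ((L2_norm M g)\<^sup>2) + ennreal 2 * ennreal (L2_norm M f * L2_norm M g)"
    by (intro add_left_mono mult_left_mono L2_Cauchy_Schwarz f g) auto
  also have "\<dots> = ennreal ((L2_norm M f + L2_norm M g)\<^sup>2)"
    by (subst ennreal_mult'[symmetric], simp, (subst ennreal_plus[symmetric], simp, simp)+)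
      (simp add: power2_sum mult.assoc)
  finally have *: "(\<integral>\<^sup>+x. ennreal ((cmod (f x + g x))\<^sup>2) \<partial>M) \<le> ennreal ((L2_norm M f + L2_norm M g)\<^sup>2)" .
  show "(\<lambda>x. f x + g x) \<in> L2 M" "L2_norm M (\<lambda>x. f x + g x) \<le> L2_norm M f + L2_norm M g"
    using L2_boundI[OF *] by auto
qed

lemma L2_cmult:
  assumes f: "f \<in> L2 M"
  shows "(\<lambda>x. c * f x) \<in> L2 M" "L2_norm M (\<lambda>x. c * f x) = cmod c * L2_norm M f"
proof -
  have "(\<integral>\<^sup>+x. ennreal ((cmod (c * f x))\<^sup>2) \<partial>M) = ennreal ((cmod c)\<^sup>2) * (\<integral>\<^sup>+x. ennreal ((cmod (f x))\<^sup>2) \<partial>M)"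
    by (subst nn_integral_cmult[symmetric]) (auto simp: norm_mult power_mult_distrib ennreal_mult)
  then show "(\<lambda>x. c * f x) \<in> L2 M"
    using f by (simp add: L2_iff ennreal_mult_less_top)
  show "L2_norm M (\<lambda>x. c * f x) = cmod c * L2_norm M f"
    by (simp add: L2_norm_def norm_mult power_mult_distrib real_sqrt_mult)
qed

lemma L2_uminus: "f \<in> L2 M \<Longrightarrow> (\<lambda>x. - f x) \<in> L2 M" "L2_norm M (\<lambda>x. - f x) = L2_norm M f"
  using L2_cmult(1)[of f "-1"] by (simp_all add: L2_norm_def)

lemma L2_diff:
  assumes f: "f \<in> L2 M" and g: "g \<in> L2 M"
  shows "(\<lambda>x. f x - g x) \<in> L2 M" "L2_norm M (\<lambda>x. f x - g x) \<le> L2_norm M f + L2_norm M g"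
  using L2_add[OF f L2_uminus(1)[OF g]] by (simp_all add: L2_uminus(2))

lemma L2_norm_minus_commute: "L2_norm M (\<lambda>x. f x - g x) = L2_norm M (\<lambda>x. g x - f x)"
  by (simp add: L2_norm_def norm_minus_commute)

lemma L2_zero [simp]: "(\<lambda>x. 0) \<in> L2 M" "L2_norm M (\<lambda>x. 0) = 0"
  by (auto simp: L2_iff L2_norm_def)

lemma L2_norm_0_iff: "f \<in> L2 M \<Longrightarrow> L2_norm M f = 0 \<longleftrightarrow> (\<forall>x. f x = 0)"
proof
  assume f: "f \<in> L2 M" and "L2_norm M f = 0"
  then have "(\<integral>\<^sup>+x. ennreal (w x) * ennreal ((cmod (f x))\<^sup>2) \<partial>count_space UNIV) = 0"
    using L2_norm_square[OF f] by (simp add: nn_integral_M)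
  then have "\<forall>x. ennreal (w x) * ennreal ((cmod (f x))\<^sup>2) = 0"
    by (subst (asm) nn_integral_0_iff_AE) (auto simp: AE_count_space)
  moreover have "ennreal (w x) \<noteq> 0" for x
    using w_pos[of x] by (simp add: ennreal_eq_0_iff not_le)
  ultimately show "\<forall>x. f x = 0" by (simp add: ennreal_eq_0_iff)
qed (simp add: L2_norm_def)

lemma L2_dominated:
  assumes "G \<in> L2 M" "\<And>x. cmod (f x) \<le> cmod (G x)"
  shows "f \<in> L2 M" "L2_norm M f \<le> L2_norm M G"
proof -
  have "(\<integral>\<^sup>+x. ennreal ((cmod (f x))\<^sup>2) \<partial>M) \<le> (\<integral>\<^sup>+x. ennreal ((cmod (G x))\<^sup>2) \<partial>M)"
    by (intro nn_integral_mono ennreal_leI power_mono assms) auto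
  then have *: "(\<integral>\<^sup>+x. ennreal ((cmod (f x))\<^sup>2) \<partial>M) \<le> ennreal ((L2_norm M G)\<^sup>2)"
    using assms by (simp add: L2_norm_square)
  show "f \<in> L2 M" "L2_norm M f \<le> L2_norm M G" using L2_boundI[OF *] by auto
qed

lemma L2_dominated_convergence:
  assumes G: "(\<lambda>x. complex_of_real (G x)) \<in> L2 M" and dom: "\<And>n x. cmod (f n x) \<le> G x"
    and lim: "\<And>x. (\<lambda>n. f n x) \<longlonglongrightarrow> f' x"
  shows "f' \<in> L2 M" "(\<lambda>n. L2_norm M (\<lambda>x. f n x - f' x)) \<longlonglongrightarrow> 0"
proof -
  have G0: "0 \<le> G x" for x by (rule order_trans[OF norm_ge_zero dom[of 0]])
  have dom': "cmod (f' x) \<le> G x" for x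
    by (rule Lim_bounded[OF tendsto_norm[OF lim]]) (use dom in auto)
  show "f' \<in> L2 M" by (rule L2_dominated[OF G]) (use dom' G0 in auto)
  have "(\<lambda>n. \<integral>x. (cmod (f n x - f' x))\<^sup>2 \<partial>M) \<longlonglongrightarrow> (\<integral>x. 0 \<partial>M)"
  proof (rule integral_dominated_convergence)
    show "integrable M (\<lambda>x. (2 * G x)\<^sup>2)"
      using G by (simp add: L2_def power_mult_distrib)
    show "AE x in M. (\<lambda>n. (cmod (f n x - f' x))\<^sup>2) \<longlonglongrightarrow> 0"
    proof (rule AE_I2)
      fix x
      have "(\<lambda>n. (cmod (f n x - f' x))\<^sup>2) \<longlonglongrightarrow> (cmod (f' x - f' x))\<^sup>2"
        by (intro tendsto_intros lim)
      then show "(\<lambda>n. (cmod (f n x - f' x))\<^sup>2) \<longlonglongrightarrow> 0" by simp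
    qed
    show "AE x in M. norm ((cmod (f n x - f' x))\<^sup>2) \<le> (2 * G x)\<^sup>2" for n
    proof (rule AE_I2)
      fix x
      have "cmod (f n x - f' x) \<le> 2 * G x"
        using norm_triangle_ineq4[of "f n x" "f' x"] dom[of n x] dom'[of x] by linarith
      then show "norm ((cmod (f n x - f' x))\<^sup>2) \<le> (2 * G x)\<^sup>2"
        using power_mono[of "cmod (f n x - f' x)" "2 * G x" 2] by simp
    qed
  qed auto
  from tendsto_real_sqrt[OF this] show "(\<lambda>n. L2_norm M (\<lambda>x. f n x - f' x)) \<longlonglongrightarrow> 0"
    unfolding L2_norm_def by simp
qed

text \<open>Functions of finite support are dense. Hence a property that is inherited by linear combinations and
  \<open>L\<^sup>2\<close> limits has to be checked on indicators of points only.\<close>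

lemma L2_induct [consumes 1, case_names indicator add cmult limit]:
  assumes f: "f \<in> L2 M"
    and indicator: "\<And>y. Q (indicator {y})"
    and add: "\<And>f g. f \<in> L2 M \<Longrightarrow> g \<in> L2 M \<Longrightarrow> Q f \<Longrightarrow> Q g \<Longrightarrow> Q (\<lambda>x. f x + g x)"
    and cmult: "\<And>f c. f \<in> L2 M \<Longrightarrow> Q f \<Longrightarrow> Q (\<lambda>x. c * f x)"
    and limit: "\<And>f. f \<in> L2 M \<Longrightarrow> (\<And>\<epsilon>. 0 < \<epsilon> \<Longrightarrow> \<exists>g\<in>L2 M. Q g \<and> L2_norm M (\<lambda>x. f x - g x) < \<epsilon>) \<Longrightarrow> Q f"
  shows "Q f"
proof (rule limit[OF f])
  have ind: "indicator {y} \<in> L2 M" for y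
  proof -
    have "(\<integral>\<^sup>+x. ennreal (w x) * ennreal ((cmod (indicator {y} x))\<^sup>2) \<partial>count_space UNIV) = ennreal (w y)"
      by (subst nn_integral_count_space'[where A="{y}"]) auto
    then show ?thesis by (simp add: L2_iff nn_integral_M)
  qed
  have fin: "(\<lambda>x. \<Sum>y\<in>A. f y * indicator {y} x) \<in> L2 M \<and> Q (\<lambda>x. \<Sum>y\<in>A. f y * indicator {y} x)" if "finite A" for A
    using that
  proof (induction A)
    case empty
    show ?case using cmult[OF ind indicator, of 0] by simp
  next
    case (insert a A)
    have "(\<lambda>x. f a * indicator {a} x) \<in> L2 M" "Q (\<lambda>x. f a * indicator {a} x)"
      using L2_cmult(1)[OF ind] cmult[OF ind indicator] by auto
    then show ?case
      unfolding sum.insert[OF insert.hyps] using insert.IH add L2_add(1) by blast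
  qed
  define A where "A n = {x::'s. to_nat x < n}" for n
  have finA: "finite (A n)" for n
    using finite_vimageI[OF finite_lessThan[of n] inj_to_nat[where 'a='s]]
    by (simp add: A_def vimage_def lessThan_def)
  define F where "F n = (\<lambda>x. \<Sum>y\<in>A n. f y * indicator {y} x)" for n
  have F: "F n x = (if x \<in> A n then f x else 0)" for n x
    unfolding F_def using finA[of n] by (auto simp: indicator_def if_distrib sum.delta cong: if_cong)
  have conv: "(\<lambda>n. L2_norm M (\<lambda>x. F n x - f x)) \<longlonglongrightarrow> 0"
  proof (rule L2_dominated_convergence(2)[of "\<lambda>x. cmod (f x)"])
    show "(\<lambda>x. complex_of_real (cmod (f x))) \<in> L2 M" by (rule L2_dominated(1)[OF f]) auto
    show "cmod (F n x) \<le> cmod (f x)" for n x by (simp add: F)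
    show "(\<lambda>n. F n x) \<longlonglongrightarrow> f x" for x
      by (rule tendsto_eventually) (auto simp: F A_def eventually_sequentially intro!: exI[of _ "Suc (to_nat x)"])
  qed
  fix \<epsilon> :: real assume "0 < \<epsilon>"
  then have "\<forall>\<^sub>F n in sequentially. L2_norm M (\<lambda>x. F n x - f x) < \<epsilon>"
    using conv by (intro order_tendstoD) auto
  then obtain n where "L2_norm M (\<lambda>x. F n x - f x) < \<epsilon>" by (auto simp: eventually_sequentially)
  then have "L2_norm M (\<lambda>x. f x - F n x) < \<epsilon>"
    by (subst L2_norm_minus_commute)
  then show "\<exists>g\<in>L2 M. Q g \<and> L2_norm M (\<lambda>x. f x - g x) < \<epsilon>"
    using fin[OF finA[of n]] unfolding F_def by blast
qed

end

section \<open>The semigroup of a reversible chain\<close>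

locale reversible_chain = nonexplosive_chain q V K + weighted_points w
  for q :: "'s::countable \<Rightarrow> 's \<Rightarrow> real" and V :: "'s \<Rightarrow> real" and K :: real and w :: "'s \<Rightarrow> real" +
  assumes detailed_balance: "w x * q x y = w y * q y x"
    and w_summable: "integrable (count_space UNIV) w"
begin

abbreviation p :: "real \<Rightarrow> 's \<Rightarrow> 's \<Rightarrow> real" where "p \<equiv> transition_prob q"
abbreviation P :: "real \<Rightarrow> ('s \<Rightarrow> complex) \<Rightarrow> 's \<Rightarrow> complex" where "P \<equiv> markov_semigroup q"

lemma p_nonneg [simp]: "0 \<le> p t x y"
  by (simp add: transition_prob_eq)

lemma ennreal_p: "0 \<le> t \<Longrightarrow> ennreal (p t x y) = feller_lim q t x y"
  unfolding transition_prob_eq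
  using feller_lim_le_1[of t x y] by (intro ennreal_enn2real) (auto simp: less_top[symmetric] top_unique)

lemma measurable_p [measurable]: "(\<lambda>t. p t x y) \<in> borel_measurable borel"
  unfolding transition_prob_eq by measurable

lemma p_total: "0 \<le> t \<Longrightarrow> (\<integral>\<^sup>+y. ennreal (p t x y) \<partial>count_space UNIV) = 1"
  using feller_apply_one[of t x] by (simp add: feller_apply_def ennreal_p)

lemma p_reversible: "0 \<le> t \<Longrightarrow> w x * p t x y = w y * p t y x"
proof -
  assume t: "0 \<le> t"
  have "ennreal (w x * p t x y) = ennreal (w y * p t y x)"
    using feller_lim_reversible[where w=w and q=q and t=t and x=x and y=y, OF w_pos detailed_balance] w_pos
    by (simp add: ennreal_p t ennreal_mult less_imp_le)
  then show ?thesis using w_pos[of x] w_pos[of y] by (subst (asm) ennreal_inj) (auto simp: less_imp_le)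
qed

lemma p_invariant: 
  assumes t: "0 \<le> t"
  shows "(\<integral>\<^sup>+x. ennreal (w x) * ennreal (p t x y) \<partial>count_space UNIV) = ennreal (w y)"
proof -
  have "(\<integral>\<^sup>+x. ennreal (w x) * ennreal (p t x y) \<partial>count_space UNIV) =
    (\<integral>\<^sup>+x. ennreal (w y) * ennreal (p t y x) \<partial>count_space UNIV)"
    using w_pos p_reversible[OF t, of _ y]
    by (intro nn_integral_cong) (simp add: ennreal_mult[symmetric] less_imp_le)
  also have "\<dots> = ennreal (w y)" by (simp add: nn_integral_cmult p_total t)
  finally show ?thesis .
qed

lemma Chapman_Kolmogorov:
  assumes "0 \<le> t" "0 \<le> s"
  shows "(\<integral>\<^sup>+z. ennreal (p t x z) * ennreal (p s z y) \<partial>count_space UNIV) = ennreal (p (t + s) x y)"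
  using Chapman_Kolmogorov_feller_lim[OF assms, of y x] assms by (simp add: feller_apply_def ennreal_p)

lemma p_diag: assumes "0 \<le> t" shows "exp (q x x * t) \<le> p t x x"
proof -
  have "ennreal (exp (q x x * t)) \<le> feller_lim q t x x"
    by (subst feller_lim_first_jump) simp
  then show ?thesis by (simp add: ennreal_p[OF assms, symmetric])
qed

text \<open>Jensen's inequality for the probability \<open>p t x\<close>, in the form of the Cauchy-Schwarz inequality.\<close>

lemma P_square_bound:
  assumes t: "0 \<le> t"
  shows "(\<integral>\<^sup>+y. ennreal (p t x y) * ennreal (cmod (f y)) \<partial>count_space UNIV)\<^sup>2
    \<le> (\<integral>\<^sup>+y. ennreal (p t x y) * ennreal ((cmod (f y))\<^sup>2) \<partial>count_space UNIV)"
proof -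
  have "(\<integral>\<^sup>+y. ennreal (p t x y) * ennreal (cmod (f y)) \<partial>count_space UNIV)\<^sup>2 =
    (\<integral>\<^sup>+y. ennreal (sqrt (p t x y)) * (ennreal (sqrt (p t x y)) * ennreal (cmod (f y))) \<partial>count_space UNIV)\<^sup>2"
    by (simp add: mult.assoc[symmetric] ennreal_mult[symmetric])
  also have "\<dots> \<le> (\<integral>\<^sup>+y. ennreal (sqrt (p t x y)) ^ 2 \<partial>count_space UNIV) *
     (\<integral>\<^sup>+y. (ennreal (sqrt (p t x y)) * ennreal (cmod (f y))) ^ 2 \<partial>count_space UNIV)"
    by (rule Cauchy_Schwarz_nn_integral) auto
  also have "\<dots> = (\<integral>\<^sup>+y. ennreal (p t x y) * ennreal ((cmod (f y))\<^sup>2) \<partial>count_space UNIV)"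
    by (simp add: power_mult_distrib ennreal_power p_total t)
  finally show ?thesis .
qed

text \<open>Stationarity of \<open>w\<close>, which follows from reversibility and conservation of mass.\<close>

lemma P_square_total:
  assumes t: "0 \<le> t"
  shows "(\<integral>\<^sup>+x. \<integral>\<^sup>+y. ennreal (p t x y) * g y \<partial>count_space UNIV \<partial>M) = (\<integral>\<^sup>+x. g x \<partial>M)"
proof -
  have "(\<integral>\<^sup>+x. \<integral>\<^sup>+y. ennreal (p t x y) * g y \<partial>count_space UNIV \<partial>M) =
      (\<integral>\<^sup>+x. \<integral>\<^sup>+y. ennreal (w x) * ennreal (p t x y) * g y \<partial>count_space UNIV \<partial>count_space UNIV)"
    by (simp add: nn_integral_M nn_integral_cmult[symmetric] mult.assoc)
  also have "\<dots> = (\<integral>\<^sup>+y. \<integral>\<^sup>+x. ennreal (w x) * ennreal (p t x y) * g y \<partial>count_space UNIV \<partial>count_space UNIV)"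
    by (rule nn_integral_count_space_nn_integral) auto
  also have "\<dots> = (\<integral>\<^sup>+x. g x \<partial>M)"
    by (simp add: nn_integral_M nn_integral_multc p_invariant t)
  finally show ?thesis .
qed

lemma P_abs_L2:
  assumes t: "0 \<le> t" and f: "f \<in> L2 M"
  shows "(\<integral>\<^sup>+x. (\<integral>\<^sup>+y. ennreal (p t x y) * ennreal (cmod (f y)) \<partial>count_space UNIV)\<^sup>2 \<partial>M) \<le> ennreal ((L2_norm M f)\<^sup>2)"
proof -
  have "(\<integral>\<^sup>+x. (\<integral>\<^sup>+y. ennreal (p t x y) * ennreal (cmod (f y)) \<partial>count_space UNIV)\<^sup>2 \<partial>M)
    \<le> (\<integral>\<^sup>+x. \<integral>\<^sup>+y. ennreal (p t x y) * ennreal ((cmod (f y))\<^sup>2) \<partial>count_space UNIV \<partial>M)"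
    by (intro nn_integral_mono P_square_bound t)
  then show ?thesis by (simp add: P_square_total t L2_norm_square f)
qed

lemma P_abs_finite:
  assumes t: "0 \<le> t" and f: "f \<in> L2 M"
  shows "(\<integral>\<^sup>+y. ennreal (p t x y) * ennreal (cmod (f y)) \<partial>count_space UNIV) < \<infinity>"
proof -
  have "ennreal (w x) * (\<integral>\<^sup>+y. ennreal (p t x y) * ennreal (cmod (f y)) \<partial>count_space UNIV)\<^sup>2 \<le>
    (\<integral>\<^sup>+x. ennreal (w x) * (\<integral>\<^sup>+y. ennreal (p t x y) * ennreal (cmod (f y)) \<partial>count_space UNIV)\<^sup>2 \<partial>count_space UNIV)"
    by (rule nn_integral_ge_point) auto
  also have "\<dots> < \<infinity>"
    using P_abs_L2[OF t f] by (simp add: nn_integral_M order_le_less_trans)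
  finally show ?thesis
    using w_pos[of x] by (auto simp: ennreal_mult_less_top power2_eq_square less_top ennreal_mult_eq_top_iff ennreal_eq_0_iff)
qed

lemma P_integrable:
  assumes t: "0 \<le> t" and f: "f \<in> L2 M"
  shows "integrable (count_space UNIV) (\<lambda>y. complex_of_real (p t x y) * f y)"
  using P_abs_finite[OF assms, of x]
  by (simp add: integrable_iff_bounded norm_mult ennreal_mult)

lemma P_cmod_le:
  assumes t: "0 \<le> t" and f: "f \<in> L2 M"
  shows "ennreal (cmod (P t f x)) \<le> (\<integral>\<^sup>+y. ennreal (p t x y) * ennreal (cmod (f y)) \<partial>count_space UNIV)"
  unfolding markov_semigroup_def
  using integral_norm_bound_ennreal[OF P_integrable[OF assms, of x]]
  by (simp add: norm_mult ennreal_mult)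

lemma P_L2:
  assumes t: "0 \<le> t" and f: "f \<in> L2 M"
  shows "P t f \<in> L2 M" "L2_norm M (P t f) \<le> L2_norm M f"
proof -
  have "(\<integral>\<^sup>+x. ennreal ((cmod (P t f x))\<^sup>2) \<partial>M) \<le>
     (\<integral>\<^sup>+x. (\<integral>\<^sup>+y. ennreal (p t x y) * ennreal (cmod (f y)) \<partial>count_space UNIV)\<^sup>2 \<partial>M)"
    using P_cmod_le[OF assms] by (intro nn_integral_mono) (auto simp: ennreal_power[symmetric] intro!: power_mono)
  also have "\<dots> \<le> ennreal ((L2_norm M f)\<^sup>2)" by (rule P_abs_L2[OF assms])
  finally have *: "(\<integral>\<^sup>+x. ennreal ((cmod (P t f x))\<^sup>2) \<partial>M) \<le> ennreal ((L2_norm M f)\<^sup>2)" .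
  show "P t f \<in> L2 M" "L2_norm M (P t f) \<le> L2_norm M f" using L2_boundI[OF *] by auto
qed

lemma P_add:
  assumes t: "0 \<le> t" and f: "f \<in> L2 M" and g: "g \<in> L2 M"
  shows "P t (\<lambda>x. f x + g x) = (\<lambda>x. P t f x + P t g x)"
  unfolding markov_semigroup_def
  using P_integrable[OF t f] P_integrable[OF t g] by (simp add: distrib_left)

lemma P_cmult: "P t (\<lambda>x. c * f x) = (\<lambda>x. c * P t f x)"
proof
  fix x
  have "(\<lambda>y. complex_of_real (p t x y) * (c * f y)) = (\<lambda>y. c * (complex_of_real (p t x y) * f y))" by (simp add: mult_ac)
  then show "P t (\<lambda>x. c * f x) x = c * P t f x"
    unfolding markov_semigroup_def by simp
qed

lemma P_uminus: "P t (\<lambda>x. - f x) = (\<lambda>x. - P t f x)"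
  using P_cmult[of t "-1" f] by simp

lemma P_diff:
  assumes t: "0 \<le> t" and f: "f \<in> L2 M" and g: "g \<in> L2 M"
  shows "P t (\<lambda>x. f x - g x) = (\<lambda>x. P t f x - P t g x)"
  using P_add[OF t f L2_uminus(1)[OF g]] by (simp add: P_uminus)

lemma P_cnj: "P t (\<lambda>x. cnj (f x)) = (\<lambda>x. cnj (P t f x))"
proof
  show "P t (\<lambda>x. cnj (f x)) x = cnj (P t f x)" for x
    unfolding markov_semigroup_def by (subst Bochner_Integration.integral_cnj[symmetric]) simp
qed

lemma L2_const: "(\<lambda>x. c) \<in> L2 M"
proof -
  have "(\<integral>\<^sup>+x. ennreal (w x) \<partial>count_space UNIV) < \<infinity>"
    using w_summable w_pos by (simp add: integrable_iff_bounded less_imp_le)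
  then show ?thesis
    unfolding L2_iff nn_integral_M by (simp add: nn_integral_multc ennreal_mult_less_top)
qed

lemma P_const: "0 \<le> t \<Longrightarrow> P t (\<lambda>x. c) = (\<lambda>x. c)"
proof
  fix x assume t: "0 \<le> t"
  have "(\<integral>y. p t x y \<partial>count_space UNIV) = enn2real (\<integral>\<^sup>+y. ennreal (p t x y) \<partial>count_space UNIV)"
    by (rule integral_eq_nn_integral) auto
  then have 1: "(\<integral>y. p t x y \<partial>count_space UNIV) = 1" by (simp add: p_total t)
  have "P t (\<lambda>x. c) x = (\<integral>y. c * complex_of_real (p t x y) \<partial>count_space UNIV)"
    unfolding markov_semigroup_def by (simp add: mult.commute)
  also have "\<dots> = c * complex_of_real (\<integral>y. p t x y \<partial>count_space UNIV)"
    by (simp del: of_real_def)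
  finally show "P t (\<lambda>x. c) x = c" by (simp add: 1)
qed

lemma sigma_finite_count: "sigma_finite_measure (count_space (UNIV::'s set))"
  by (intro sigma_finite_measure_count_space_countable) auto

lemma P_semigroup:
  assumes t: "0 \<le> t" and s: "0 \<le> s" and f: "f \<in> L2 M"
  shows "P t (P s f) = P (t + s) f"
proof
  fix x
  have meas: "(\<integral>\<^sup>+z. \<integral>\<^sup>+y. ennreal (p t x z) * ennreal (p s z y) * g y \<partial>count_space UNIV \<partial>count_space UNIV) =
     (\<integral>\<^sup>+y. ennreal (p (t + s) x y) * g y \<partial>count_space UNIV)" for g
    by (subst nn_integral_count_space_nn_integral[symmetric]) (auto simp: nn_integral_multc Chapman_Kolmogorov t s)
  have "P t (P s f) x = (\<integral>z. \<integral>y. complex_of_real (p t x z) * complex_of_real (p s z y) * f y \<partial>count_space UNIV \<partial>count_space UNIV)"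
    unfolding markov_semigroup_def by (simp add: mult.assoc)
  also have "\<dots> = (\<integral>y. \<integral>z. complex_of_real (p t x z) * complex_of_real (p s z y) * f y \<partial>count_space UNIV \<partial>count_space UNIV)"
    by (rule Fubini_count_space(1)[OF sigma_finite_count])
      (use meas[of "\<lambda>y. ennreal (cmod (f y))"] P_abs_finite[of "t + s" f x] t s f
       in \<open>auto simp: norm_mult ennreal_mult\<close>)
  also have "\<dots> = P (t + s) f x"
    unfolding markov_semigroup_def
  proof (rule Bochner_Integration.integral_cong[OF refl])
    fix y
    have "(\<integral>z. p t x z * p s z y \<partial>count_space UNIV) = enn2real (\<integral>\<^sup>+z. ennreal (p t x z * p s z y) \<partial>count_space UNIV)"
      by (rule integral_eq_nn_integral) auto
    also have "\<dots> = p (t + s) x y"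
      using Chapman_Kolmogorov[OF t s, of x y] by (simp add: ennreal_mult)
    finally have "(\<integral>z. p t x z * p s z y \<partial>count_space UNIV) = p (t + s) x y" .
    moreover have "(\<integral>z. complex_of_real (p t x z) * complex_of_real (p s z y) * f y \<partial>count_space UNIV)
      = complex_of_real (\<integral>z. p t x z * p s z y \<partial>count_space UNIV) * f y"
      by (simp flip: of_real_mult)
    ultimately show "(\<integral>z. complex_of_real (p t x z) * complex_of_real (p s z y) * f y \<partial>count_space UNIV) =
       complex_of_real (p (t + s) x y) * f y" by simp
  qed
  finally show "P t (P s f) x = P (t + s) f x" .
qed

text \<open>Both sides are the sum of \<open>w x * p t x y * g x * f y\<close> over all pairs; the pairing is bilinear,
  without complex conjugation.\<close>

lemma P_symmetric:
  assumes t: "0 \<le> t" and f: "f \<in> L2 M" and g: "g \<in> L2 M"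
  shows "(\<integral>x. g x * P t f x \<partial>M) = (\<integral>x. P t g x * f x \<partial>M)"
proof -
  let ?F = "\<lambda>x y. complex_of_real (w x) * complex_of_real (p t x y) * g x * f y"
  have fin: "(\<integral>\<^sup>+x. \<integral>\<^sup>+y. ennreal (cmod (?F x y)) \<partial>count_space UNIV \<partial>count_space UNIV) < \<infinity>"
  proof -
    have "(\<integral>\<^sup>+x. \<integral>\<^sup>+y. ennreal (cmod (?F x y)) \<partial>count_space UNIV \<partial>count_space UNIV) \<le>
       (\<integral>\<^sup>+x. \<integral>\<^sup>+y. ennreal (p t x y) * (ennreal ((cmod (g x))\<^sup>2) + ennreal ((cmod (f y))\<^sup>2)) \<partial>count_space UNIV \<partial>M)"
      unfolding nn_integral_M
    proof (rule nn_integral_mono)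
      fix x
      have "(\<integral>\<^sup>+y. ennreal (cmod (?F x y)) \<partial>count_space UNIV) \<le>
         (\<integral>\<^sup>+y. ennreal (w x) * (ennreal (p t x y) * (ennreal ((cmod (g x))\<^sup>2) + ennreal ((cmod (f y))\<^sup>2))) \<partial>count_space UNIV)"
      proof (rule nn_integral_mono)
        fix y
        have "0 \<le> (cmod (g x) - cmod (f y))\<^sup>2" by simp
        then have "2 * (cmod (g x) * cmod (f y)) \<le> (cmod (g x))\<^sup>2 + (cmod (f y))\<^sup>2" by (simp add: power2_diff)
        moreover have "0 \<le> cmod (g x) * cmod (f y)" by simp
        ultimately have "cmod (g x) * cmod (f y) \<le> (cmod (g x))\<^sup>2 + (cmod (f y))\<^sup>2" by linarith
        then have "w x * (p t x y * (cmod (g x) * cmod (f y))) \<le> w x * (p t x y * ((cmod (g x))\<^sup>2 + (cmod (f y))\<^sup>2))"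
          using w_pos[of x] by (intro mult_left_mono) auto
        then have "ennreal (cmod (?F x y)) \<le> ennreal (w x * (p t x y * ((cmod (g x))\<^sup>2 + (cmod (f y))\<^sup>2)))"
          using w_pos[of x] by (intro ennreal_leI) (simp add: norm_mult mult_ac)
        then show "ennreal (cmod (?F x y)) \<le>
          ennreal (w x) * (ennreal (p t x y) * (ennreal ((cmod (g x))\<^sup>2) + ennreal ((cmod (f y))\<^sup>2)))"
          using w_pos[of x] by (simp add: ennreal_mult less_imp_le)
      qed
      then show "(\<integral>\<^sup>+y. ennreal (cmod (?F x y)) \<partial>count_space UNIV) \<le>
         ennreal (w x) * (\<integral>\<^sup>+y. ennreal (p t x y) * (ennreal ((cmod (g x))\<^sup>2) + ennreal ((cmod (f y))\<^sup>2)) \<partial>count_space UNIV)"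
        by (simp add: nn_integral_cmult)
    qed
    also have "\<dots> = (\<integral>\<^sup>+x. ennreal ((cmod (g x))\<^sup>2) \<partial>M) + (\<integral>\<^sup>+x. ennreal ((cmod (f x))\<^sup>2) \<partial>M)"
      by (simp add: distrib_left nn_integral_add nn_integral_multc p_total t P_square_total)
    also have "\<dots> < \<infinity>" using f g by (simp add: L2_norm_square[symmetric])
    finally show ?thesis .
  qed
  have "(\<integral>x. g x * P t f x \<partial>M) = (\<integral>x. \<integral>y. ?F x y \<partial>count_space UNIV \<partial>count_space UNIV)"
    unfolding integral_M markov_semigroup_def
    by (simp add: scaleR_conv_of_real mult.assoc mult.left_commute[of "complex_of_real (p _ _ _)" "g _"])
  also have "\<dots> = (\<integral>y. \<integral>x. ?F x y \<partial>count_space UNIV \<partial>count_space UNIV)"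
    by (rule Fubini_count_space(1)[OF sigma_finite_count _ fin]) simp
  also have "\<dots> = (\<integral>y. \<integral>x. complex_of_real (w y) * (complex_of_real (p t y x) * g x) * f y \<partial>count_space UNIV \<partial>count_space UNIV)"
  proof (intro Bochner_Integration.integral_cong refl)
    fix x y
    show "?F x y = complex_of_real (w y) * (complex_of_real (p t y x) * g x) * f y"
      using p_reversible[OF t, of x y] by (simp flip: of_real_mult mult.assoc)
  qed
  also have "\<dots> = (\<integral>y. complex_of_real (w y) * P t g y * f y \<partial>count_space UNIV)"
    unfolding markov_semigroup_def by simp
  also have "\<dots> = (\<integral>x. P t g x * f x \<partial>M)"
    unfolding integral_M by (simp add: scaleR_conv_of_real mult.assoc)
  finally show ?thesis .
qed

lemma L2_integral_bound:
  assumes f: "f \<in> L2 M" and g: "g \<in> L2 M"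
  shows "integrable M (\<lambda>x. f x * g x)" "cmod (\<integral>x. f x * g x \<partial>M) \<le> L2_norm M f * L2_norm M g"
proof -
  have le: "(\<integral>\<^sup>+x. ennreal (norm (f x * g x)) \<partial>M) \<le> ennreal (L2_norm M f * L2_norm M g)"
    using L2_Cauchy_Schwarz[OF f g] by (simp add: norm_mult)
  then show int: "integrable M (\<lambda>x. f x * g x)"
    by (simp add: integrable_iff_bounded order_le_less_trans)
  show "cmod (\<integral>x. f x * g x \<partial>M) \<le> L2_norm M f * L2_norm M g"
    using order_trans[OF integral_norm_bound_ennreal[OF int] le] by simp
qed

text \<open>Self-adjointness and the semigroup property give
  \<open>\<parallel>P t f\<parallel>\<^sup>2 = \<langle>f, P (2 * t) f\<rangle>\<close>.\<close>

lemma P_norm_log_convex: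
  assumes t: "0 \<le> t" and f: "f \<in> L2 M"
  shows "(L2_norm M (P t f))\<^sup>2 \<le> L2_norm M f * L2_norm M (P (2 * t) f)"
proof -
  note L = P_L2(1)[OF t f]
  have cnjL: "(\<lambda>x. cnj (g x)) \<in> L2 M" "L2_norm M (\<lambda>x. cnj (g x)) = L2_norm M g" if "g \<in> L2 M" for g
    using that by (simp_all add: L2_iff L2_norm_def)
  have "complex_of_real ((L2_norm M (P t f))\<^sup>2) = (\<integral>x. cnj (P t f x) * P t f x \<partial>M)"
  proof -
    have "(L2_norm M (P t f))\<^sup>2 = (\<integral>x. (cmod (P t f x))\<^sup>2 \<partial>M)" by (simp add: L2_norm_def)
    then have "complex_of_real ((L2_norm M (P t f))\<^sup>2) = (\<integral>x. complex_of_real ((cmod (P t f x))\<^sup>2) \<partial>M)"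
      by (simp del: of_real_power)
    also have "\<dots> = (\<integral>x. cnj (P t f x) * P t f x \<partial>M)"
      by (simp add: complex_norm_square mult.commute del: of_real_power)
    finally show ?thesis .
  qed
  also have "\<dots> = (\<integral>x. P t (\<lambda>x. cnj (P t f x)) x * f x \<partial>M)"
    by (rule P_symmetric[OF t f cnjL(1)[OF L]])
  also have "\<dots> = (\<integral>x. cnj (P (2 * t) f x) * f x \<partial>M)"
    by (simp add: P_cnj P_semigroup t f)
  finally have "(L2_norm M (P t f))\<^sup>2 = cmod (\<integral>x. cnj (P (2 * t) f x) * f x \<partial>M)"
    by (metis norm_of_real abs_of_nonneg zero_le_power2)
  also have "\<dots> \<le> L2_norm M (P (2 * t) f) * L2_norm M f"
    using L2_integral_bound(2)[OF cnjL(1) f, of "P (2 * t) f"] cnjL(2) P_L2(1)[of "2 * t" f] t f by simp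
  finally show ?thesis by (simp add: mult.commute)
qed

text \<open>By contractivity it suffices to treat the indicator \<open>e\<close> of a point \<open>y\<close>. There
  stationarity gives \<open>\<parallel>P t e - e\<parallel>\<^sup>2 \<le> 2 * w y * (1 - p t y y)\<close>, and
  \<open>p t y y\<close> is at least the probability of not having jumped.\<close>

lemma P_strongly_continuous:
  assumes "f \<in> L2 M"
  shows "((\<lambda>t. L2_norm M (\<lambda>x. P t f x - f x)) \<longlongrightarrow> 0) (at_right 0)"
  using assms
proof (induction f rule: L2_induct)
  case (indicator y)
  have Py: "P t (indicator {y}) x = complex_of_real (p t x y)" for t x
  proof -
    let ?g = "\<lambda>a. complex_of_real (p t x a) * indicator {y} a"
    have fin: "finite {a \<in> UNIV. ?g a \<noteq> 0}"
      by (rule finite_subset[of _ "{y}"]) (auto simp: indicator_def)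
    have "P t (indicator {y}) x = (\<Sum>a | a \<in> UNIV \<and> ?g a \<noteq> 0. ?g a)"
      unfolding markov_semigroup_def by (rule lebesgue_integral_count_space_finite_support[OF fin])
    also have "\<dots> = (\<Sum>a\<in>{y}. ?g a)"
      by (rule sum.mono_neutral_left) (auto simp: indicator_def)
    finally show ?thesis by simp
  qed
  have bound: "L2_norm M (\<lambda>x. P t (indicator {y}) x - indicator {y} x) \<le> sqrt (2 * w y * (1 - exp (q y y * t)))"
    if t: "0 \<le> t" for t
  proof -
    have nn: "0 \<le> 2 * w y * (1 - exp (q y y * t))"
      using diag_nonpos[of y] t w_pos[of y] by (simp add: mult_nonpos_nonneg)
    have le1: "p t x y \<le> 1" for x
      using feller_lim_le_1[OF t, of x y] by (simp add: ennreal_p[OF t, symmetric])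
    have pt: "(cmod (P t (indicator {y}) x - indicator {y} x))\<^sup>2 \<le> (1 - 2 * p t y y) * indicator {y} x + p t x y" for x
    proof (cases "x = y")
      case True
      have "(cmod (complex_of_real (p t y y) - 1))\<^sup>2 = (p t y y - 1)\<^sup>2"
        by (metis norm_of_real of_real_1 of_real_diff power2_abs)
      moreover have "(p t y y - 1)\<^sup>2 \<le> 1 * (1 - p t y y)"
        using le1[of y] by (simp add: power2_eq_square algebra_simps mult_left_le)
      ultimately show ?thesis using True by (simp add: Py)
    next
      case False
      have "p t x y * p t x y \<le> p t x y * 1" using le1 by (intro mult_left_mono) auto
      then show ?thesis using False by (simp add: Py power2_eq_square)
    qed
    have intp: "integrable M (\<lambda>x. p t x y)" and ip: "(\<integral>x. p t x y \<partial>M) = w y"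
    proof -
      have "(\<integral>\<^sup>+x. ennreal (p t x y) \<partial>M) = ennreal (w y)" by (simp add: nn_integral_M p_invariant t)
      then show "integrable M (\<lambda>x. p t x y)" "(\<integral>x. p t x y \<partial>M) = w y"
        using w_pos[of y] by (auto simp: integrable_iff_bounded integral_eq_nn_integral)
    qed
    have iy: "integrable M (indicator {y} :: 's \<Rightarrow> real)" "measure M {y} = w y"
    proof -
      have "emeasure M {y} = (\<integral>\<^sup>+x. ennreal (w x) * indicator {y} x \<partial>count_space UNIV)"
        unfolding point_measure_def by (rule emeasure_density) auto
      also have "\<dots> = ennreal (w y)"
        by (subst nn_integral_count_space'[where A="{y}"]) auto
      finally have "emeasure M {y} = ennreal (w y)" .
      then show "integrable M (indicator {y} :: 's \<Rightarrow> real)" "measure M {y} = w y"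
        using w_pos[of y] by (auto simp: measure_def integrable_indicator_iff point_measure_def)
    qed
    have "P t (indicator {y}) \<in> L2 M" "indicator {y} \<in> L2 M"
    proof -
      show "indicator {y} \<in> L2 M"
        by (rule L2_dominated[OF L2_const[of 1]]) (auto split: split_indicator)
      then show "P t (indicator {y}) \<in> L2 M" by (rule P_L2[OF t])
    qed
    then have "(\<lambda>x. P t (indicator {y}) x - indicator {y} x) \<in> L2 M" by (rule L2_diff)
    then have "(\<integral>x. (cmod (P t (indicator {y}) x - indicator {y} x))\<^sup>2 \<partial>M) \<le>
      (\<integral>x. (1 - 2 * p t y y) * indicator {y} x + p t x y \<partial>M)"
      by (intro integral_mono pt) (auto simp: L2_def intro!: intp iy Bochner_Integration.integrable_add integrable_mult_right)
    also have "\<dots> = 2 * w y * (1 - p t y y)"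
      by (subst Bochner_Integration.integral_add) (auto simp: iy ip intp algebra_simps intro!: integrable_mult_right)
    also have "\<dots> \<le> 2 * w y * (1 - exp (q y y * t))"
      using p_diag[OF t, of y] w_pos[of y] by (intro mult_left_mono) auto
    finally show ?thesis unfolding L2_norm_def by (rule real_sqrt_le_mono)
  qed
  have "((\<lambda>t. sqrt (2 * w y * (1 - exp (q y y * t)))) \<longlongrightarrow> sqrt (2 * w y * (1 - exp (q y y * 0)))) (at_right 0)"
    by (intro tendsto_intros)
  then have lim: "((\<lambda>t. sqrt (2 * w y * (1 - exp (q y y * t)))) \<longlongrightarrow> 0) (at_right 0)" by simp
  show ?case
    by (rule tendsto_sandwich[OF _ _ tendsto_const lim])
      (auto simp: eventually_at_right_less[THEN eventually_mono] intro!: eventually_mono[OF eventually_at_right_less] bound)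
next
  case (add f g)
  have "\<forall>\<^sub>F t in at_right 0. L2_norm M (\<lambda>x. P t (\<lambda>x. f x + g x) x - (f x + g x)) \<le>
     L2_norm M (\<lambda>x. P t f x - f x) + L2_norm M (\<lambda>x. P t g x - g x)"
    using eventually_at_right_less
  proof eventually_elim
    fix t :: real assume "0 < t"
    then have t: "0 \<le> t" by simp
    show "L2_norm M (\<lambda>x. P t (\<lambda>x. f x + g x) x - (f x + g x)) \<le>
     L2_norm M (\<lambda>x. P t f x - f x) + L2_norm M (\<lambda>x. P t g x - g x)"
      using L2_add(2)[OF L2_diff(1)[OF P_L2(1)[OF t add.hyps(1)] add.hyps(1)] L2_diff(1)[OF P_L2(1)[OF t add.hyps(2)] add.hyps(2)]]
      by (simp add: P_add t add.hyps algebra_simps)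
  qed
  from tendsto_sandwich[OF _ this tendsto_const tendsto_add_zero[OF add.IH]] show ?case by simp
next
  case (cmult f c)
  have "L2_norm M (\<lambda>x. P t (\<lambda>x. c * f x) x - c * f x) = cmod c * L2_norm M (\<lambda>x. P t f x - f x)" for t
    by (simp add: P_cmult right_diff_distrib[symmetric] L2_norm_def norm_mult power_mult_distrib real_sqrt_mult)
  then show ?case using tendsto_mult_left[OF cmult.IH, of "cmod c"] by simp
next
  case (limit f)
  show ?case
  proof (rule tendstoI)
    fix e :: real assume e: "0 < e"
    obtain g where g: "g \<in> L2 M" "((\<lambda>t. L2_norm M (\<lambda>x. P t g x - g x)) \<longlongrightarrow> 0) (at_right 0)"
      "L2_norm M (\<lambda>x. f x - g x) < e / 3"
      using limit.IH[of "e / 3"] e by auto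
    have "\<forall>\<^sub>F t in at_right 0. L2_norm M (\<lambda>x. P t g x - g x) < e / 3"
      using g(2) e by (intro order_tendstoD) auto
    then show "\<forall>\<^sub>F t in at_right 0. dist (L2_norm M (\<lambda>x. P t f x - f x)) 0 < e"
      using eventually_at_right_less
    proof eventually_elim
      case (elim t)
      then have t: "0 \<le> t" by simp
      note d = L2_diff(1)[OF limit.hyps g(1)]
      have "L2_norm M (\<lambda>x. P t f x - f x) =
        L2_norm M (\<lambda>x. (P t (\<lambda>x. f x - g x) x - (f x - g x)) + (P t g x - g x))"
        by (simp add: P_diff t limit.hyps g)
      also have "\<dots> \<le> L2_norm M (\<lambda>x. P t (\<lambda>x. f x - g x) x - (f x - g x)) + L2_norm M (\<lambda>x. P t g x - g x)"
        by (intro L2_add L2_diff P_L2 d t g)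
      also have "L2_norm M (\<lambda>x. P t (\<lambda>x. f x - g x) x - (f x - g x)) \<le>
         L2_norm M (P t (\<lambda>x. f x - g x)) + L2_norm M (\<lambda>x. f x - g x)"
        by (intro L2_diff P_L2 d t)
      also have "L2_norm M (P t (\<lambda>x. f x - g x)) \<le> L2_norm M (\<lambda>x. f x - g x)"
        by (intro P_L2 d t)
      finally show ?case using g(3) elim by simp
    qed
  qed
qed

end

section \<open>Exponential decay to the mean\<close>

text \<open>Doubling the time \<open>n\<close> times gives \<open>b t ^ (2 ^ n) \<le> C * exp (- l * t) ^ (2 ^ n)\<close>,
  and the root of \<open>C\<close> tends to one.\<close>

lemma squaring_bound:
  fixes b :: "real \<Rightarrow> real"
  assumes sq: "\<And>t. 0 \<le> t \<Longrightarrow> (b t)\<^sup>2 \<le> b (2 * t)" and b0: "\<And>t. 0 \<le> b t"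
    and bound: "\<And>t. 0 \<le> t \<Longrightarrow> b t \<le> C * exp (- l * t)" and t: "0 \<le> t"
  shows "b t \<le> exp (- l * t)"
proof (rule ccontr)
  have pow: "b t ^ (2 ^ n) \<le> b (2 ^ n * t)" for n
  proof (induction n)
    case (Suc n)
    have "b t ^ (2 ^ Suc n) = (b t ^ (2 ^ n))\<^sup>2"
      by (simp add: power_mult[symmetric] mult.commute)
    also have "\<dots> \<le> (b (2 ^ n * t))\<^sup>2" using Suc b0 by (intro power_mono) auto
    also have "\<dots> \<le> b (2 ^ Suc n * t)" using sq[of "2 ^ n * t"] t by (simp add: mult_ac)
    finally show ?case .
  qed simp
  let ?x = "b t * exp (l * t)"
  assume "\<not> b t \<le> exp (- l * t)"
  then have x1: "1 < ?x" by (simp add: exp_minus field_simps not_le)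
  obtain n where n: "C < ?x ^ n" using real_arch_pow[OF x1] by blast
  have "?x ^ n \<le> ?x ^ (2 ^ n)" using x1 by (intro power_increasing) auto
  also have "\<dots> = b t ^ (2 ^ n) * exp (l * (2 ^ n * t))"
    by (simp add: power_mult_distrib exp_of_nat_mult[symmetric] mult_ac)
  also have "\<dots> \<le> (C * exp (- l * (2 ^ n * t))) * exp (l * (2 ^ n * t))"
    using order_trans[OF pow bound, of n] t by (intro mult_right_mono) auto
  also have "\<dots> = C" by (simp add: exp_minus field_simps)
  finally show False using n by simp
qed

context reversible_chain
begin

lemma decay_constant_normalised:
  assumes f: "f \<in> L2 M" and decay: "\<And>t. 0 \<le> t \<Longrightarrow> L2_norm M (P t f) \<le> A * exp (- l * t)" and t: "0 \<le> t"
  shows "L2_norm M (P t f) \<le> exp (- l * t) * L2_norm M f"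
proof (cases "L2_norm M f = 0")
  case True
  then show ?thesis using P_L2(2)[OF t f] by simp
next
  case False
  then have pos: "0 < L2_norm M f" using L2_norm_nonneg[of f] by linarith
  have "L2_norm M (P t f) / L2_norm M f \<le> exp (- l * t)"
  proof (rule squaring_bound[of "\<lambda>t. L2_norm M (P t f) / L2_norm M f" "A / L2_norm M f"])
    show "(L2_norm M (P t f) / L2_norm M f)\<^sup>2 \<le> L2_norm M (P (2 * t) f) / L2_norm M f" if "0 \<le> t" for t
      using P_norm_log_convex[OF that f] pos by (simp add: field_simps power2_eq_square)
    show "L2_norm M (P t f) / L2_norm M f \<le> A / L2_norm M f * exp (- l * t)" if "0 \<le> t" for t
      using decay[OF that] pos by (simp add: field_simps)
  qed (use t in auto)
  then show ?thesis using pos by (simp add: field_simps)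
qed

definition mass :: real where "mass = L2_norm M (\<lambda>_. 1)"

definition mean :: "('s \<Rightarrow> complex) \<Rightarrow> complex" where
  "mean f = (\<integral>x. f x \<partial>M) / complex_of_real (mass\<^sup>2)"

lemma mass_pos: "0 < mass"
  using L2_norm_0_iff[OF L2_const[of 1]] L2_norm_nonneg[of "\<lambda>_. 1"] unfolding mass_def by (simp add: order_less_le)

lemma L2_norm_const: "L2_norm M (\<lambda>_. c) = cmod c * mass"
  using L2_cmult(2)[OF L2_const[of 1], of c] by (simp add: mass_def)

lemma L2_M_integrable: "f \<in> L2 M \<Longrightarrow> integrable M f"
  using L2_integral_bound(1)[OF _ L2_const[of 1]] by simp

lemma mean_bound: "f \<in> L2 M \<Longrightarrow> cmod (mean f) * mass \<le> L2_norm M f"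
  using L2_integral_bound(2)[OF _ L2_const[of 1], of f] mass_pos
  by (simp add: mean_def mass_def[symmetric] norm_divide field_simps power2_eq_square norm_mult)

lemma mean_diff: "f \<in> L2 M \<Longrightarrow> g \<in> L2 M \<Longrightarrow> mean (\<lambda>x. f x - g x) = mean f - mean g"
  by (simp add: mean_def L2_M_integrable diff_divide_distrib)

lemma mean_cmult: "mean (\<lambda>x. c * f x) = c * mean f"
  by (simp add: mean_def)

lemma mean_const: "mean (\<lambda>_. c) = c"
proof -
  have "mass\<^sup>2 = measure M (space M)" by (simp add: mass_def L2_norm_def)
  then have "(\<integral>x. 1 \<partial>M) = complex_of_real (mass\<^sup>2)" by (simp add: scaleR_conv_of_real)
  then have "mean (\<lambda>_. 1) = 1" using mass_pos by (simp add: mean_def)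
  then show ?thesis using mean_cmult[of c "\<lambda>_. 1"] by simp
qed

lemma mean_P: "0 \<le> t \<Longrightarrow> f \<in> L2 M \<Longrightarrow> mean (P t f) = mean f"
  using P_symmetric[of t f "\<lambda>_. 1"] by (simp add: mean_def L2_const P_const)

definition decaying :: "real \<Rightarrow> ('s \<Rightarrow> complex) \<Rightarrow> bool" where
  "decaying l f \<longleftrightarrow> f \<in> L2 M \<and>
     (\<forall>t\<ge>0. L2_norm M (\<lambda>x. P t f x - mean f) \<le> exp (- l * t) * L2_norm M (\<lambda>x. f x - mean f))"

text \<open>The limit \<open>k\<close> can only be the mean, since the semigroup preserves means. A constant
  \<open>A\<close> that depends on \<open>f\<close> is good enough, which makes the decaying functions a linear
  space.\<close>

lemma decayingI:
  assumes f: "f \<in> L2 M" and l: "0 < l"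
    and decay: "\<And>t. 0 \<le> t \<Longrightarrow> L2_norm M (\<lambda>x. P t f x - k) \<le> A * exp (- l * t)"
  shows "decaying l f"
proof -
  have L: "(\<lambda>x. P t f x - k) \<in> L2 M" if "0 \<le> t" for t
    by (intro L2_diff P_L2 L2_const f that)
  have "cmod (mean f - k) * mass \<le> A * exp (- l * t)" if "0 \<le> t" for t
    using order_trans[OF mean_bound[OF L[OF that]] decay[OF that]]
    by (simp add: mean_diff P_L2 f that L2_const mean_P mean_const)
  moreover have "((\<lambda>t. A * exp (- l * t)) \<longlongrightarrow> A * 0) at_top"
  proof (intro tendsto_mult tendsto_const filterlim_compose[OF exp_at_bot])
    show "filterlim (\<lambda>t. - l * t) at_bot at_top"
      by (rule filterlim_tendsto_neg_mult_at_bot[OF tendsto_const _ filterlim_ident]) (use l in simp)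
  qed
  ultimately have "cmod (mean f - k) * mass \<le> 0"
    by (intro tendsto_lowerbound[where F=at_top and f="\<lambda>t. A * exp (- l * t)"])
      (auto intro!: eventually_mono[OF eventually_ge_at_top[of 0]])
  then have k: "k = mean f" using mass_pos by (simp add: mult_le_0_iff)
  let ?f = "\<lambda>x. f x - mean f"
  have P0: "P t ?f = (\<lambda>x. P t f x - mean f)" if "0 \<le> t" for t
    by (simp add: P_diff that f L2_const P_const)
  show ?thesis unfolding decaying_def
  proof (intro conjI allI impI f)
    fix t :: real assume t: "0 \<le> t"
    have "L2_norm M (P t ?f) \<le> exp (- l * t) * L2_norm M ?f"
      by (rule decay_constant_normalised[OF L2_diff(1)[OF f L2_const] _ t]) (use decay P0 k in auto)
    then show "L2_norm M (\<lambda>x. P t f x - mean f) \<le> exp (- l * t) * L2_norm M ?f" by (simp add: P0 t)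
  qed
qed

lemma decaying_L2: "decaying l f \<Longrightarrow> f \<in> L2 M"
  by (simp add: decaying_def)

lemma decaying_add:
  assumes l: "0 < l" and f: "decaying l f" and g: "decaying l g"
  shows "decaying l (\<lambda>x. f x + g x)"
proof (rule decayingI[OF _ l])
  note fg = decaying_L2[OF f] decaying_L2[OF g]
  show "(\<lambda>x. f x + g x) \<in> L2 M" by (intro L2_add fg)
  fix t :: real assume t: "0 \<le> t"
  have "L2_norm M (\<lambda>x. P t (\<lambda>x. f x + g x) x - (mean f + mean g)) =
     L2_norm M (\<lambda>x. (P t f x - mean f) + (P t g x - mean g))"
    by (simp add: P_add t fg algebra_simps)
  also have "\<dots> \<le> L2_norm M (\<lambda>x. P t f x - mean f) + L2_norm M (\<lambda>x. P t g x - mean g)"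
    by (intro L2_add L2_diff P_L2 fg t L2_const)
  also have "\<dots> \<le> exp (- l * t) * L2_norm M (\<lambda>x. f x - mean f) + exp (- l * t) * L2_norm M (\<lambda>x. g x - mean g)"
    using f g t unfolding decaying_def by (intro add_mono) auto
  finally show "L2_norm M (\<lambda>x. P t (\<lambda>x. f x + g x) x - (mean f + mean g)) \<le>
     (L2_norm M (\<lambda>x. f x - mean f) + L2_norm M (\<lambda>x. g x - mean g)) * exp (- l * t)"
    by (simp add: algebra_simps)
qed

lemma decaying_cmult:
  assumes l: "0 < l" and f: "decaying l f"
  shows "decaying l (\<lambda>x. c * f x)"
proof (rule decayingI[OF _ l])
  note fL = decaying_L2[OF f]
  show "(\<lambda>x. c * f x) \<in> L2 M" by (intro L2_cmult fL)
  fix t :: real assume t: "0 \<le> t"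
  have "L2_norm M (\<lambda>x. P t (\<lambda>x. c * f x) x - c * mean f) = L2_norm M (\<lambda>x. c * (P t f x - mean f))"
    by (simp add: P_cmult right_diff_distrib)
  also have "\<dots> = cmod c * L2_norm M (\<lambda>x. P t f x - mean f)"
    by (intro L2_cmult L2_diff P_L2 fL t L2_const)
  also have "\<dots> \<le> cmod c * (exp (- l * t) * L2_norm M (\<lambda>x. f x - mean f))"
    using f t unfolding decaying_def by (intro mult_left_mono) auto
  finally show "L2_norm M (\<lambda>x. P t (\<lambda>x. c * f x) x - c * mean f) \<le>
     (cmod c * L2_norm M (\<lambda>x. f x - mean f)) * exp (- l * t)"
    by (simp add: mult_ac)
qed

lemma decaying_limit:
  assumes f: "f \<in> L2 M" and approx: "\<And>\<epsilon>. 0 < \<epsilon> \<Longrightarrow> \<exists>g. decaying l g \<and> L2_norm M (\<lambda>x. f x - g x) < \<epsilon>"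
    and l: "0 < l"
  shows "decaying l f"
  unfolding decaying_def
proof (intro conjI allI impI f)
  fix t :: real assume t: "0 \<le> t"
  show "L2_norm M (\<lambda>x. P t f x - mean f) \<le> exp (- l * t) * L2_norm M (\<lambda>x. f x - mean f)"
  proof (rule field_le_epsilon)
    fix e :: real assume e: "0 < e"
    obtain g where g: "decaying l g" and fg: "L2_norm M (\<lambda>x. f x - g x) < e / 4"
      using approx[of "e / 4"] e by auto
    note gL = decaying_L2[OF g]
    let ?d = "\<lambda>x. (f x - g x) - (mean f - mean g)"
    have dL: "?d \<in> L2 M" by (intro L2_diff f gL L2_const)
    have "L2_norm M ?d \<le> L2_norm M (\<lambda>x. f x - g x) + L2_norm M (\<lambda>x. mean f - mean g)"
      by (intro L2_diff f gL L2_const)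
    also have "L2_norm M (\<lambda>x. mean f - mean g) \<le> L2_norm M (\<lambda>x. f x - g x)"
      using mean_bound[OF L2_diff(1)[OF f gL]] by (simp add: L2_norm_const mean_diff f gL)
    finally have d: "L2_norm M ?d < e / 2" using fg by linarith
    have "L2_norm M (\<lambda>x. P t f x - mean f) = L2_norm M (\<lambda>x. P t ?d x + (P t g x - mean g))"
      by (simp add: P_diff[OF t L2_diff(1)[OF f gL] L2_const] P_diff[OF t f gL] P_const[OF t])
    also have "\<dots> \<le> L2_norm M (P t ?d) + L2_norm M (\<lambda>x. P t g x - mean g)"
      by (intro L2_add P_L2 L2_diff dL gL L2_const t)
    also have "L2_norm M (P t ?d) \<le> L2_norm M ?d"
      by (intro P_L2 dL t)
    also have "L2_norm M (\<lambda>x. P t g x - mean g) \<le> exp (- l * t) * L2_norm M (\<lambda>x. g x - mean g)"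
      using g t unfolding decaying_def by auto
    also have "L2_norm M (\<lambda>x. g x - mean g) = L2_norm M (\<lambda>x. (f x - mean f) - ?d x)"
      by simp
    also have "\<dots> \<le> L2_norm M (\<lambda>x. f x - mean f) + L2_norm M ?d"
      by (intro L2_diff dL f L2_const)
    finally have *: "L2_norm M (\<lambda>x. P t f x - mean f) \<le>
        L2_norm M ?d + exp (- l * t) * (L2_norm M (\<lambda>x. f x - mean f) + L2_norm M ?d)"
      by simp
    have "exp (- l * t) * L2_norm M ?d \<le> 1 * L2_norm M ?d"
      using l t by (intro mult_right_mono) auto
    then show "L2_norm M (\<lambda>x. P t f x - mean f) \<le> exp (- l * t) * L2_norm M (\<lambda>x. f x - mean f) + e"
      using * d by (simp add: algebra_simps)
  qed
qed

end

section \<open>The resolvent as a Laplace transform\<close>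

context reversible_chain
begin

text \<open>Minkowski's inequality for the weight \<open>k\<close>, obtained from Cauchy-Schwarz in time and Tonelli.\<close>

lemma L2_time_average:
  fixes u :: "real \<Rightarrow> 's \<Rightarrow> complex" and k :: "real \<Rightarrow> real"
  assumes meas: "\<And>x. (\<lambda>t. u t x) \<in> borel_measurable borel"
    and [measurable]: "k \<in> borel_measurable borel"
    and k0: "\<And>t. 0 \<le> k t" and kc: "(\<integral>\<^sup>+t. ennreal (k t) \<partial>lborel) = ennreal c" and c: "0 \<le> c"
    and u: "\<And>t. k t \<noteq> 0 \<Longrightarrow> u t \<in> L2 M" "\<And>t. k t \<noteq> 0 \<Longrightarrow> L2_norm M (u t) \<le> B" and B: "0 \<le> B"
  shows "integrable lborel (\<lambda>t. complex_of_real (k t) * u t x)"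
    and "(\<lambda>x. \<integral>t. complex_of_real (k t) * u t x \<partial>lborel) \<in> L2 M"
    and "L2_norm M (\<lambda>x. \<integral>t. complex_of_real (k t) * u t x \<partial>lborel) \<le> c * B"
proof -
  note [measurable] = meas
  define I where "I x = (\<integral>\<^sup>+t. ennreal (k t) * ennreal (cmod (u t x)) \<partial>lborel)" for x
  have I2: "(I x)\<^sup>2 \<le> ennreal c * (\<integral>\<^sup>+t. ennreal (k t) * ennreal ((cmod (u t x))\<^sup>2) \<partial>lborel)" for x
  proof -
    have "(I x)\<^sup>2 = (\<integral>\<^sup>+t. ennreal (sqrt (k t)) * (ennreal (sqrt (k t)) * ennreal (cmod (u t x))) \<partial>lborel)\<^sup>2"
      unfolding I_def using k0 by (simp add: mult.assoc[symmetric] ennreal_mult[symmetric])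
    also have "\<dots> \<le> (\<integral>\<^sup>+t. ennreal (sqrt (k t)) ^ 2 \<partial>lborel) *
       (\<integral>\<^sup>+t. (ennreal (sqrt (k t)) * ennreal (cmod (u t x))) ^ 2 \<partial>lborel)"
      by (rule Cauchy_Schwarz_nn_integral) measurable
    also have "\<dots> = ennreal c * (\<integral>\<^sup>+t. ennreal (k t) * ennreal ((cmod (u t x))\<^sup>2) \<partial>lborel)"
      using k0 by (simp add: power_mult_distrib ennreal_power kc)
    finally show ?thesis .
  qed
  have "(\<integral>\<^sup>+x. (I x)\<^sup>2 \<partial>M) \<le>
      (\<integral>\<^sup>+x. ennreal c * (\<integral>\<^sup>+t. ennreal (k t) * ennreal ((cmod (u t x))\<^sup>2) \<partial>lborel) \<partial>M)"
    by (intro nn_integral_mono I2)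
  also have "\<dots> = ennreal c * (\<integral>\<^sup>+x. \<integral>\<^sup>+t. ennreal (w x) * (ennreal (k t) * ennreal ((cmod (u t x))\<^sup>2)) \<partial>lborel \<partial>count_space UNIV)"
    by (simp add: nn_integral_cmult[symmetric] nn_integral_M mult.left_commute)
  also have "(\<integral>\<^sup>+x. \<integral>\<^sup>+t. ennreal (w x) * (ennreal (k t) * ennreal ((cmod (u t x))\<^sup>2)) \<partial>lborel \<partial>count_space UNIV)
     = (\<integral>\<^sup>+t. \<integral>\<^sup>+x. ennreal (w x) * (ennreal (k t) * ennreal ((cmod (u t x))\<^sup>2)) \<partial>count_space UNIV \<partial>lborel)"
    by (rule nn_integral_count_space_nn_integral[symmetric]) auto
  also have "\<dots> \<le> (\<integral>\<^sup>+t. ennreal (k t) * ennreal (B\<^sup>2) \<partial>lborel)"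
  proof (rule nn_integral_mono)
    fix t
    have "(\<integral>\<^sup>+x. ennreal (w x) * (ennreal (k t) * ennreal ((cmod (u t x))\<^sup>2)) \<partial>count_space UNIV) =
       ennreal (k t) * (\<integral>\<^sup>+x. ennreal ((cmod (u t x))\<^sup>2) \<partial>M)"
      by (simp add: nn_integral_M nn_integral_cmult[symmetric] mult.left_commute)
    also have "\<dots> \<le> ennreal (k t) * ennreal (B\<^sup>2)"
    proof (cases "k t = 0")
      case False
      then have "(\<integral>\<^sup>+x. ennreal ((cmod (u t x))\<^sup>2) \<partial>M) \<le> ennreal (B\<^sup>2)"
        using u[OF False] by (simp add: L2_norm_square[symmetric] ennreal_leI power_mono)
      then show ?thesis by (intro mult_left_mono) auto
    qed simp
    finally show "(\<integral>\<^sup>+x. ennreal (w x) * (ennreal (k t) * ennreal ((cmod (u t x))\<^sup>2)) \<partial>count_space UNIV)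
      \<le> ennreal (k t) * ennreal (B\<^sup>2)" .
  qed
  also have "\<dots> = ennreal c * ennreal (B\<^sup>2)"
    by (simp add: nn_integral_multc kc)
  finally have "(\<integral>\<^sup>+x. (I x)\<^sup>2 \<partial>M) \<le> ennreal c * (ennreal c * ennreal (B\<^sup>2))"
    by (simp add: mult_left_mono)
  also have "\<dots> = ennreal ((c * B)\<^sup>2)"
  proof -
    have "(c * B)\<^sup>2 = c * (c * B\<^sup>2)" by (simp add: power2_eq_square mult_ac)
    then show ?thesis using c by (simp add: ennreal_mult')
  qed
  finally have *: "(\<integral>\<^sup>+x. (I x)\<^sup>2 \<partial>M) \<le> ennreal ((c * B)\<^sup>2)" .
  have Ifin: "I x < \<infinity>" for x
  proof -
    have "ennreal (w x) * (I x)\<^sup>2 \<le> (\<integral>\<^sup>+x. ennreal (w x) * (I x)\<^sup>2 \<partial>count_space UNIV)"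
      by (rule nn_integral_ge_point) auto
    also have "\<dots> < \<infinity>"
      using * by (simp add: nn_integral_M order_le_less_trans)
    finally show ?thesis
      using w_pos[of x] by (auto simp: ennreal_mult_less_top power2_eq_square less_top ennreal_mult_eq_top_iff ennreal_eq_0_iff)
  qed
  show int: "integrable lborel (\<lambda>t. complex_of_real (k t) * u t x)" for x
    using Ifin[of x] k0 unfolding I_def by (simp add: integrable_iff_bounded norm_mult ennreal_mult)
  have le: "ennreal (cmod (\<integral>t. complex_of_real (k t) * u t x \<partial>lborel)) \<le> I x" for x
    using integral_norm_bound_ennreal[OF int[of x]] k0 unfolding I_def by (simp add: norm_mult ennreal_mult)
  have "(\<integral>\<^sup>+x. ennreal ((cmod (\<integral>t. complex_of_real (k t) * u t x \<partial>lborel))\<^sup>2) \<partial>M) \<le> (\<integral>\<^sup>+x. (I x)\<^sup>2 \<partial>M)"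
    using le by (intro nn_integral_mono) (auto simp: ennreal_power[symmetric] intro!: power_mono)
  with * have **: "(\<integral>\<^sup>+x. ennreal ((cmod (\<integral>t. complex_of_real (k t) * u t x \<partial>lborel))\<^sup>2) \<partial>M) \<le> ennreal ((c * B)\<^sup>2)"
    by (rule order_trans[rotated])
  show "(\<lambda>x. \<integral>t. complex_of_real (k t) * u t x \<partial>lborel) \<in> L2 M"
    and "L2_norm M (\<lambda>x. \<integral>t. complex_of_real (k t) * u t x \<partial>lborel) \<le> c * B"
    using L2_boundI[OF **] c B by auto
qed

lemma measurable_P [measurable]: "(\<lambda>t. P t f x) \<in> borel_measurable borel"
proof -
  interpret sigma_finite_measure "count_space (UNIV::'s set)" by (rule sigma_finite_count)
  have "(\<lambda>r. complex_of_real (p (fst r) x (snd r)) * f (snd r)) \<in> borel_measurable (borel \<Otimes>\<^sub>M count_space UNIV)"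
    by (rule measurable_compose_countable'[where I=UNIV and f="\<lambda>z r. complex_of_real (p (fst r) x z) * f z" and g=snd]) auto
  then show ?thesis
    unfolding markov_semigroup_def by (intro borel_measurable_lebesgue_integral) (simp add: case_prod_unfold)
qed

lemma P_abs_point:
  assumes t: "0 \<le> t" and f: "f \<in> L2 M"
  shows "(\<integral>\<^sup>+y. ennreal (p t x y) * ennreal (cmod (f y)) \<partial>count_space UNIV) \<le> ennreal (L2_norm M f / sqrt (w x))"
proof (rule ennreal_power2_le_imp_le)
  let ?I = "\<integral>\<^sup>+y. ennreal (p t x y) * ennreal (cmod (f y)) \<partial>count_space UNIV"
  have "ennreal (w x) * ?I\<^sup>2 \<le>
    (\<integral>\<^sup>+x. ennreal (w x) * (\<integral>\<^sup>+y. ennreal (p t x y) * ennreal (cmod (f y)) \<partial>count_space UNIV)\<^sup>2 \<partial>count_space UNIV)"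
    by (rule nn_integral_ge_point) auto
  also have "\<dots> \<le> ennreal ((L2_norm M f)\<^sup>2)"
    using P_abs_L2[OF t f] by (simp add: nn_integral_M)
  finally have 1: "ennreal (w x) * ?I\<^sup>2 \<le> ennreal ((L2_norm M f)\<^sup>2)" .
  have "?I\<^sup>2 = ennreal (1 / w x) * (ennreal (w x) * ?I\<^sup>2)"
    using w_pos[of x] by (simp add: mult.assoc[symmetric] ennreal_mult[symmetric] less_imp_le)
  also have "\<dots> \<le> ennreal (1 / w x) * ennreal ((L2_norm M f)\<^sup>2)"
    by (intro mult_left_mono 1) auto
  also have "\<dots> = ennreal ((L2_norm M f / sqrt (w x))\<^sup>2)"
    using w_pos[of x] by (simp add: ennreal_mult[symmetric] power_divide less_imp_le)
  finally show "?I\<^sup>2 \<le> ennreal ((L2_norm M f / sqrt (w x))\<^sup>2)" .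
qed (use w_pos in \<open>auto simp: less_imp_le\<close>)

text \<open>The Laplace transform of the semigroup, formed pointwise. It solves \<open>(- L - z) f = h\<close> once the
  integral converges.\<close>

definition resolvent :: "complex \<Rightarrow> ('s \<Rightarrow> complex) \<Rightarrow> 's \<Rightarrow> complex" where
  "resolvent z h x = (\<integral>t. indicator {0..} t * exp (z * complex_of_real t) * P t h x \<partial>lborel)"

lemma nn_integral_exp_decay:
  assumes k: "0 < k"
  shows "(\<integral>\<^sup>+t. ennreal (indicator {0..} t * exp (- k * t)) \<partial>lborel) = ennreal (1 / k)"
proof -
  have "(\<integral>\<^sup>+t. ennreal (exp (- k * t)) * indicator {0..} t \<partial>lborel) = ennreal (0 - (- exp (- k * 0) / k))"
  proof (rule nn_integral_FTC_atLeast)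
    show "DERIV (\<lambda>t. - exp (- k * t) / k) t :> exp (- k * t)" for t
      using k by (auto intro!: derivative_eq_intros)
    have "filterlim (\<lambda>t. - k * t) at_bot at_top"
      by (rule filterlim_tendsto_neg_mult_at_bot[OF tendsto_const _ filterlim_ident]) (use k in simp)
    then have "((\<lambda>t. - exp (- k * t) / k) \<longlongrightarrow> - 0 / k) at_top"
      using k by (intro tendsto_intros filterlim_compose[OF exp_at_bot]) auto
    then show "((\<lambda>t. - exp (- k * t) / k) \<longlongrightarrow> 0) at_top" by simp
  qed auto
  then show ?thesis
    by (simp add: ennreal_indicator[symmetric] ennreal_mult'[symmetric] mult.commute)
qed

lemma resolvent_L2:
  assumes h: "h \<in> L2 M" and decay: "\<And>t. 0 \<le> t \<Longrightarrow> L2_norm M (P t h) \<le> exp (- l * t) * L2_norm M h"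
    and z: "Re z < l"
  shows "resolvent z h \<in> L2 M"
    and "integrable lborel (\<lambda>t. indicator {0..} t * exp (z * complex_of_real t) * P t h x)"
proof -
  \<comment> \<open>The integrand is split into an integrable weight of total mass \<open>1 / (l - Re z)\<close> and a
    function of \<open>t\<close> whose \<open>L\<^sup>2\<close> norm is at most that of \<open>h\<close>.\<close>
  let ?k = "\<lambda>t. indicator {0..} t * exp (- (l - Re z) * t)"
  let ?u = "\<lambda>t x. exp ((z + complex_of_real (l - Re z)) * complex_of_real t) * P t h x"
  have eq: "indicator {0..} t * exp (z * complex_of_real t) * P t h x = complex_of_real (?k t) * ?u t x" for t x
    by (auto split: split_indicator simp: exp_of_real[symmetric] exp_add[symmetric] algebra_simps)
  have u: "L2_norm M (?u t) \<le> L2_norm M h" "?u t \<in> L2 M" if "?k t \<noteq> 0" for t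
  proof -
    have t: "0 \<le> t" using that by (auto simp: indicator_def split: if_splits)
    show "?u t \<in> L2 M" by (intro L2_cmult P_L2 h t)
    have "L2_norm M (?u t) = cmod (exp ((z + complex_of_real (l - Re z)) * complex_of_real t)) * L2_norm M (P t h)"
      by (intro L2_cmult P_L2 h t)
    also have "cmod (exp ((z + complex_of_real (l - Re z)) * complex_of_real t)) = exp (l * t)"
      by (simp add: norm_exp_eq_Re)
    also have "exp (l * t) * L2_norm M (P t h) \<le> exp (l * t) * (exp (- l * t) * L2_norm M h)"
      using decay[OF t] by (intro mult_left_mono) auto
    also have "\<dots> = L2_norm M h" by (simp add: exp_minus field_simps)
    finally show "L2_norm M (?u t) \<le> L2_norm M h" .
  qed
  note avg = L2_time_average[where u="?u" and k="?k" and c="1 / (l - Re z)" and B="L2_norm M h"]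
  have 1: "(\<integral>\<^sup>+t. ennreal (?k t) \<partial>lborel) = ennreal (1 / (l - Re z))"
    by (rule nn_integral_exp_decay) (use z in simp)
  show "resolvent z h \<in> L2 M"
    unfolding resolvent_def[abs_def] eq by (rule avg(2)) (use 1 u z in auto)
  show "integrable lborel (\<lambda>t. indicator {0..} t * exp (z * complex_of_real t) * P t h x)"
    unfolding eq by (rule avg(1)) (use 1 u z in auto)
qed

text \<open>Moving \<open>P a\<close> under the integral shifts time by \<open>a\<close>, so that only the part of the
  integral over \<open>[0, a)\<close> is lost.\<close>

lemma P_resolvent:
  assumes h: "h \<in> L2 M" and decay: "\<And>t. 0 \<le> t \<Longrightarrow> L2_norm M (P t h) \<le> exp (- l * t) * L2_norm M h"
    and z: "Re z < l" and a: "0 \<le> a"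
  shows "P a (resolvent z h) x =
    exp (- z * a) * (resolvent z h x - (\<integral>s. indicator {0..<a} s * exp (z * complex_of_real s) * P s h x \<partial>lborel))"
proof -
  let ?F = "\<lambda>t y. complex_of_real (p a x y) * (indicator {0..} t * exp (z * complex_of_real t) * P t h y)"
  have fin: "(\<integral>\<^sup>+t. \<integral>\<^sup>+y. ennreal (cmod (?F t y)) \<partial>count_space UNIV \<partial>lborel) < \<infinity>"
  proof -
    have "(\<integral>\<^sup>+t. \<integral>\<^sup>+y. ennreal (cmod (?F t y)) \<partial>count_space UNIV \<partial>lborel) \<le>
       (\<integral>\<^sup>+t. ennreal (indicator {0..} t * exp (- (l - Re z) * t)) * ennreal (L2_norm M h / sqrt (w x)) \<partial>lborel)"
    proof (rule nn_integral_mono)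
      fix t :: real
      show "(\<integral>\<^sup>+y. ennreal (cmod (?F t y)) \<partial>count_space UNIV) \<le>
         ennreal (indicator {0..} t * exp (- (l - Re z) * t)) * ennreal (L2_norm M h / sqrt (w x))"
      proof (cases "0 \<le> t")
        case True
        have "(\<integral>\<^sup>+y. ennreal (cmod (?F t y)) \<partial>count_space UNIV) =
          ennreal (exp (Re z * t)) * (\<integral>\<^sup>+y. ennreal (p a x y) * ennreal (cmod (P t h y)) \<partial>count_space UNIV)"
          using True by (subst nn_integral_cmult[symmetric])
            (auto simp: norm_mult norm_exp_eq_Re ennreal_mult mult_ac intro!: nn_integral_cong)
        also have "\<dots> \<le> ennreal (exp (Re z * t)) * ennreal (exp (- l * t) * L2_norm M h / sqrt (w x))"
          using w_pos[of x] decay[OF True]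
          by (intro mult_left_mono order_trans[OF P_abs_point[OF a P_L2(1)[OF True h]]] ennreal_leI divide_right_mono)
            (auto simp: less_imp_le)
        also have "\<dots> = ennreal (indicator {0..} t * exp (- (l - Re z) * t)) * ennreal (L2_norm M h / sqrt (w x))"
          using True w_pos[of x]
          by (simp add: ennreal_mult[symmetric] less_imp_le exp_add[symmetric] mult.assoc[symmetric]) (simp add: algebra_simps)
        finally show ?thesis .
      qed simp
    qed
    also have "\<dots> = ennreal (1 / (l - Re z)) * ennreal (L2_norm M h / sqrt (w x))"
      using nn_integral_exp_decay[of "l - Re z"] z by (subst nn_integral_multc) auto
    also have "\<dots> < \<infinity>" by (simp add: ennreal_mult_less_top)
    finally show ?thesis .
  qed
  have "P a (resolvent z h) x = (\<integral>y. \<integral>t. ?F t y \<partial>lborel \<partial>count_space UNIV)"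
    unfolding markov_semigroup_def[of q a] resolvent_def by simp
  also have "\<dots> = (\<integral>t. \<integral>y. ?F t y \<partial>count_space UNIV \<partial>lborel)"
    by (rule Fubini_count_space(1)[OF _ _ fin, symmetric]) (auto intro: lborel.sigma_finite_measure_axioms)
  also have "\<dots> = (\<integral>t. indicator {0..} t * exp (z * complex_of_real t) * P (a + t) h x \<partial>lborel)"
  proof (rule Bochner_Integration.integral_cong[OF refl])
    fix t :: real
    show "(\<integral>y. ?F t y \<partial>count_space UNIV) = indicator {0..} t * exp (z * complex_of_real t) * P (a + t) h x"
    proof (cases "0 \<le> t")
      case True
      have "(\<integral>y. ?F t y \<partial>count_space UNIV) =
         (\<integral>y. exp (z * complex_of_real t) * (complex_of_real (p a x y) * P t h y) \<partial>count_space UNIV)"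
        using True by (simp add: mult_ac)
      also have "\<dots> = exp (z * complex_of_real t) * P a (P t h) x"
        unfolding markov_semigroup_def[of q a] by simp
      finally show ?thesis using True by (simp add: P_semigroup a h)
    qed simp
  qed
  also have "\<dots> = (\<integral>s. indicator {a..} s * exp (z * complex_of_real (s - a)) * P s h x \<partial>lborel)"
    by (subst lborel_integral_real_affine[of 1 _ "- a"]) (auto intro!: Bochner_Integration.integral_cong split: split_indicator)
  also have "\<dots> = (\<integral>s. exp (- z * a) * (indicator {0..} s * exp (z * complex_of_real s) * P s h x
      - indicator {0..<a} s * exp (z * complex_of_real s) * P s h x) \<partial>lborel)"
    using a by (intro Bochner_Integration.integral_cong refl)
      (auto split: split_indicator simp: exp_add[symmetric] algebra_simps exp_diff exp_minus field_simps)
  also have "\<dots> = exp (- z * a) * (resolvent z h x - (\<integral>s. indicator {0..<a} s * exp (z * complex_of_real s) * P s h x \<partial>lborel))"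
  proof -
    note int = resolvent_L2(2)[OF h decay z, of x]
    have "integrable lborel (\<lambda>s. indicator {0..<a} s * exp (z * complex_of_real s) * P s h x)"
      by (rule Bochner_Integration.integrable_bound[OF int]) (auto split: split_indicator)
    then show ?thesis
      by (simp add: resolvent_def int)
  qed
  finally show ?thesis .
qed

end

section \<open>Generator and spectrum\<close>

lemma first_jump_at_0: "first_jump q v 0 x = 0"
proof -
  have "first_jump q v 0 x = (\<integral>\<^sup>+(s::real). 0 \<partial>lborel)"
    unfolding first_jump_def
  proof (rule nn_integral_cong_AE)
    show "AE s in lborel. ennreal (exp (q x x * s)) * (\<integral>\<^sup>+ z. ennreal (q x z) * v (0 - s) z \<partial>count_space (- {x}))
        * indicator {0..0} s = 0"
      using AE_lborel_singleton[of "0::real"] by eventually_elim (auto split: split_indicator)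
  qed
  then show ?thesis by simp
qed

context reversible_chain
begin

text \<open>By \<open>P_resolvent\<close> the difference quotient differs from \<open>- z * resolvent z h - h\<close> by a
  multiple of the resolvent that tends to zero and by a time average of
  \<open>h - exp (z * (s - a)) * P s h\<close> over \<open>s < a\<close>, which is small by strong continuity.\<close>

lemma resolvent_difference_quotient:
  assumes h: "h \<in> L2 M" and decay: "\<And>t. 0 \<le> t \<Longrightarrow> L2_norm M (P t h) \<le> exp (- l * t) * L2_norm M h"
    and z: "Re z < l" and a: "0 < a" and e: "0 \<le> e"
    and close: "\<And>s. 0 \<le> s \<Longrightarrow> s \<le> a \<Longrightarrow> L2_norm M (\<lambda>x. P s h x - h x) \<le> e"
      "\<And>s. 0 \<le> s \<Longrightarrow> s \<le> a \<Longrightarrow> cmod (exp (- z * complex_of_real s) - 1) \<le> e"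
  shows "L2_norm M (\<lambda>x. (P a (resolvent z h) x - resolvent z h x) / complex_of_real a - (- z * resolvent z h x - h x))
    \<le> cmod ((exp (- z * a) - 1) / a + z) * L2_norm M (resolvent z h) + e * (L2_norm M h + 1 + e)"
proof -
  let ?R = "resolvent z h"
  let ?k = "\<lambda>s. indicator {0..<a} s / a"
  let ?u = "\<lambda>s x. h x - exp (z * complex_of_real (s - a)) * P s h x"
  note R = resolvent_L2(1)[OF h decay z] and Rint = resolvent_L2(2)[OF h decay z]
  have k1: "(\<integral>\<^sup>+t. ennreal (?k t) \<partial>lborel) = ennreal 1"
  proof -
    have "(\<integral>\<^sup>+t. ennreal (?k t) \<partial>lborel) = (\<integral>\<^sup>+t. ennreal (1 / a) * indicator {0..<a} t \<partial>lborel)"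
      by (intro nn_integral_cong) (auto split: split_indicator)
    also have "\<dots> = ennreal 1"
      using a by (simp add: nn_integral_cmult ennreal_mult[symmetric])
    finally show ?thesis .
  qed
  have u: "?u s \<in> L2 M" "L2_norm M (?u s) \<le> e * (L2_norm M h + 1 + e)" if "?k s \<noteq> 0" for s
  proof -
    have s: "0 \<le> s" "s \<le> a" using that by (auto simp: indicator_def split: if_splits)
    show "?u s \<in> L2 M" by (intro L2_diff L2_cmult P_L2 h s)
    let ?c = "exp (- z * complex_of_real (a - s))"
    have c: "cmod (?c - 1) \<le> e" by (rule close(2)) (use s in auto)
    have c': "cmod ?c \<le> 1 + e"
      using norm_triangle_ineq[of "?c - 1" 1] c by simp
    have ceq: "exp (z * complex_of_real (s - a)) = ?c" by (simp add: algebra_simps)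
    have "L2_norm M (?u s) = L2_norm M (\<lambda>x. (1 - ?c) * h x - ?c * (P s h x - h x))"
      unfolding ceq by (simp add: algebra_simps)
    also have "\<dots> \<le> L2_norm M (\<lambda>x. (1 - ?c) * h x) + L2_norm M (\<lambda>x. ?c * (P s h x - h x))"
      by (intro L2_diff L2_cmult P_L2 h s)
    also have "L2_norm M (\<lambda>x. (1 - ?c) * h x) = cmod (?c - 1) * L2_norm M h"
      using L2_cmult(2)[OF h] by (simp add: norm_minus_commute)
    also have "L2_norm M (\<lambda>x. ?c * (P s h x - h x)) = cmod ?c * L2_norm M (\<lambda>x. P s h x - h x)"
      by (intro L2_cmult L2_diff P_L2 h s)
    also have "cmod (?c - 1) * L2_norm M h + cmod ?c * L2_norm M (\<lambda>x. P s h x - h x) \<le> e * L2_norm M h + (1 + e) * e"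
      by (intro add_mono mult_mono c c' close s) (use e in auto)
    finally show "L2_norm M (?u s) \<le> e * (L2_norm M h + 1 + e)" by (simp add: algebra_simps)
  qed
  have Bpos: "0 \<le> e * (L2_norm M h + 1 + e)" using e by simp
  have um: "(\<lambda>t. ?u t x) \<in> borel_measurable borel" for x by measurable
  have k0: "0 \<le> ?k t" for t using a by simp
  have km: "?k \<in> borel_measurable borel" by measurable
  note avg = L2_time_average[where u="?u" and k="?k" and c=1, OF um km k0 k1 zero_le_one u Bpos]
  let ?J = "\<lambda>x. \<integral>s. complex_of_real (?k s) * ?u s x \<partial>lborel"
  have eq: "(P a ?R x - ?R x) / complex_of_real a - (- z * ?R x - h x) =
      ((exp (- z * a) - 1) / a + z) * ?R x + ?J x" for x
  proof -
    have int: "integrable lborel (\<lambda>s. indicator {0..<a} s * exp (z * complex_of_real s) * P s h x)"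
      by (rule Bochner_Integration.integrable_bound[OF Rint]) (auto split: split_indicator)
    have inth: "integrable lborel (\<lambda>s. indicator {0..<a} s * h x)"
    proof -
      have "integrable lborel (indicator {0..<a} :: real \<Rightarrow> real)"
        using a by (simp add: integrable_indicator_iff)
      then have "integrable lborel (\<lambda>s. complex_of_real (indicator {0..<a} s) * h x)" by (intro integrable_mult_left integrable_of_real)
      then show ?thesis by (simp add: of_real_indicator)
    qed
    have inth': "(\<integral>s. indicator {0..<a} s * h x \<partial>lborel) = complex_of_real a * h x"
    proof -
      have "(\<integral>s. indicator {0..<a} s * h x \<partial>lborel) = (\<integral>s. complex_of_real (indicator {0..<a} s) * h x \<partial>lborel)"
        by (simp add: of_real_indicator)
      also have "\<dots> = complex_of_real (\<integral>s. indicator {0..<a} s \<partial>lborel) * h x"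
        by (simp del: integral_indicator)
      also have "(\<integral>s. indicator {0..<a} s \<partial>lborel) = a" using a by simp
      finally show ?thesis .
    qed
    have pt: "complex_of_real (?k s) * ?u s x = (1 / complex_of_real a) * (indicator {0..<a} s * h x
        - exp (- z * a) * (indicator {0..<a} s * exp (z * complex_of_real s) * P s h x))" for s
      using a by (auto split: split_indicator simp: field_simps exp_diff exp_minus)
    have "?J x = (1 / complex_of_real a) * (\<integral>s. indicator {0..<a} s * h x
        - exp (- z * a) * (indicator {0..<a} s * exp (z * complex_of_real s) * P s h x) \<partial>lborel)"
      unfolding pt by (rule integral_mult_right_zero)
    also have "\<dots> = (1 / complex_of_real a) * (complex_of_real a * h x
        - exp (- z * a) * (\<integral>s. indicator {0..<a} s * exp (z * complex_of_real s) * P s h x \<partial>lborel))"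
      by (subst Bochner_Integration.integral_diff[OF inth integrable_mult_right[OF int]])
        (simp only: inth' integral_mult_right_zero)
    finally have "?J x = (1 / complex_of_real a) * (complex_of_real a * h x
        - exp (- z * a) * (\<integral>s. indicator {0..<a} s * exp (z * complex_of_real s) * P s h x \<partial>lborel))" .
    note J = this
    note PR = P_resolvent[OF h decay z, of a x]
    have alg: "(E * (R - I) - R) / A - (- z * R - H) = ((E - 1) / A + z) * R + (1 / A) * (A * H - E * I)"
      if "A \<noteq> 0" for E R I A H :: complex
      using that by (simp add: field_simps)
    show ?thesis
      unfolding J using PR a alg[of "complex_of_real a"] by simp
  qed
  have "L2_norm M (\<lambda>x. ((exp (- z * a) - 1) / a + z) * ?R x + ?J x) \<le>
     L2_norm M (\<lambda>x. ((exp (- z * a) - 1) / a + z) * ?R x) + L2_norm M ?J"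
    by (intro L2_add L2_cmult R avg)
  also have "L2_norm M (\<lambda>x. ((exp (- z * a) - 1) / a + z) * ?R x) = cmod ((exp (- z * a) - 1) / a + z) * L2_norm M ?R"
    by (intro L2_cmult R)
  finally show ?thesis unfolding eq using avg(3) by simp
qed

lemma exp_difference_quotient: "((\<lambda>a. (exp (c * complex_of_real a) - 1) / complex_of_real a) \<longlongrightarrow> c) (at_right 0)"
proof -
  have "((\<lambda>w. exp (c * w)) has_field_derivative c) (at 0)"
    by (auto intro!: derivative_eq_intros)
  then have "((\<lambda>w. (exp (c * w) - 1) / w) \<longlongrightarrow> c) (at 0)"
    by (simp add: has_field_derivative_iff)
  moreover have "filterlim complex_of_real (at 0) (at_right 0)"
    unfolding filterlim_at
    by (auto intro!: tendsto_eq_intros eventually_at_rightI[of 0 1])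
  ultimately show ?thesis by (rule filterlim_compose)
qed

lemma resolvent_generator:
  assumes h: "h \<in> L2 M" and decay: "\<And>t. 0 \<le> t \<Longrightarrow> L2_norm M (P t h) \<le> exp (- l * t) * L2_norm M h"
    and z: "Re z < l"
  shows "(resolvent z h, \<lambda>x. - z * resolvent z h x - h x) \<in> L2_generator M P"
proof -
  let ?R = "resolvent z h"
  note R = resolvent_L2(1)[OF h decay z]
  let ?q = "\<lambda>a. cmod ((exp (- z * complex_of_real a) - 1) / complex_of_real a + z) * L2_norm M ?R"
  have q: "(?q \<longlongrightarrow> cmod (- z + z) * L2_norm M ?R) (at_right 0)"
    by (intro tendsto_intros exp_difference_quotient)
  have lim: "((\<lambda>t. L2_norm M (\<lambda>x. (P t ?R x - ?R x) / complex_of_real t - (- z * ?R x - h x))) \<longlongrightarrow> 0) (at_right 0)"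
  proof (rule tendstoI)
    fix \<epsilon> :: real assume \<epsilon>: "0 < \<epsilon>"
    define N where "N = L2_norm M h"
    define e where "e = min 1 (\<epsilon> / (4 * (N + 2)))"
    have N: "0 \<le> N" by (simp add: N_def)
    have e: "0 < e" "e \<le> 1" using \<epsilon> N by (auto simp: e_def)
    have "e * (N + 1 + e) \<le> (\<epsilon> / (4 * (N + 2))) * (N + 2)"
      using N e \<epsilon> by (intro mult_mono) (auto simp: e_def)
    also have "\<dots> = \<epsilon> / 4" using N by (simp add: field_simps)
    finally have e2: "e * (N + 1 + e) \<le> \<epsilon> / 4" .
    have "\<forall>\<^sub>F s in at_right 0. L2_norm M (\<lambda>x. P s h x - h x) < e"
      using P_strongly_continuous[OF h] e by (intro order_tendstoD) auto
    moreover have "\<forall>\<^sub>F s in at_right 0. cmod (exp (- z * complex_of_real s) - 1) < e"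
    proof -
      have "((\<lambda>s. cmod (exp (- z * complex_of_real s) - 1)) \<longlongrightarrow> cmod (exp (- z * complex_of_real 0) - 1)) (at_right 0)"
        by (intro tendsto_intros)
      then show ?thesis using e by (intro order_tendstoD) auto
    qed
    ultimately have "\<forall>\<^sub>F s in at_right 0. L2_norm M (\<lambda>x. P s h x - h x) < e \<and> cmod (exp (- z * complex_of_real s) - 1) < e"
      by (rule eventually_conj)
    then obtain b where b: "0 < b"
      "\<And>s. 0 < s \<Longrightarrow> s < b \<Longrightarrow> L2_norm M (\<lambda>x. P s h x - h x) < e \<and> cmod (exp (- z * complex_of_real s) - 1) < e"
      by (auto simp: eventually_at_right_field)
    have P0: "L2_norm M (\<lambda>x. P 0 h x - h x) \<le> e"
    proof -
      have "P 0 h x = h x" for x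
      proof -
        have "p 0 x y = indicator {y} x" for y
          by (simp add: transition_prob_eq, subst feller_lim_first_jump) (auto simp: first_jump_at_0 split: split_indicator)
        then show ?thesis
          unfolding markov_semigroup_def
          by (subst Bochner_Integration.integral_cong[OF refl, where g="\<lambda>y. indicator {x} y *\<^sub>R h x"])
            (auto split: split_indicator)
      qed
      then show ?thesis using e by simp
    qed
    have "\<forall>\<^sub>F a in at_right 0. ?q a < \<epsilon> / 4"
      using q \<epsilon> by (intro order_tendstoD(2)) auto
    moreover have "\<forall>\<^sub>F a in at_right 0. 0 < a \<and> a < b"
      using b(1) by (auto simp: eventually_at_right_field)
    ultimately show "\<forall>\<^sub>F t in at_right 0. dist (L2_norm M (\<lambda>x. (P t ?R x - ?R x) / complex_of_real t - (- z * ?R x - h x))) 0 < \<epsilon>"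
    proof eventually_elim
      case (elim a)
      have "L2_norm M (\<lambda>x. (P a ?R x - ?R x) / complex_of_real a - (- z * ?R x - h x)) \<le> ?q a + e * (N + 1 + e)"
        unfolding N_def
      proof (rule resolvent_difference_quotient[OF h decay z])
        show "L2_norm M (\<lambda>x. P s h x - h x) \<le> e" if "0 \<le> s" "s \<le> a" for s
          using P0 b(2)[of s] that elim by (cases "s = 0") auto
        show "cmod (exp (- z * complex_of_real s) - 1) \<le> e" if "0 \<le> s" "s \<le> a" for s
          using b(2)[of s] that elim e by (cases "s = 0") auto
      qed (use elim e in auto)
      also have "\<dots> < \<epsilon>" using e2 elim \<epsilon> by linarith
      finally show ?case by simp
    qed
  qed
  show ?thesis
    unfolding L2_generator_def using R h L2_diff(1)[OF L2_cmult(1)[OF R, of "- z"] h] lim by auto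
qed

lemma generator_diff:
  assumes "(f, g) \<in> L2_generator M P" "(f', g') \<in> L2_generator M P"
  shows "(\<lambda>x. f x - f' x, \<lambda>x. g x - g' x) \<in> L2_generator M P"
proof -
  have L: "f \<in> L2 M" "g \<in> L2 M" "f' \<in> L2 M" "g' \<in> L2 M"
    and lim: "((\<lambda>t. L2_norm M (\<lambda>x. (P t f x - f x) / complex_of_real t - g x)) \<longlongrightarrow> 0) (at_right 0)"
      "((\<lambda>t. L2_norm M (\<lambda>x. (P t f' x - f' x) / complex_of_real t - g' x)) \<longlongrightarrow> 0) (at_right 0)"
    using assms by (auto simp: L2_generator_def)
  have "\<forall>\<^sub>F t in at_right 0. L2_norm M (\<lambda>x. (P t (\<lambda>x. f x - f' x) x - (f x - f' x)) / complex_of_real t - (g x - g' x)) \<le>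
    L2_norm M (\<lambda>x. (P t f x - f x) / complex_of_real t - g x) + L2_norm M (\<lambda>x. (P t f' x - f' x) / complex_of_real t - g' x)"
    using eventually_at_right_less
  proof eventually_elim
    fix t :: real assume "0 < t"
    then have t: "0 \<le> t" by simp
    have d: "(\<lambda>x. (P t f x - f x) / complex_of_real t - g x) \<in> L2 M" if "f \<in> L2 M" "g \<in> L2 M" for f g
      using L2_diff(1)[OF L2_cmult(1)[OF L2_diff(1)[OF P_L2(1)[OF t that(1)] that(1)], of "1 / complex_of_real t"] that(2)]
      by simp
    have "L2_norm M (\<lambda>x. (P t (\<lambda>x. f x - f' x) x - (f x - f' x)) / complex_of_real t - (g x - g' x)) =
      L2_norm M (\<lambda>x. ((P t f x - f x) / complex_of_real t - g x) - ((P t f' x - f' x) / complex_of_real t - g' x))"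
      by (simp add: P_diff t L diff_divide_distrib add_divide_distrib algebra_simps)
    also have "\<dots> \<le> L2_norm M (\<lambda>x. (P t f x - f x) / complex_of_real t - g x) + L2_norm M (\<lambda>x. (P t f' x - f' x) / complex_of_real t - g' x)"
      by (intro L2_diff d L)
    finally show "L2_norm M (\<lambda>x. (P t (\<lambda>x. f x - f' x) x - (f x - f' x)) / complex_of_real t - (g x - g' x)) \<le>
    L2_norm M (\<lambda>x. (P t f x - f x) / complex_of_real t - g x) + L2_norm M (\<lambda>x. (P t f' x - f' x) / complex_of_real t - g' x)" .
  qed
  from tendsto_sandwich[OF _ this tendsto_const tendsto_add_zero[OF lim]]
  have "((\<lambda>t. L2_norm M (\<lambda>x. (P t (\<lambda>x. f x - f' x) x - (f x - f' x)) / complex_of_real t - (g x - g' x))) \<longlongrightarrow> 0) (at_right 0)"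
    by simp
  then show ?thesis unfolding L2_generator_def using L by (auto intro: L2_diff)
qed

text \<open>On the mean-zero part \<open>f0\<close> of \<open>f\<close>, the expansion
  \<open>P t f0 = (1 - t * z) * f0 - t * h0 + o(t)\<close> with \<open>h0\<close> the mean-zero part of
  \<open>h = - g - z * f\<close> is compared with
  \<open>\<parallel>P t f0\<parallel> \<le> exp (- l * t) * \<parallel>f0\<parallel>\<close>. Dividing by
  \<open>t\<close> gives \<open>(l - Re z) * \<parallel>f0\<parallel> \<le> \<parallel>h0\<parallel>\<close>.
  The mean of \<open>f\<close> is \<open>- 1 / z\<close> times that of \<open>h\<close>, because the generator
  kills means.\<close>

lemma generator_lower_bound:
  assumes gen: "(f, g) \<in> L2_generator M P" and dec: "decaying l f" and z: "Re z < l" "z \<noteq> 0"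
  shows "L2_norm M f \<le> (2 / (l - Re z) + 1 / cmod z) * L2_norm M (\<lambda>x. - g x - z * f x)"
proof -
  have f: "f \<in> L2 M" and g: "g \<in> L2 M"
    and lim: "((\<lambda>t. L2_norm M (\<lambda>x. (P t f x - f x) / complex_of_real t - g x)) \<longlongrightarrow> 0) (at_right 0)"
    using gen by (auto simp: L2_generator_def)
  let ?r = "\<lambda>t x. (P t f x - f x) / complex_of_real t - g x"
  let ?h = "\<lambda>x. - g x - z * f x"
  let ?f0 = "\<lambda>x. f x - mean f"
  have rL: "?r t \<in> L2 M" if "0 \<le> t" for t
    using L2_diff(1)[OF L2_cmult(1)[OF L2_diff(1)[OF P_L2(1)[OF that f] f], of "1 / complex_of_real t"] g] by simp
  have mg: "mean g = 0"
  proof -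
    have "\<forall>\<^sub>F t in at_right 0. cmod (mean g) * mass \<le> L2_norm M (?r t)"
      using eventually_at_right_less
    proof eventually_elim
      fix t :: real assume "0 < t"
      then have t: "0 \<le> t" by simp
      have "mean (\<lambda>x. (P t f x - f x) / complex_of_real t) = 0"
        using mean_cmult[of "1 / complex_of_real t" "\<lambda>x. P t f x - f x"] by (simp add: mean_diff P_L2 f t mean_P)
      moreover have "(\<lambda>x. (P t f x - f x) / complex_of_real t) \<in> L2 M"
        using L2_cmult(1)[OF L2_diff(1)[OF P_L2(1)[OF t f] f], of "1 / complex_of_real t"] by simp
      ultimately have "mean (?r t) = - mean g" by (simp add: mean_diff g)
      then show "cmod (mean g) * mass \<le> L2_norm M (?r t)"
        using mean_bound[OF rL[OF t]] by simp
    qed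
    from tendsto_lowerbound[OF lim this] have "cmod (mean g) * mass \<le> 0" by simp
    then show ?thesis using mass_pos by (simp add: mult_le_0_iff)
  qed
  have hL: "?h \<in> L2 M" by (intro L2_diff L2_uminus L2_cmult f g)
  have mh: "mean ?h = - z * mean f"
    using mean_cmult[of "-1" g] by (simp add: mean_diff L2_uminus g L2_cmult f mean_cmult mg)
  let ?hz = "\<lambda>x. ?h x - mean ?h"
  have h0: "?hz x = - g x - z * ?f0 x" for x by (simp add: mh algebra_simps)
  have f0L: "?f0 \<in> L2 M" by (intro L2_diff f L2_const)
  have h0L: "?hz \<in> L2 M" by (intro L2_diff hL L2_const)
  have main: "(l - Re z) * L2_norm M ?f0 \<le> L2_norm M ?hz"
  proof (rule tendsto_le[of "at_right 0"])
    have "((\<lambda>t. - Re ((exp (complex_of_real (- l) * complex_of_real t) - 1) / complex_of_real t)) \<longlongrightarrow> - Re (complex_of_real (- l))) (at_right 0)"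
      by (intro tendsto_intros exp_difference_quotient)
    moreover have "- Re ((exp (complex_of_real (- l) * complex_of_real t) - 1) / complex_of_real t) = (1 - exp (- l * t)) / t" for t
    proof -
      have "(exp (complex_of_real (- l) * complex_of_real t) - 1) / complex_of_real t = complex_of_real ((exp (- l * t) - 1) / t)"
        by (simp flip: exp_of_real)
      then show ?thesis
        unfolding \<open>_ = complex_of_real _\<close> Re_complex_of_real by (simp add: diff_divide_distrib)
    qed
    ultimately have "((\<lambda>t. (1 - exp (- l * t)) / t) \<longlongrightarrow> l) (at_right 0)" by simp
    then show "((\<lambda>t. ((1 - exp (- l * t)) / t - Re z) * L2_norm M ?f0) \<longlongrightarrow> (l - Re z) * L2_norm M ?f0) (at_right 0)"
      by (intro tendsto_intros)
    have "((\<lambda>t. L2_norm M ?hz + L2_norm M (?r t)) \<longlongrightarrow> L2_norm M ?hz + 0) (at_right 0)"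
      by (intro tendsto_intros lim)
    then show "((\<lambda>t. L2_norm M ?hz + L2_norm M (?r t)) \<longlongrightarrow> L2_norm M ?hz) (at_right 0)" by simp
    show "\<forall>\<^sub>F t in at_right 0. ((1 - exp (- l * t)) / t - Re z) * L2_norm M ?f0 \<le> L2_norm M ?hz + L2_norm M (?r t)"
      using eventually_at_right_less
    proof eventually_elim
      fix t :: real assume t0: "0 < t"
      then have t: "0 \<le> t" by simp
      let ?c = "1 - complex_of_real t * z"
      have "1 - t * Re z \<le> cmod ?c"
        using complex_Re_le_cmod[of ?c] by simp
      then have "(1 - t * Re z) * L2_norm M ?f0 \<le> cmod ?c * L2_norm M ?f0"
        by (intro mult_right_mono) auto
      also have "\<dots> = L2_norm M (\<lambda>x. ?c * ?f0 x)"
        using L2_cmult(2)[OF f0L] by simp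
      also have "(\<lambda>x. ?c * ?f0 x) = (\<lambda>x. (P t f x - mean f) + complex_of_real t * (?hz x - ?r t x))"
      proof
        fix x
        have "complex_of_real t * ?r t x = P t f x - f x - complex_of_real t * g x"
          using t0 by (simp add: field_simps)
        then show "?c * ?f0 x = (P t f x - mean f) + complex_of_real t * (?hz x - ?r t x)"
          unfolding h0 by (simp only: right_diff_distrib) (simp add: algebra_simps)
      qed
      also have "L2_norm M \<dots> \<le> L2_norm M (\<lambda>x. P t f x - mean f) + L2_norm M (\<lambda>x. complex_of_real t * (?hz x - ?r t x))"
        by (intro L2_add L2_diff L2_cmult P_L2 f t L2_const h0L rL)
      also have "L2_norm M (\<lambda>x. complex_of_real t * (?hz x - ?r t x)) = t * L2_norm M (\<lambda>x. ?hz x - ?r t x)"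
        using L2_cmult(2)[OF L2_diff(1)[OF h0L rL[OF t]], of "complex_of_real t"] t by simp
      also have "\<dots> \<le> t * (L2_norm M ?hz + L2_norm M (?r t))"
        using L2_diff(2)[OF h0L rL[OF t]] t by (rule mult_left_mono)
      also have "L2_norm M (\<lambda>x. P t f x - mean f) \<le> exp (- l * t) * L2_norm M ?f0"
        using dec t unfolding decaying_def by auto
      finally have "(1 - t * Re z - exp (- l * t)) * L2_norm M ?f0 \<le> t * (L2_norm M ?hz + L2_norm M (?r t))"
        by (simp add: algebra_simps)
      then have "(1 - t * Re z - exp (- l * t)) * L2_norm M ?f0 / t \<le> L2_norm M ?hz + L2_norm M (?r t)"
        using t0 by (simp add: pos_divide_le_eq mult.commute)
      moreover have "(1 - t * Re z - exp (- l * t)) * L2_norm M ?f0 / t = ((1 - exp (- l * t)) / t - Re z) * L2_norm M ?f0"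
        using t0 by (simp add: field_simps)
      ultimately show "((1 - exp (- l * t)) / t - Re z) * L2_norm M ?f0 \<le> L2_norm M ?hz + L2_norm M (?r t)" by simp
    qed
  qed simp
  have "L2_norm M ?hz \<le> L2_norm M ?h + L2_norm M (\<lambda>_. mean ?h)"
    by (intro L2_diff hL L2_const)
  also have "L2_norm M (\<lambda>_. mean ?h) \<le> L2_norm M ?h"
    using mean_bound[OF hL] by (simp add: L2_norm_const)
  finally have "(l - Re z) * L2_norm M ?f0 \<le> 2 * L2_norm M ?h" using main by linarith
  then have 1: "L2_norm M ?f0 \<le> 2 / (l - Re z) * L2_norm M ?h"
    using z by (simp add: field_simps)
  have "cmod z * (cmod (mean f) * mass) \<le> L2_norm M ?h"
    using mean_bound[OF hL] unfolding mh by (simp add: norm_mult mult.assoc)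
  then have 2: "cmod (mean f) * mass \<le> 1 / cmod z * L2_norm M ?h"
    using z by (simp add: field_simps)
  have "L2_norm M f = L2_norm M (\<lambda>x. ?f0 x + mean f)" by simp
  also have "\<dots> \<le> L2_norm M ?f0 + L2_norm M (\<lambda>_. mean f)"
    by (intro L2_add f0L L2_const)
  also have "\<dots> \<le> 2 / (l - Re z) * L2_norm M ?h + 1 / cmod z * L2_norm M ?h"
    using 1 2 by (simp add: L2_norm_const)
  finally show ?thesis by (simp add: distrib_right)
qed

text \<open>Injectivity and boundedness of the inverse come from the lower bound, surjectivity from the Laplace transform
  applied to the mean-zero part and division by \<open>- z\<close> of the mean.\<close>

theorem spectral_gap_resolvent:
  assumes gap: "\<And>f. f \<in> L2 M \<Longrightarrow> decaying l f" and z: "Re z < l" "z \<noteq> 0"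
  shows "z \<in> L2_resolvent_set M (neg_graph (L2_generator M P))"
proof -
  let ?T = "L2_generator M P"
  let ?\<Phi> = "\<lambda>(f, g). \<lambda>x. g x - z * f x :: complex"
  have GL: "f \<in> L2 M \<and> g \<in> L2 M" if "(f, g) \<in> ?T" for f g
    using that by (auto simp: L2_generator_def)
  have low: "L2_norm M f \<le> (2 / (l - Re z) + 1 / cmod z) * L2_norm M (\<lambda>x. - g x - z * f x)" if "(f, g) \<in> ?T" for f g
    using generator_lower_bound[OF that gap z] GL[OF that] by blast
  have neg: "(f, g) \<in> neg_graph ?T \<longleftrightarrow> (f, \<lambda>x. - g x) \<in> ?T" for f g
  proof
    assume "(f, \<lambda>x. - g x) \<in> ?T"
    then show "(f, g) \<in> neg_graph ?T" unfolding neg_graph_def by (intro image_eqI[where x="(f, \<lambda>x. - g x)"]) auto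
  qed (auto simp: neg_graph_def)
  have inj: "inj_on ?\<Phi> (neg_graph ?T)"
  proof (rule inj_onI)
    fix a b assume a: "a \<in> neg_graph ?T" and b: "b \<in> neg_graph ?T" and eq: "?\<Phi> a = ?\<Phi> b"
    obtain f g f' g' where ab: "a = (f, g)" "b = (f', g')" by (metis surj_pair)
    have eq': "g x - z * f x = g' x - z * f' x" for x using eq ab by (auto dest: fun_cong)
    have T: "(\<lambda>x. f x - f' x, \<lambda>x. - g x - (- g' x)) \<in> ?T"
      by (rule generator_diff) (use a b ab neg in auto)
    have "- (- g x - (- g' x)) - z * (f x - f' x) = 0" for x using eq'[of x] by (simp add: algebra_simps)
    then have "L2_norm M (\<lambda>x. f x - f' x) \<le> 0"
      using low[OF T] by simp
    then have "L2_norm M (\<lambda>x. f x - f' x) = 0" using L2_norm_nonneg[of "\<lambda>x. f x - f' x"] by linarith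
    then have "\<forall>x. f x - f' x = 0" using L2_norm_0_iff GL[OF T] by blast
    then have "f = f'" by auto
    then have "g = g'" using eq' by auto
    with \<open>f = f'\<close> ab show "a = b" by simp
  qed
  have surj: "?\<Phi> ` neg_graph ?T = L2 M"
  proof (intro equalityI subsetI)
    fix h assume "h \<in> ?\<Phi> ` neg_graph ?T"
    then obtain f g where "(f, g) \<in> neg_graph ?T" "h = (\<lambda>x. g x - z * f x)" by auto
    moreover from this have "f \<in> L2 M" "g \<in> L2 M"
      using GL[of f "\<lambda>x. - g x"] L2_uminus(1)[of "\<lambda>x. - g x"] by (auto simp: neg)
    ultimately show "h \<in> L2 M" by (auto intro: L2_diff L2_cmult)
  next
    fix h assume h: "h \<in> L2 M"
    let ?h0 = "\<lambda>x. h x - mean h"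
    have h0: "?h0 \<in> L2 M" by (intro L2_diff h L2_const)
    have decay: "L2_norm M (P t ?h0) \<le> exp (- l * t) * L2_norm M ?h0" if "0 \<le> t" for t
      using gap[OF h] that unfolding decaying_def by (simp add: P_diff that h L2_const P_const)
    let ?R = "resolvent z ?h0"
    note R = resolvent_generator[OF h0 decay z(1)]
    have RL: "?R \<in> L2 M" using GL[OF R] by simp
    let ?f = "\<lambda>x. ?R x - mean h / z"
    have "(\<lambda>_. mean h / z, \<lambda>_. 0) \<in> ?T"
    proof -
      have "\<forall>\<^sub>F t in at_right 0. L2_norm M (\<lambda>x. (P t (\<lambda>_. mean h / z) x - mean h / z) / complex_of_real t - 0) = 0"
        using eventually_at_right_less by eventually_elim (simp add: P_const)
      from tendsto_eventually[OF this] show ?thesis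
        by (simp add: L2_generator_def L2_const del: diff_0_right)
    qed
    from generator_diff[OF R this] have "(?f, \<lambda>x. - z * ?R x - ?h0 x) \<in> ?T" by (simp only: diff_0_right)
    moreover have "(\<lambda>x. - z * ?R x - ?h0 x) = (\<lambda>x. - (z * ?R x + ?h0 x))" by auto
    ultimately have "(?f, \<lambda>x. z * ?R x + ?h0 x) \<in> neg_graph ?T" by (simp only: neg)
    moreover have "h = ?\<Phi> (?f, \<lambda>x. z * ?R x + ?h0 x)"
      using z by (auto simp: algebra_simps)
    ultimately show "h \<in> ?\<Phi> ` neg_graph ?T" by (rule rev_image_eqI)
  qed
  have "\<forall>(f, g)\<in>neg_graph ?T. L2_norm M f \<le> (2 / (l - Re z) + 1 / cmod z) * L2_norm M (\<lambda>x. g x - z * f x)"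
  proof clarify
    fix f g assume "(f, g) \<in> neg_graph ?T"
    then have "(f, \<lambda>x. - g x) \<in> ?T" by (simp add: neg)
    from low[OF this] show "L2_norm M f \<le> (2 / (l - Re z) + 1 / cmod z) * L2_norm M (\<lambda>x. g x - z * f x)"
      by simp
  qed
  then show ?thesis
    unfolding L2_resolvent_set_def bij_betw_def using inj surj by blast
qed

text \<open>An eigenfunction makes \<open>- L - l\<close> fail to be injective.\<close>

theorem eigenvalue_in_spectrum:
  assumes f: "f \<in> L2 M" "f x0 \<noteq> 0" and eig: "\<And>t. 0 \<le> t \<Longrightarrow> P t f = (\<lambda>x. complex_of_real (exp (- l * t)) * f x)"
  shows "complex_of_real l \<in> L2_spectrum M (neg_graph (L2_generator M P))"
proof -
  let ?T = "L2_generator M P"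
  have "((\<lambda>t. cmod ((exp (complex_of_real (- l) * complex_of_real t) - 1) / complex_of_real t - complex_of_real (- l)) * L2_norm M f)
      \<longlongrightarrow> cmod (complex_of_real (- l) - complex_of_real (- l)) * L2_norm M f) (at_right 0)"
    by (intro tendsto_intros exp_difference_quotient)
  then have lim: "((\<lambda>t. cmod ((exp (complex_of_real (- l) * complex_of_real t) - 1) / complex_of_real t - complex_of_real (- l)) * L2_norm M f)
      \<longlongrightarrow> 0) (at_right 0)" by simp
  have "\<forall>\<^sub>F t in at_right 0. cmod ((exp (complex_of_real (- l) * complex_of_real t) - 1) / complex_of_real t - complex_of_real (- l)) * L2_norm M f
     = L2_norm M (\<lambda>x. (P t f x - f x) / complex_of_real t - complex_of_real (- l) * f x)"
    using eventually_at_right_less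
  proof eventually_elim
    fix t :: real assume "0 < t"
    then have t: "0 \<le> t" by simp
    have "(\<lambda>x. (P t f x - f x) / complex_of_real t - complex_of_real (- l) * f x) =
      (\<lambda>x. ((exp (complex_of_real (- l) * complex_of_real t) - 1) / complex_of_real t - complex_of_real (- l)) * f x)"
      by (simp add: eig[OF t] diff_divide_distrib algebra_simps flip: exp_of_real)
    then show "cmod ((exp (complex_of_real (- l) * complex_of_real t) - 1) / complex_of_real t - complex_of_real (- l)) * L2_norm M f
     = L2_norm M (\<lambda>x. (P t f x - f x) / complex_of_real t - complex_of_real (- l) * f x)"
      using L2_cmult(2)[OF f(1)] by simp
  qed
  then have "((\<lambda>t. L2_norm M (\<lambda>x. (P t f x - f x) / complex_of_real t - complex_of_real (- l) * f x)) \<longlongrightarrow> 0) (at_right 0)"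
    by (rule Lim_transform_eventually[OF lim])
  then have T: "(f, \<lambda>x. complex_of_real (- l) * f x) \<in> ?T"
    unfolding L2_generator_def using f L2_cmult(1)[OF f(1)] by blast
  from generator_diff[OF T T] have T0: "(\<lambda>_. 0, \<lambda>_. 0) \<in> ?T" by simp
  have N: "(f, \<lambda>x. complex_of_real l * f x) \<in> neg_graph ?T"
    unfolding neg_graph_def using T by (intro image_eqI[where x="(f, \<lambda>x. complex_of_real (- l) * f x)"]) auto
  have N0: "(\<lambda>_. 0, \<lambda>_. 0) \<in> neg_graph ?T"
    unfolding neg_graph_def using T0 by (intro image_eqI[where x="(\<lambda>_. 0, \<lambda>_. 0)"]) auto
  have "\<not> inj_on (\<lambda>(f, g). \<lambda>x. g x - complex_of_real l * f x) (neg_graph ?T)"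
  proof
    assume "inj_on (\<lambda>(f, g). \<lambda>x. g x - complex_of_real l * f x) (neg_graph ?T)"
    from inj_onD[OF this _ N N0] have "f = (\<lambda>_. 0)" by auto
    with f(2) show False by simp
  qed
  then show ?thesis
    by (auto simp: L2_spectrum_def L2_resolvent_set_def bij_betw_def)
qed

end

section \<open>The random walk with killing\<close>

text \<open>The form of the killed walk in the inner product weighted by \<open>\<alpha>\<close>, in which the walk is
  symmetric.\<close>

definition rw_form :: "('v::finite \<Rightarrow> 'v \<Rightarrow> real) \<Rightarrow> ('v \<Rightarrow> real) \<Rightarrow> ('v \<Rightarrow> real) \<Rightarrow> ('v \<Rightarrow> real) \<Rightarrow> ('v \<Rightarrow> real) \<Rightarrow> real" where
  "rw_form c \<alpha> \<omega> f g = (\<Sum>x\<in>UNIV. \<alpha> x * f x * rw_neg_generator c \<alpha> \<omega> g x)"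

locale killed_walk =
  fixes c :: "'v::finite \<Rightarrow> 'v \<Rightarrow> real" and \<alpha> \<omega> :: "'v \<Rightarrow> real"
  assumes conn: "connected_conductances c"
    and \<alpha>_pos: "0 < \<alpha> x"
    and \<omega>_nonneg: "0 \<le> \<omega> x"
    and \<omega>_nonzero: "\<exists>x. \<omega> x \<noteq> 0"
begin

lemma c_sym: "c x y = c y x" and c_nonneg: "0 \<le> c x y" and c_diag: "c x x = 0"
  and c_conn: "(\<lambda>u v. 0 < c u v)\<^sup>*\<^sup>* x y"
  using conn by (auto simp: connected_conductances_def)

lemma rw_form_eq:
  "rw_form c \<alpha> \<omega> f g = (\<Sum>x\<in>UNIV. \<Sum>y\<in>UNIV. c x y * \<alpha> x * \<alpha> y * (f x - f y) * (g x - g y)) / 2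
     + (\<Sum>x\<in>UNIV. \<alpha> x * \<omega> x * f x * g x)"
proof -
  let ?s = "\<lambda>x y. c x y * \<alpha> x * \<alpha> y * f x * (g x - g y)"
  have "(\<Sum>x\<in>UNIV. \<Sum>y\<in>UNIV. ?s x y) = (\<Sum>x\<in>UNIV. \<Sum>y\<in>UNIV. ?s y x)"
    by (rule sum.swap)
  then have "2 * (\<Sum>x\<in>UNIV. \<Sum>y\<in>UNIV. ?s x y) = (\<Sum>x\<in>UNIV. \<Sum>y\<in>UNIV. ?s x y + ?s y x)"
    by (simp add: sum.distrib)
  also have "\<dots> = (\<Sum>x\<in>UNIV. \<Sum>y\<in>UNIV. c x y * \<alpha> x * \<alpha> y * (f x - f y) * (g x - g y))"
  proof (intro sum.cong refl)
    fix x y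
    show "?s x y + ?s y x = c x y * \<alpha> x * \<alpha> y * (f x - f y) * (g x - g y)"
      unfolding c_sym[of y x] by (simp add: algebra_simps)
  qed
  finally have 1: "(\<Sum>x\<in>UNIV. \<Sum>y\<in>UNIV. ?s x y) =
    (\<Sum>x\<in>UNIV. \<Sum>y\<in>UNIV. c x y * \<alpha> x * \<alpha> y * (f x - f y) * (g x - g y)) / 2" by simp
  have "rw_form c \<alpha> \<omega> f g = (\<Sum>x\<in>UNIV. (\<Sum>y\<in>UNIV. ?s x y) + \<alpha> x * \<omega> x * f x * g x)"
    unfolding rw_form_def rw_neg_generator_def
    by (intro sum.cong refl) (simp add: distrib_left sum_distrib_left sum_negf[symmetric] algebra_simps)
  then show ?thesis by (simp add: sum.distrib 1)
qed

lemma rw_form_sym: "rw_form c \<alpha> \<omega> f g = rw_form c \<alpha> \<omega> g f"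
  unfolding rw_form_eq by (simp add: mult_ac)

lemma rw_form_add_left:
  "rw_form c \<alpha> \<omega> (\<lambda>x. f x + t * g x) h = rw_form c \<alpha> \<omega> f h + t * rw_form c \<alpha> \<omega> g h"
  unfolding rw_form_def by (simp add: sum.distrib sum_distrib_left algebra_simps)

lemma rw_form_abs: "rw_form c \<alpha> \<omega> (\<lambda>x. \<bar>f x\<bar>) (\<lambda>x. \<bar>f x\<bar>) \<le> rw_form c \<alpha> \<omega> f f"
proof -
  have "c x y * \<alpha> x * \<alpha> y * (\<bar>f x\<bar> - \<bar>f y\<bar>) * (\<bar>f x\<bar> - \<bar>f y\<bar>) \<le> c x y * \<alpha> x * \<alpha> y * (f x - f y) * (f x - f y)" for x y
  proof -
    have "(\<bar>f x\<bar> - \<bar>f y\<bar>)\<^sup>2 \<le> (f x - f y)\<^sup>2"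
      using abs_triangle_ineq3[of "f x" "f y"] by (simp only: abs_le_square_iff)
    then have "(\<bar>f x\<bar> - \<bar>f y\<bar>) * (\<bar>f x\<bar> - \<bar>f y\<bar>) \<le> (f x - f y) * (f x - f y)"
      by (simp only: power2_eq_square)
    then have "(c x y * \<alpha> x * \<alpha> y) * ((\<bar>f x\<bar> - \<bar>f y\<bar>) * (\<bar>f x\<bar> - \<bar>f y\<bar>)) \<le> (c x y * \<alpha> x * \<alpha> y) * ((f x - f y) * (f x - f y))"
      using c_nonneg \<alpha>_pos by (intro mult_left_mono) (auto simp: less_imp_le)
    then show ?thesis by (simp add: mult.assoc)
  qed
  then show ?thesis
    unfolding rw_form_eq by (intro add_mono divide_right_mono sum_mono) (auto simp: mult.assoc)
qed

text \<open>The substitution \<open>f x = v x / sqrt (\<alpha> x)\<close> turns the weighted norm into the Euclidean one,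
  and the Rayleigh quotient attains its minimum on the compact sphere.\<close>

lemma rw_form_minimiser:
  obtains f l where "f \<noteq> (\<lambda>_. 0)" "\<And>g. l * (\<Sum>x\<in>UNIV. \<alpha> x * (g x)\<^sup>2) \<le> rw_form c \<alpha> \<omega> g g"
    "rw_form c \<alpha> \<omega> f f = l * (\<Sum>x\<in>UNIV. \<alpha> x * (f x)\<^sup>2)"
proof -
  define F where "F v = (\<lambda>x. v $ x / sqrt (\<alpha> x))" for v :: "real ^ 'v"
  define Q where "Q v = rw_form c \<alpha> \<omega> (F v) (F v)" for v
  have N: "(\<Sum>x\<in>UNIV. \<alpha> x * (F v x)\<^sup>2) = (norm v)\<^sup>2" for v
    unfolding norm_vec_def L2_set_def F_def
    using \<alpha>_pos by (simp add: power_divide less_imp_le sum_nonneg less_imp_neq[symmetric])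
  have "continuous_on (sphere 0 1) Q"
    unfolding Q_def F_def rw_form_eq by (intro continuous_intros) (use \<alpha>_pos in \<open>auto simp: less_imp_neq[symmetric]\<close>)
  moreover have "sphere (0::real^'v) 1 \<noteq> {}" by simp
  ultimately obtain v where v: "v \<in> sphere 0 1" "\<And>u. u \<in> sphere 0 1 \<Longrightarrow> Q v \<le> Q u"
    using continuous_attains_inf[OF compact_sphere] by blast
  have hom: "Q (r *\<^sub>R u) = r\<^sup>2 * Q u" for r u
    unfolding Q_def F_def rw_form_eq
    by (simp add: sum_distrib_left distrib_left power2_eq_square algebra_simps diff_divide_distrib)
  have all: "Q v * (norm u)\<^sup>2 \<le> Q u" for u
  proof (cases "u = 0")
    case True
    then show ?thesis using hom[of 0 0] by simp
  next
    case False
    have "Q v \<le> Q ((1 / norm u) *\<^sub>R u)" by (rule v(2)) (use False in simp)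
    then show ?thesis unfolding hom using False by (simp add: field_simps)
  qed
  show ?thesis
  proof
    show "F v \<noteq> (\<lambda>_. 0)" using N[of v] v(1) by auto
    show "Q v * (\<Sum>x\<in>UNIV. \<alpha> x * (g x)\<^sup>2) \<le> rw_form c \<alpha> \<omega> g g" for g
    proof -
      have "F (\<chi> x. sqrt (\<alpha> x) * g x) = g"
        using \<alpha>_pos by (auto simp: F_def less_imp_neq[symmetric])
      then show ?thesis using all[of "\<chi> x. sqrt (\<alpha> x) * g x"] N[of "\<chi> x. sqrt (\<alpha> x) * g x"] by (simp add: Q_def)
    qed
    show "rw_form c \<alpha> \<omega> (F v) (F v) = Q v * (\<Sum>x\<in>UNIV. \<alpha> x * (F v x)\<^sup>2)"
      using v(1) by (simp add: N Q_def)
  qed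
qed

text \<open>First-order condition in the direction of the defect \<open>g\<close> of the eigenvalue equation: the slope
  there is twice the weighted norm square of \<open>g\<close>.\<close>

lemma minimiser_eigenfunction:
  assumes low: "\<And>g. l * (\<Sum>x\<in>UNIV. \<alpha> x * (g x)\<^sup>2) \<le> rw_form c \<alpha> \<omega> g g"
    and eq: "rw_form c \<alpha> \<omega> f f \<le> l * (\<Sum>x\<in>UNIV. \<alpha> x * (f x)\<^sup>2)"
  shows "rw_neg_generator c \<alpha> \<omega> f = (\<lambda>x. l * f x)"
proof
  fix z
  define g where "g = (\<lambda>x. rw_neg_generator c \<alpha> \<omega> f x - l * f x)"
  define b where "b = (\<Sum>x\<in>UNIV. \<alpha> x * (g x)\<^sup>2)"
  define d where "d = rw_form c \<alpha> \<omega> g g - l * (\<Sum>x\<in>UNIV. \<alpha> x * (g x)\<^sup>2)"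
  have exp1: "rw_form c \<alpha> \<omega> (\<lambda>x. f x + t * g x) (\<lambda>x. f x + t * g x) =
      rw_form c \<alpha> \<omega> f f + 2 * t * rw_form c \<alpha> \<omega> g f + t\<^sup>2 * rw_form c \<alpha> \<omega> g g" for t
  proof -
    have "rw_form c \<alpha> \<omega> h (\<lambda>x. f x + t * g x) = rw_form c \<alpha> \<omega> f h + t * rw_form c \<alpha> \<omega> g h" for h
      by (subst rw_form_sym) (rule rw_form_add_left)
    then show ?thesis
      by (simp add: rw_form_add_left power2_eq_square algebra_simps rw_form_sym[of f g])
  qed
  have exp2: "(\<Sum>x\<in>UNIV. \<alpha> x * (f x + t * g x)\<^sup>2) = (\<Sum>x\<in>UNIV. \<alpha> x * (f x)\<^sup>2) + 2 * t * (\<Sum>x\<in>UNIV. \<alpha> x * f x * g x)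
      + t\<^sup>2 * (\<Sum>x\<in>UNIV. \<alpha> x * (g x)\<^sup>2)" for t
    by (simp add: sum.distrib sum_distrib_left power2_eq_square algebra_simps)
  have b: "rw_form c \<alpha> \<omega> g f - l * (\<Sum>x\<in>UNIV. \<alpha> x * f x * g x) = b"
    unfolding rw_form_def b_def g_def
    by (simp add: sum_subtractf[symmetric] sum_distrib_left power2_eq_square algebra_simps)
  have pos: "0 \<le> 2 * t * b + t\<^sup>2 * d" for t
  proof -
    have "l * ((\<Sum>x\<in>UNIV. \<alpha> x * (f x)\<^sup>2) + 2 * t * (\<Sum>x\<in>UNIV. \<alpha> x * f x * g x) + t\<^sup>2 * (\<Sum>x\<in>UNIV. \<alpha> x * (g x)\<^sup>2))
       \<le> rw_form c \<alpha> \<omega> f f + 2 * t * rw_form c \<alpha> \<omega> g f + t\<^sup>2 * rw_form c \<alpha> \<omega> g g"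
      using low[of "\<lambda>x. f x + t * g x"] unfolding exp1 exp2 .
    then show ?thesis using eq unfolding b[symmetric] d_def by (simp add: algebra_simps)
  qed
  have b0: "0 \<le> b" unfolding b_def using \<alpha>_pos by (intro sum_nonneg mult_nonneg_nonneg) (auto simp: less_imp_le)
  have d0: "0 \<le> d" unfolding d_def using low[of g] by simp
  have "b = 0"
  proof (rule ccontr)
    assume "b \<noteq> 0"
    then have bp: "0 < b" using b0 by simp
    \<comment> \<open>A step so short that the linear term of \<open>2 * t * b + t\<^sup>2 * d\<close> at \<open>t = - s\<close>
      outweighs the quadratic one.\<close>
    define s where "s = b / (d + 1)"
    have s: "0 < s" "b = s * (d + 1)" using bp d0 by (auto simp: s_def)
    have "0 \<le> 2 * (- s) * b + (- s)\<^sup>2 * d" by (rule pos)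
    also have "\<dots> = - (s\<^sup>2 * (d + 2))"
      unfolding s(2) by (simp add: power2_eq_square algebra_simps)
    finally have "s\<^sup>2 * (d + 2) \<le> 0" by simp
    moreover have "0 < s\<^sup>2 * (d + 2)" using s(1) d0 by (intro mult_pos_pos) auto
    ultimately show False by simp
  qed
  then have "\<alpha> z * (g z)\<^sup>2 = 0"
    unfolding b_def using \<alpha>_pos by (subst (asm) sum_nonneg_eq_0_iff) (auto simp: less_imp_le)
  then show "rw_neg_generator c \<alpha> \<omega> f z = l * f z"
    using \<alpha>_pos[of z] by (simp add: g_def)
qed

text \<open>Taking absolute values does not increase the form, so there is a non-negative minimiser. By the eigenvalue
  equation a zero spreads to all neighbours, and by connectedness to all sites. The eigenvalue is positive
  because pairing the equation with the constant one leaves only the killing term.\<close>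

lemma principal_eigenfunction:
  obtains \<psi> l where "\<And>x. 0 < \<psi> x" "rw_neg_generator c \<alpha> \<omega> \<psi> = (\<lambda>x. l * \<psi> x)" "0 < l"
    "\<And>g. l * (\<Sum>x\<in>UNIV. \<alpha> x * (g x)\<^sup>2) \<le> rw_form c \<alpha> \<omega> g g"
proof -
  obtain f l where f: "f \<noteq> (\<lambda>_. 0)" and low: "\<And>g. l * (\<Sum>x\<in>UNIV. \<alpha> x * (g x)\<^sup>2) \<le> rw_form c \<alpha> \<omega> g g"
    and eq: "rw_form c \<alpha> \<omega> f f = l * (\<Sum>x\<in>UNIV. \<alpha> x * (f x)\<^sup>2)"
    using rw_form_minimiser by blast
  define \<psi> where "\<psi> = (\<lambda>x. \<bar>f x\<bar>)"
  have eig: "rw_neg_generator c \<alpha> \<omega> \<psi> = (\<lambda>x. l * \<psi> x)"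
    by (rule minimiser_eigenfunction[OF low]) (use rw_form_abs[of f] eq in \<open>simp add: \<psi>_def\<close>)
  have \<psi>0: "0 \<le> \<psi> x" for x by (simp add: \<psi>_def)
  have zero: "\<psi> y = 0" if "\<psi> x = 0" "0 < c x y" for x y
  proof -
    have "0 = (\<Sum>y\<in>UNIV. c x y * \<alpha> y * \<psi> y)"
      using fun_cong[OF eig, of x] that(1) by (simp add: rw_neg_generator_def)
    then have "\<forall>y\<in>UNIV. c x y * \<alpha> y * \<psi> y = 0"
      using c_nonneg \<alpha>_pos \<psi>0 by (subst (asm) eq_commute, subst (asm) sum_nonneg_eq_0_iff) (auto simp: less_imp_le)
    then have "c x y * \<alpha> y * \<psi> y = 0" by simp
    then show ?thesis using that(2) \<alpha>_pos[of y] by simp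
  qed
  have pos: "0 < \<psi> x" for x
  proof (rule ccontr)
    assume "\<not> 0 < \<psi> x"
    then have x: "\<psi> x = 0" using \<psi>0[of x] by simp
    have "\<psi> y = 0" for y
      using c_conn[of x y] by (induction rule: rtranclp_induct) (auto intro: x zero)
    then show False using f by (auto simp: \<psi>_def)
  qed
  have "rw_form c \<alpha> \<omega> (\<lambda>_. 1) \<psi> = l * (\<Sum>x\<in>UNIV. \<alpha> x * \<psi> x)"
    unfolding rw_form_def eig by (simp add: sum_distrib_left mult_ac)
  moreover have "rw_form c \<alpha> \<omega> (\<lambda>_. 1) \<psi> = (\<Sum>x\<in>UNIV. \<alpha> x * \<omega> x * \<psi> x)"
    unfolding rw_form_eq by simp
  moreover have "0 < (\<Sum>x\<in>UNIV. \<alpha> x * \<omega> x * \<psi> x)"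
  proof -
    obtain x where "\<omega> x \<noteq> 0" using \<omega>_nonzero by blast
    then have "0 < \<omega> x" using \<omega>_nonneg[of x] by simp
    then have "0 < \<alpha> x * \<omega> x * \<psi> x" using \<alpha>_pos pos by simp
    also have "\<dots> \<le> (\<Sum>x\<in>UNIV. \<alpha> x * \<omega> x * \<psi> x)"
      by (rule member_le_sum) (use \<alpha>_pos \<omega>_nonneg \<psi>0 in \<open>auto simp: less_imp_le\<close>)
    finally show ?thesis .
  qed
  moreover have "0 < (\<Sum>x\<in>UNIV. \<alpha> x * \<psi> x)"
    by (rule sum_pos) (use \<alpha>_pos pos in auto)
  ultimately have "0 < l" by (metis zero_less_mult_pos2)
  from that[OF pos eig this low] show ?thesis .
qed

text \<open>Eigenvectors of distinct eigenvalues are orthogonal in the weighted inner product, hence linearly independent.\<close>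

lemma finite_eigenvalues: "finite {l. \<exists>f. f \<noteq> (\<lambda>_. 0) \<and> rw_neg_generator c \<alpha> \<omega> f = (\<lambda>x. l * f x)}"
proof -
  define E where "E = {l. \<exists>f. f \<noteq> (\<lambda>_. 0) \<and> rw_neg_generator c \<alpha> \<omega> f = (\<lambda>x. l * f x)}"
  define f where "f l = (SOME f. f \<noteq> (\<lambda>_. 0) \<and> rw_neg_generator c \<alpha> \<omega> f = (\<lambda>x. l * f x))" for l
  have f: "f l \<noteq> (\<lambda>_. 0)" "rw_neg_generator c \<alpha> \<omega> (f l) = (\<lambda>x. l * f l x)" if "l \<in> E" for l
    using someI_ex[of "\<lambda>f. f \<noteq> (\<lambda>_. 0) \<and> rw_neg_generator c \<alpha> \<omega> f = (\<lambda>x. l * f x)"] that unfolding f_def E_def by auto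
  define v where "v l = (\<chi> x. sqrt (\<alpha> x) * f l x)" for l
  have inner: "v l \<bullet> v m = (\<Sum>x\<in>UNIV. \<alpha> x * f l x * f m x)" for l m
  proof -
    have "sqrt (\<alpha> x) * f l x * (sqrt (\<alpha> x) * f m x) = \<alpha> x * f l x * f m x" for x
    proof -
      have "sqrt (\<alpha> x) * f l x * (sqrt (\<alpha> x) * f m x) = (sqrt (\<alpha> x) * sqrt (\<alpha> x)) * f l x * f m x"
        by (simp only: mult_ac)
      then show ?thesis using \<alpha>_pos[of x] by simp
    qed
    then show ?thesis
      unfolding inner_vec_def v_def by (simp only: vec_lambda_beta inner_real_def)
  qed
  have orth: "v l \<bullet> v m = 0" if "l \<in> E" "m \<in> E" "l \<noteq> m" for l m
  proof -
    have "m * (v l \<bullet> v m) = rw_form c \<alpha> \<omega> (f l) (f m)"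
      unfolding rw_form_def f(2)[OF that(2)] inner by (simp add: sum_distrib_left mult_ac)
    moreover have "l * (v l \<bullet> v m) = rw_form c \<alpha> \<omega> (f m) (f l)"
      unfolding rw_form_def f(2)[OF that(1)] inner by (simp add: sum_distrib_left mult_ac)
    ultimately have "m * (v l \<bullet> v m) = l * (v l \<bullet> v m)" using rw_form_sym[of "f l" "f m"] by simp
    then show ?thesis using that(3) by (simp only: mult_cancel_right) blast
  qed
  have nz: "v l \<noteq> 0" if "l \<in> E" for l
  proof
    assume "v l = 0"
    then have "sqrt (\<alpha> x) * f l x = 0" for x by (metis v_def vec_lambda_beta zero_index)
    then have "f l x = 0" for x using \<alpha>_pos[of x] by (metis mult_eq_0_iff real_sqrt_eq_0_iff less_irrefl)
    then show False using f(1)[OF that] by auto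
  qed
  have "independent (v ` E)"
    by (rule pairwise_orthogonal_independent) (use orth nz in \<open>auto simp: pairwise_def orthogonal_def\<close>)
  then have "finite (v ` E)" by (rule independent_imp_finite)
  moreover have "inj_on v E"
    using orth nz by (intro inj_onI) (metis inner_eq_zero_iff)
  ultimately have "finite E" by (rule finite_imageD)
  then show ?thesis by (simp add: E_def)
qed

lemma gap_RW_principal:
  assumes pos: "\<And>x. 0 < \<psi> x" and eig: "rw_neg_generator c \<alpha> \<omega> \<psi> = (\<lambda>x. l * \<psi> x)"
    and low: "\<And>g. l * (\<Sum>x\<in>UNIV. \<alpha> x * (g x)\<^sup>2) \<le> rw_form c \<alpha> \<omega> g g"
  shows "gap_RW c \<alpha> \<omega> = l"
  unfolding gap_RW_def
proof (rule Min_eqI[OF finite_eigenvalues])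
  show "l \<in> {l. \<exists>f. f \<noteq> (\<lambda>_. 0) \<and> rw_neg_generator c \<alpha> \<omega> f = (\<lambda>x. l * f x)}"
  proof (intro CollectI exI conjI)
    show "\<psi> \<noteq> (\<lambda>_. 0)" using pos[of undefined] by auto
  qed (rule eig)
  fix m assume "m \<in> {l. \<exists>f. f \<noteq> (\<lambda>_. 0) \<and> rw_neg_generator c \<alpha> \<omega> f = (\<lambda>x. l * f x)}"
  then obtain f where f0: "f \<noteq> (\<lambda>_. 0)" and f2: "rw_neg_generator c \<alpha> \<omega> f = (\<lambda>x. m * f x)" by blast
  from f0 obtain x where "f x \<noteq> 0" by auto
  note f = this f2
  have "l * (\<Sum>x\<in>UNIV. \<alpha> x * (f x)\<^sup>2) \<le> m * (\<Sum>x\<in>UNIV. \<alpha> x * (f x)\<^sup>2)"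
    using low[of f] unfolding rw_form_def f(2) by (simp add: sum_distrib_left power2_eq_square mult_ac)
  moreover have "0 < (\<Sum>x\<in>UNIV. \<alpha> x * (f x)\<^sup>2)"
    by (rule sum_pos2[of _ x]) (use f \<alpha>_pos in \<open>auto simp: less_imp_le\<close>)
  ultimately show "l \<le> m" by simp
qed

end

section \<open>The inclusion process as a reversible chain\<close>

text \<open>Several indices may lead to the same state, so that transfers and reservoir moves can be listed by their kind
  instead of by their result.\<close>

definition jump_op :: "('i::finite \<Rightarrow> 's \<Rightarrow> real) \<Rightarrow> ('i \<Rightarrow> 's \<Rightarrow> 's) \<Rightarrow> ('s \<Rightarrow> real) \<Rightarrow> 's \<Rightarrow> real" where
  "jump_op a T f x = (\<Sum>i\<in>UNIV. a i x * (f (T i x) - f x))"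

lemma rate_matrix_jump_op:
  "rate_matrix (jump_op a T) x y = (\<Sum>i\<in>UNIV. a i x * (indicator {y} (T i x) - indicator {y} x))"
  by (simp add: rate_matrix_def jump_op_def)

lemma finite_row_jump_op: "finite {y. rate_matrix (jump_op a T) x y \<noteq> 0}"
proof (rule finite_subset)
  show "{y. rate_matrix (jump_op a T) x y \<noteq> 0} \<subseteq> insert x (range (\<lambda>i. T i x))"
  proof (rule subsetI, rule ccontr)
    fix y assume y: "y \<in> {y. rate_matrix (jump_op a T) x y \<noteq> 0}" "y \<notin> insert x (range (\<lambda>i. T i x))"
    then have "rate_matrix (jump_op a T) x y = 0"
      unfolding rate_matrix_jump_op by (intro sum.neutral) (auto simp: indicator_def)
    with y show False by simp
  qed
qed simp

lemma rate_apply_jump_op: "rate_apply (rate_matrix (jump_op a T)) f x = jump_op a T f x"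
proof -
  let ?q = "rate_matrix (jump_op a T)"
  define S where "S = insert x (range (\<lambda>i. T i x))"
  have fin: "finite S" by (simp add: S_def)
  have sub: "{y. ?q x y \<noteq> 0} \<subseteq> S"
  proof (rule subsetI, rule ccontr)
    fix y assume y: "y \<in> {y. ?q x y \<noteq> 0}" "y \<notin> S"
    then have "?q x y = 0"
      unfolding rate_matrix_jump_op S_def by (intro sum.neutral) (auto simp: indicator_def)
    with y show False by simp
  qed
  have "rate_apply ?q f x = (\<Sum>y\<in>S. ?q x y * f y)"
    unfolding rate_apply_def by (rule sum.mono_neutral_left) (use fin sub in auto)
  also have "\<dots> = (\<Sum>y\<in>S. \<Sum>i\<in>UNIV. a i x * (indicator {y} (T i x) - indicator {y} x) * f y)"
    by (simp add: rate_matrix_jump_op sum_distrib_right)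
  also have "\<dots> = (\<Sum>i\<in>UNIV. \<Sum>y\<in>S. a i x * (indicator {y} (T i x) - indicator {y} x) * f y)"
    by (rule sum.swap)
  also have "\<dots> = jump_op a T f x"
    unfolding jump_op_def
  proof (intro sum.cong refl)
    fix i
    have ind: "(\<Sum>y\<in>S. indicator {y} z * f y) = f z" if "z \<in> S" for z
    proof -
      have "(\<Sum>y\<in>S. indicator {y} z * f y) = (\<Sum>y\<in>S. if y = z then f y else 0)"
        by (intro sum.cong refl) (auto simp: indicator_def)
      then show ?thesis using that fin by simp
    qed
    have "(\<Sum>y\<in>S. a i x * (indicator {y} (T i x) - indicator {y} x) * f y) =
      a i x * ((\<Sum>y\<in>S. indicator {y} (T i x) * f y) - (\<Sum>y\<in>S. indicator {y} x * f y))"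
      by (simp add: sum_distrib_left sum_subtractf[symmetric] algebra_simps)
    then show "(\<Sum>y\<in>S. a i x * (indicator {y} (T i x) - indicator {y} x) * f y) = a i x * (f (T i x) - f x)"
      using ind[of "T i x"] ind[of x] by (simp add: S_def)
  qed
  finally show ?thesis .
qed

lemma rate_matrix_jump_op_nonneg:
  assumes "\<And>i. 0 \<le> a i x" "x \<noteq> y"
  shows "0 \<le> rate_matrix (jump_op a T) x y"
  unfolding rate_matrix_jump_op using assms by (intro sum_nonneg mult_nonneg_nonneg) auto

text \<open>Detailed balance need only be verified move by move, against the reverse move \<open>r i\<close>.\<close>

lemma jump_op_detailed_balance:
  assumes invol: "\<And>i. r (r i) = i"
    and rev: "\<And>i x. a i x \<noteq> 0 \<Longrightarrow> T (r i) (T i x) = x \<and> w x * a i x = w (T i x) * a (r i) (T i x)"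
    and w: "\<And>x. w x \<noteq> 0"
  shows "w x * rate_matrix (jump_op a T) x y = w y * rate_matrix (jump_op a T) y x"
proof (cases "x = y")
  case False
  have bij: "bij r" by (rule o_bij[of r]) (auto simp: invol)
  have "w x * rate_matrix (jump_op a T) x y = (\<Sum>i\<in>UNIV. w x * a i x * indicator {y} (T i x))"
    unfolding rate_matrix_jump_op sum_distrib_left by (intro sum.cong refl) (use False in auto)
  also have "\<dots> = (\<Sum>i\<in>UNIV. w y * a (r i) y * indicator {x} (T (r i) y))"
  proof (intro sum.cong refl)
    fix i
    show "w x * a i x * indicator {y} (T i x) = w y * a (r i) y * indicator {x} (T (r i) y)"
      using rev[of i x] rev[of "r i" y] w[of x] w[of y] invol[of i]
      by (cases "a i x = 0"; cases "a (r i) y = 0") (auto simp: indicator_def)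
  qed
  also have "\<dots> = (\<Sum>i\<in>UNIV. w y * a i y * indicator {x} (T i y))"
    by (rule sum.reindex_bij_betw[OF bij])
  also have "\<dots> = w y * rate_matrix (jump_op a T) y x"
    unfolding rate_matrix_jump_op sum_distrib_left by (intro sum.cong refl) (use False in auto)
  finally show ?thesis .
qed simp

text \<open>Applied to the process and its dual acting on the two arguments of a duality function.\<close>

lemma jump_op_commute:
  "jump_op a T (\<lambda>x. jump_op b S (\<lambda>y. G x y) y) x = jump_op b S (\<lambda>y. jump_op a T (\<lambda>x. G x y) x) y"
proof -
  let ?d = "\<lambda>i j. a i x * b j y * (G (T i x) (S j y) - G (T i x) y - (G x (S j y) - G x y))"
  have "jump_op a T (\<lambda>x. jump_op b S (\<lambda>y. G x y) y) x = (\<Sum>i\<in>UNIV. \<Sum>j\<in>UNIV. ?d i j)"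
    unfolding jump_op_def sum_subtractf[symmetric] sum_distrib_left
    by (intro sum.cong refl) (simp add: algebra_simps)
  also have "\<dots> = (\<Sum>j\<in>UNIV. \<Sum>i\<in>UNIV. ?d i j)" by (rule sum.swap)
  also have "\<dots> = jump_op b S (\<lambda>y. jump_op a T (\<lambda>x. G x y) x) y"
    unfolding jump_op_def sum_subtractf[symmetric] sum_distrib_left
    by (intro sum.cong refl) (simp add: algebra_simps)
  finally show ?thesis .
qed

text \<open>A particle transfer along an ordered pair of sites, or an exchange with the reservoir at a site, where
  \<open>True\<close> stands for the creation of a particle.\<close>

type_synonym 'v move = "'v \<times> 'v + 'v \<times> bool"

fun move_rate :: "('v \<Rightarrow> 'v \<Rightarrow> real) \<Rightarrow> ('v \<Rightarrow> real) \<Rightarrow> ('v \<Rightarrow> real) \<Rightarrow> real \<Rightarrow> 'v move \<Rightarrow> ('v \<Rightarrow> nat) \<Rightarrow> real" where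
  "move_rate c \<alpha> \<omega> \<rho> (Inl (x, y)) \<eta> = c x y * real (\<eta> x) * (\<alpha> y + real (\<eta> y))"
| "move_rate c \<alpha> \<omega> \<rho> (Inr (x, False)) \<eta> = \<omega> x * (real (\<eta> x) * (1 + \<rho>))"
| "move_rate c \<alpha> \<omega> \<rho> (Inr (x, True)) \<eta> = \<omega> x * (\<rho> * (\<alpha> x + real (\<eta> x)))"

fun move :: "'v move \<Rightarrow> ('v \<Rightarrow> nat) \<Rightarrow> 'v \<Rightarrow> nat" where
  "move (Inl (x, y)) \<eta> = add_particle y (remove_particle x \<eta>)"
| "move (Inr (x, False)) \<eta> = remove_particle x \<eta>"
| "move (Inr (x, True)) \<eta> = add_particle x \<eta>"

fun reverse_move :: "'v move \<Rightarrow> 'v move" where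
  "reverse_move (Inl (x, y)) = Inl (y, x)"
| "reverse_move (Inr (x, b)) = Inr (x, \<not> b)"

lemma sip_generator_eq_jump_op: "sip_generator c \<alpha> \<omega> \<rho> = jump_op (move_rate c \<alpha> \<omega> \<rho>) move"
proof (intro ext)
  fix f \<eta>
  have "jump_op (move_rate c \<alpha> \<omega> \<rho>) move f \<eta> =
     (\<Sum>p\<in>UNIV. move_rate c \<alpha> \<omega> \<rho> (Inl p) \<eta> * (f (move (Inl p) \<eta>) - f \<eta>))
     + (\<Sum>p\<in>UNIV. move_rate c \<alpha> \<omega> \<rho> (Inr p) \<eta> * (f (move (Inr p) \<eta>) - f \<eta>))"
    unfolding jump_op_def by (subst UNIV_Plus_UNIV[symmetric], subst sum.Plus) (auto simp: o_def)
  also have "\<dots> = (\<Sum>x\<in>UNIV. \<Sum>y\<in>UNIV. move_rate c \<alpha> \<omega> \<rho> (Inl (x, y)) \<eta> * (f (move (Inl (x, y)) \<eta>) - f \<eta>))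
     + (\<Sum>x\<in>UNIV. \<Sum>b\<in>UNIV. move_rate c \<alpha> \<omega> \<rho> (Inr (x, b)) \<eta> * (f (move (Inr (x, b)) \<eta>) - f \<eta>))"
    unfolding UNIV_Times_UNIV[symmetric] by (simp only: sum.cartesian_product case_prod_unfold prod.collapse)
  also have "\<dots> = sip_generator c \<alpha> \<omega> \<rho> f \<eta>"
    by (simp add: sip_generator_def UNIV_bool algebra_simps)
  finally show "sip_generator c \<alpha> \<omega> \<rho> f \<eta> = jump_op (move_rate c \<alpha> \<omega> \<rho>) move f \<eta>" by simp
qed

locale open_sip = killed_walk c \<alpha> \<omega>
  for c :: "'v::finite \<Rightarrow> 'v \<Rightarrow> real" and \<alpha> \<omega> :: "'v \<Rightarrow> real" +
  fixes \<rho> :: real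
  assumes \<rho>_pos: "0 < \<rho>"
begin

abbreviation size :: "('v \<Rightarrow> nat) \<Rightarrow> nat" where "size \<eta> \<equiv> (\<Sum>x\<in>UNIV. \<eta> x)"

abbreviation L :: "(('v \<Rightarrow> nat) \<Rightarrow> real) \<Rightarrow> ('v \<Rightarrow> nat) \<Rightarrow> real" where
  "L \<equiv> sip_generator c \<alpha> \<omega> \<rho>"

definition w :: "('v \<Rightarrow> nat) \<Rightarrow> real" where
  "w \<eta> = (1 + \<rho>) powr (- (\<Sum>x\<in>UNIV. \<alpha> x)) * (\<rho> / (1 + \<rho>)) ^ (\<Sum>x\<in>UNIV. \<eta> x) *
     (\<Prod>x\<in>UNIV. Gamma (\<alpha> x + real (\<eta> x)) / (Gamma (\<alpha> x) * fact (\<eta> x)))"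

lemma sip_stationary_eq: "sip_stationary \<alpha> \<rho> = point_measure UNIV (\<lambda>\<eta>. ennreal (w \<eta>))"
  by (simp add: sip_stationary_def w_def)

definition r :: real where "r = \<rho> / (1 + \<rho>)"

lemma r: "0 < r" "r < 1" "(1 + \<rho>) * r = \<rho>"
  using \<rho>_pos by (auto simp: r_def)

text \<open>The one-site negative binomial weight without its normalisation.\<close>

definition site_weight :: "'v \<Rightarrow> nat \<Rightarrow> real" where
  "site_weight x n = r ^ n * (Gamma (\<alpha> x + real n) / (Gamma (\<alpha> x) * fact n))"

lemma site_weight_pos: "0 < site_weight x n"
  using r(1) \<alpha>_pos[of x] unfolding site_weight_def
  by (intro mult_pos_pos divide_pos_pos Gamma_real_pos) auto

lemma site_weight_Suc: "site_weight x (Suc n) * real (Suc n) = site_weight x n * r * (\<alpha> x + real n)"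
proof -
  have "Gamma (\<alpha> x + real (Suc n)) = (\<alpha> x + real n) * Gamma (\<alpha> x + real n)"
    using Gamma_plus1[of "\<alpha> x + real n"] \<alpha>_pos[of x] by (auto simp: add_ac nonpos_Ints_def)
  moreover have "0 < Gamma (\<alpha> x)" using \<alpha>_pos by (rule Gamma_real_pos)
  ultimately show ?thesis
    unfolding site_weight_def by (simp add: field_simps del: of_nat_Suc)
qed

lemma w_eq: "w \<eta> = (1 + \<rho>) powr (- (\<Sum>x\<in>UNIV. \<alpha> x)) * (\<Prod>x\<in>UNIV. site_weight x (\<eta> x))"
  by (simp only: w_def site_weight_def r_def prod.distrib power_sum mult.assoc)

lemma w_pos: "0 < w \<eta>"
  unfolding w_eq using site_weight_pos \<rho>_pos by (intro mult_pos_pos prod_pos) auto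

lemma w_add_particle: "w (add_particle x \<eta>) * (real (\<eta> x) + 1) = w \<eta> * (r * (\<alpha> x + real (\<eta> x)))"
proof -
  have "(\<Prod>z\<in>UNIV. site_weight z (add_particle x \<eta> z)) = site_weight x (Suc (\<eta> x)) * (\<Prod>z\<in>UNIV - {x}. site_weight z (\<eta> z))"
    by (subst prod.remove[of _ x]) (auto simp: add_particle_def intro!: prod.cong)
  moreover have "(\<Prod>z\<in>UNIV. site_weight z (\<eta> z)) = site_weight x (\<eta> x) * (\<Prod>z\<in>UNIV - {x}. site_weight z (\<eta> z))"
    by (subst prod.remove[of _ x]) auto
  ultimately show ?thesis
    unfolding w_eq using site_weight_Suc[of x "\<eta> x"] by (simp add: mult_ac add_ac)
qed

lemma w_remove_particle:
  assumes "0 < \<eta> x"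
  shows "w \<eta> * real (\<eta> x) = w (remove_particle x \<eta>) * (r * (\<alpha> x + real (\<eta> x) - 1))"
proof -
  have "add_particle x (remove_particle x \<eta>) = \<eta>"
    using assms by (auto simp: add_particle_def remove_particle_def)
  then show ?thesis
    using w_add_particle[of x "remove_particle x \<eta>"] assms
    by (simp add: remove_particle_def of_nat_diff algebra_simps)
qed

lemma sip_detailed_balance: "w \<eta> * rate_matrix L \<eta> \<zeta> = w \<zeta> * rate_matrix L \<zeta> \<eta>"
  unfolding sip_generator_eq_jump_op
proof (rule jump_op_detailed_balance[where r=reverse_move])
  show "reverse_move (reverse_move i) = i" for i :: "'v move"
    by (cases i) auto
  show "w \<eta> \<noteq> 0" for \<eta> using w_pos[of \<eta>] by simp
  fix i \<eta> assume a: "move_rate c \<alpha> \<omega> \<rho> i \<eta> \<noteq> 0"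
  show "move (reverse_move i) (move i \<eta>) = \<eta> \<and>
      w \<eta> * move_rate c \<alpha> \<omega> \<rho> i \<eta> = w (move i \<eta>) * move_rate c \<alpha> \<omega> \<rho> (reverse_move i) (move i \<eta>)"
  proof (cases i)
    case (Inl xy)
    obtain x y where i: "i = Inl (x, y)" using Inl by (cases xy) auto
    have x: "0 < \<eta> x" and xy: "x \<noteq> y" using a c_diag[of x] by (auto simp: i)
    let ?z = "remove_particle x \<eta>"
    have inv_move: "add_particle x (remove_particle y (add_particle y ?z)) = \<eta>"
      using x xy by (auto simp: add_particle_def remove_particle_def)
    have vals: "add_particle y ?z y = Suc (\<eta> y)" "real (add_particle y ?z x) = real (\<eta> x) - 1" "?z y = \<eta> y"
      using x xy by (auto simp: add_particle_def remove_particle_def)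
    have 1: "w \<eta> * real (\<eta> x) = w ?z * (r * (\<alpha> x + real (\<eta> x) - 1))"
      by (rule w_remove_particle) (rule x)
    have 2: "w (add_particle y ?z) * (real (\<eta> y) + 1) = w ?z * (r * (\<alpha> y + real (\<eta> y)))"
      using w_add_particle[of y ?z] by (simp add: vals)
    have "w \<eta> * (c x y * real (\<eta> x) * (\<alpha> y + real (\<eta> y))) = c x y * (w \<eta> * real (\<eta> x)) * (\<alpha> y + real (\<eta> y))"
      by simp
    also have "\<dots> = c y x * (w (add_particle y ?z) * (real (\<eta> y) + 1)) * (\<alpha> x + real (\<eta> x) - 1)"
      unfolding 1 2 c_sym[of x y] by (simp add: mult_ac)
    finally show ?thesis
      using inv_move by (simp add: i vals algebra_simps)
  next
    case (Inr xb)
    obtain x b where ib: "i = Inr (x, b)" using Inr by (cases xb) auto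
    show ?thesis
    proof (cases b)
      case False
      have x: "0 < \<eta> x" using a by (auto simp: ib False)
      have inv_move: "add_particle x (remove_particle x \<eta>) = \<eta>"
        using x by (auto simp: add_particle_def remove_particle_def)
      have v: "real (remove_particle x \<eta> x) = real (\<eta> x) - 1" using x by (auto simp: remove_particle_def)
      have "w \<eta> * (\<omega> x * (real (\<eta> x) * (1 + \<rho>))) = \<omega> x * (1 + \<rho>) * (w \<eta> * real (\<eta> x))" by simp
      also have "\<dots> = \<omega> x * ((1 + \<rho>) * r) * (w (remove_particle x \<eta>) * (\<alpha> x + real (\<eta> x) - 1))"
        unfolding w_remove_particle[where \<eta>=\<eta> and x=x, OF x] by simp
      finally show ?thesis using inv_move unfolding r(3) by (simp add: ib False v algebra_simps)
    next
      case True
      have inv_move: "remove_particle x (add_particle x \<eta>) = \<eta>"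
        by (auto simp: add_particle_def remove_particle_def)
      have v: "real (add_particle x \<eta> x) = real (\<eta> x) + 1" by (auto simp: add_particle_def)
      have "w \<eta> * (\<omega> x * (\<rho> * (\<alpha> x + real (\<eta> x)))) = \<omega> x * (1 + \<rho>) * (w \<eta> * (r * (\<alpha> x + real (\<eta> x))))"
        using r(3) by (simp add: mult_ac)
      also have "\<dots> = \<omega> x * (1 + \<rho>) * (w (add_particle x \<eta>) * (real (\<eta> x) + 1))"
        by (simp only: w_add_particle)
      finally show ?thesis using inv_move by (simp add: ib True v algebra_simps)
    qed
  qed
qed

lemma site_weight_summable:
  assumes s: "0 \<le> s" "s * r < 1"
  shows "summable (\<lambda>n. site_weight x n * s ^ n)"
proof -
  define \<beta> where "\<beta> = (s * r + 1) / 2"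
  have \<beta>: "s * r < \<beta>" "\<beta> < 1" using s by (auto simp: \<beta>_def)
  have "(\<lambda>n. s * r * ((\<alpha> x + real n) / (real n + 1))) \<longlonglongrightarrow> s * r * 1"
  proof (intro tendsto_mult tendsto_const)
    have "(\<lambda>n. 1 + (\<alpha> x - 1) * (1 / (real n + 1))) \<longlonglongrightarrow> 1 + (\<alpha> x - 1) * 0"
      by (intro tendsto_intros LIMSEQ_Suc[OF lim_1_over_n, simplified]) (use LIMSEQ_Suc[OF lim_1_over_n] in \<open>simp add: add.commute\<close>)
    moreover have "1 + (\<alpha> x - 1) * (1 / (real n + 1)) = (\<alpha> x + real n) / (real n + 1)" for n
      by (simp add: field_simps)
    ultimately show "(\<lambda>n. (\<alpha> x + real n) / (real n + 1)) \<longlonglongrightarrow> 1" by simp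
  qed
  then have "\<forall>\<^sub>F n in sequentially. s * r * ((\<alpha> x + real n) / (real n + 1)) < \<beta>"
    using \<beta> by (intro order_tendstoD) auto
  then obtain N where N: "\<And>n. N \<le> n \<Longrightarrow> s * r * ((\<alpha> x + real n) / (real n + 1)) < \<beta>"
    by (auto simp: eventually_sequentially)
  show ?thesis
  proof (rule summable_ratio_test[OF \<beta>(2)])
    fix n assume n: "N \<le> n"
    have "site_weight x (Suc n) = site_weight x n * r * (\<alpha> x + real n) / (real n + 1)"
      using site_weight_Suc[of x n] by (simp add: field_simps)
    then have "site_weight x (Suc n) * s ^ Suc n = (site_weight x n * s ^ n) * (s * r * ((\<alpha> x + real n) / (real n + 1)))"
      by simp
    also have "\<dots> \<le> (site_weight x n * s ^ n) * \<beta>"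
      using N[OF n] site_weight_pos[of x n] s by (intro mult_left_mono) (auto simp: less_imp_le)
    finally show "norm (site_weight x (Suc n) * s ^ Suc n) \<le> \<beta> * norm (site_weight x n * s ^ n)"
      using site_weight_pos[of x n] site_weight_pos[of x "Suc n"] s by (simp add: abs_mult mult_ac)
  qed
qed

lemma w_exp_integrable:
  assumes s: "0 \<le> s" "s * r < 1"
  shows "integrable (count_space UNIV) (\<lambda>\<eta>. w \<eta> * s ^ size \<eta>)"
proof -
  have "integrable (count_space (PiE (UNIV :: 'v set) (\<lambda>_. UNIV))) (\<lambda>g. \<Prod>x\<in>UNIV. site_weight x (g x) * s ^ g x)"
  proof (rule abs_summable_on_prod_PiE[unfolded Infinite_Set_Sum.abs_summable_on_def])
    show "integrable (count_space UNIV) (\<lambda>n. site_weight x n * s ^ n)" for x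
      using site_weight_summable[OF s, of x] site_weight_pos s
      by (simp add: integrable_count_space_nat_iff abs_mult less_imp_le)
  qed auto
  then have "integrable (count_space UNIV) (\<lambda>g. \<Prod>x\<in>UNIV. site_weight x (g x) * s ^ g x)"
    by simp
  then have "integrable (count_space UNIV) (\<lambda>g. (1 + \<rho>) powr (- (\<Sum>x\<in>UNIV. \<alpha> x)) * (\<Prod>x\<in>UNIV. site_weight x (g x) * s ^ g x))"
    by (rule integrable_mult_right)
  then show ?thesis
    unfolding w_eq by (simp add: prod.distrib power_sum mult_ac)
qed

lemma finite_size_le: "finite {\<eta> :: 'v \<Rightarrow> nat. size \<eta> \<le> n}"
proof (rule finite_subset)
  show "{\<eta> :: 'v \<Rightarrow> nat. size \<eta> \<le> n} \<subseteq> PiE UNIV (\<lambda>_. {..n})"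
  proof
    fix \<eta> :: "'v \<Rightarrow> nat" assume "\<eta> \<in> {\<eta>. size \<eta> \<le> n}"
    then have "\<eta> x \<le> n" for x
      using member_le_sum[of x UNIV \<eta>] by (simp add: order_trans)
    then show "\<eta> \<in> PiE UNIV (\<lambda>_. {..n})" by auto
  qed
  show "finite (PiE (UNIV :: 'v set) (\<lambda>_. {..n}))" by (intro finite_PiE) auto
qed

lemma size_add_particle: "size (add_particle x \<eta>) = Suc (size \<eta>)"
proof -
  have "size (add_particle x \<eta>) = Suc (\<eta> x) + (\<Sum>z\<in>UNIV - {x}. \<eta> z)"
    by (subst sum.remove[of _ x]) (auto simp: add_particle_def intro!: sum.cong)
  moreover have "size \<eta> = \<eta> x + (\<Sum>z\<in>UNIV - {x}. \<eta> z)"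
    by (subst sum.remove[of _ x]) auto
  ultimately show ?thesis by simp
qed

lemma size_remove_particle: "0 < \<eta> x \<Longrightarrow> Suc (size (remove_particle x \<eta>)) = size \<eta>"
proof -
  assume "0 < \<eta> x"
  then have "add_particle x (remove_particle x \<eta>) = \<eta>"
    by (auto simp: add_particle_def remove_particle_def)
  then show ?thesis using size_add_particle[of x "remove_particle x \<eta>"] by simp
qed

text \<open>This base makes the reservoir part of the generator act on \<open>s0 ^ size \<eta>\<close> without a term that
  grows with \<open>\<eta>\<close>. It is the radius of convergence of the one-site generating function.\<close>

definition s0 :: real where "s0 = (1 + \<rho>) / \<rho>"

lemma s0: "1 < s0" "s0 * r = 1" "\<rho> * (s0 - 1) = 1" "(1 + \<rho>) * (1 - 1 / s0) = 1"
proof -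
  have "0 < \<rho> + \<rho> * \<rho>" using \<rho>_pos by (simp add: add_pos_pos)
  then show "1 < s0" "s0 * r = 1" "\<rho> * (s0 - 1) = 1" "(1 + \<rho>) * (1 - 1 / s0) = 1"
    using \<rho>_pos by (auto simp: s0_def r_def field_simps)
qed

text \<open>Transfers preserve the number of particles. At the reservoirs the terms proportional to
  \<open>\<eta> x\<close> cancel by the choice of \<open>s0\<close>.\<close>

lemma L_exp: "L (\<lambda>\<eta>. s0 ^ size \<eta>) \<eta> = (\<Sum>x\<in>UNIV. \<omega> x * \<alpha> x) * s0 ^ size \<eta>"
proof -
  have 1: "c x y * real (\<eta> x) * (\<alpha> y + real (\<eta> y)) * (s0 ^ size (add_particle y (remove_particle x \<eta>)) - s0 ^ size \<eta>) = 0" for x y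
    by (cases "\<eta> x = 0") (auto simp: size_add_particle size_remove_particle)
  have 2: "\<omega> x * (real (\<eta> x) * (1 + \<rho>) * (s0 ^ size (remove_particle x \<eta>) - s0 ^ size \<eta>) +
         \<rho> * (\<alpha> x + real (\<eta> x)) * (s0 ^ size (add_particle x \<eta>) - s0 ^ size \<eta>)) = \<omega> x * \<alpha> x * s0 ^ size \<eta>" for x
  proof -
    have "real (\<eta> x) * (1 + \<rho>) * (s0 ^ size (remove_particle x \<eta>) - s0 ^ size \<eta>) = - real (\<eta> x) * s0 ^ size \<eta>"
    proof (cases "\<eta> x = 0")
      case False
      then have "s0 ^ size \<eta> = s0 * s0 ^ size (remove_particle x \<eta>)"
        using size_remove_particle[of \<eta> x] by (metis neq0_conv power_Suc)
      then have e: "s0 ^ size (remove_particle x \<eta>) = s0 ^ size \<eta> / s0" using s0 by simp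
      have "real (\<eta> x) * (1 + \<rho>) * (s0 ^ size (remove_particle x \<eta>) - s0 ^ size \<eta>) =
         - real (\<eta> x) * ((1 + \<rho>) * (1 - 1 / s0)) * s0 ^ size \<eta>"
        unfolding e by (simp add: divide_inverse algebra_simps)
      then show ?thesis unfolding s0(4) by simp
    qed simp
    moreover have "\<rho> * (\<alpha> x + real (\<eta> x)) * (s0 ^ size (add_particle x \<eta>) - s0 ^ size \<eta>) =
       (\<rho> * (s0 - 1)) * (\<alpha> x + real (\<eta> x)) * s0 ^ size \<eta>"
      unfolding size_add_particle by (simp add: algebra_simps)
    ultimately show ?thesis unfolding s0(3) by (simp add: algebra_simps)
  qed
  show ?thesis
    unfolding sip_generator_def 1 2 by (simp add: sum_distrib_right)
qed

lemma move_rate_nonneg: "0 \<le> \<rho>' \<Longrightarrow> 0 \<le> move_rate c \<alpha> \<omega> \<rho>' i \<eta>"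
  using c_nonneg \<omega>_nonneg \<alpha>_pos
  by (induction c \<alpha> \<omega> \<rho>' i \<eta> rule: move_rate.induct) (auto intro!: mult_nonneg_nonneg add_nonneg_nonneg simp: less_imp_le)

sublocale chain: reversible_chain "rate_matrix L" "\<lambda>\<eta>. s0 ^ size \<eta>" "\<Sum>x\<in>UNIV. \<omega> x * \<alpha> x" w
proof unfold_locales
  show "0 \<le> rate_matrix L x y" if "x \<noteq> y" for x y
    unfolding sip_generator_eq_jump_op using that \<rho>_pos
    by (intro rate_matrix_jump_op_nonneg move_rate_nonneg) auto
  show "finite {y. rate_matrix L x y \<noteq> 0}" for x
    unfolding sip_generator_eq_jump_op by (rule finite_row_jump_op)
  show "(\<Sum>y | rate_matrix L x y \<noteq> 0. rate_matrix L x y) = 0" for x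
    using rate_apply_jump_op[of "move_rate c \<alpha> \<omega> \<rho>" move "\<lambda>_. 1" x]
    by (simp add: rate_apply_def jump_op_def sip_generator_eq_jump_op)
  show "0 < s0 ^ size \<eta>" for \<eta> using s0 by simp
  show "finite {\<eta> :: 'v \<Rightarrow> nat. s0 ^ size \<eta> \<le> a}" for a
  proof -
    obtain n where n: "a < s0 ^ n" using real_arch_pow[OF s0(1)] by blast
    have "{\<eta> :: 'v \<Rightarrow> nat. s0 ^ size \<eta> \<le> a} \<subseteq> {\<eta>. size \<eta> \<le> n}"
    proof (safe, rule ccontr)
      fix \<eta> :: "'v \<Rightarrow> nat" assume *: "s0 ^ size \<eta> \<le> a" "\<not> size \<eta> \<le> n"
      have "s0 ^ n \<le> s0 ^ size \<eta>" using * s0 by (intro power_increasing) auto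
      then show False using * n by linarith
    qed
    then show ?thesis using finite_size_le finite_subset by blast
  qed
  show "0 \<le> (\<Sum>x\<in>UNIV. \<omega> x * \<alpha> x)"
    using \<omega>_nonneg \<alpha>_pos by (intro sum_nonneg mult_nonneg_nonneg) (auto simp: less_imp_le)
  show "rate_apply (rate_matrix L) (\<lambda>\<eta>. s0 ^ size \<eta>) \<eta> \<le> (\<Sum>x\<in>UNIV. \<omega> x * \<alpha> x) * s0 ^ size \<eta>" for \<eta>
    using L_exp[of \<eta>] unfolding sip_generator_eq_jump_op rate_apply_jump_op by simp
  show "0 < w \<eta>" for \<eta> by (rule w_pos)
  show "w \<eta> * rate_matrix L \<eta> \<zeta> = w \<zeta> * rate_matrix L \<zeta> \<eta>" for \<eta> \<zeta> by (rule sip_detailed_balance)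
  show "integrable (count_space UNIV) w" using w_exp_integrable[of 1] r by simp
qed

end

section \<open>Duality with the inclusion process with killing\<close>

text \<open>The falling factorial of \<open>n\<close> of length \<open>j\<close>; it vanishes for \<open>j > n\<close>.\<close>

definition falling :: "nat \<Rightarrow> nat \<Rightarrow> real" where
  "falling j n = (\<Prod>i<j. real n - real i)"

lemma falling_0 [simp]: "falling 0 n = 1"
  by (simp add: falling_def)

lemma falling_Suc: "falling (Suc j) n = (real n - real j) * falling j n"
  by (simp add: falling_def mult.commute)

lemma falling_Suc_shift: "falling (Suc j) (Suc n) = (real n + 1) * falling j n"
  unfolding falling_def prod.lessThan_Suc_shift by simp

lemma falling_remove: "real n * falling j (n - 1) = falling (Suc j) n"
  by (cases n) (auto simp: falling_Suc_shift falling_def[of "Suc j" 0] prod.lessThan_Suc_shift)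

lemma falling_add: "falling j (Suc n) = falling j n + real j * falling (j - 1) n"
proof (cases j)
  case (Suc i)
  have 1: "falling (Suc i) (Suc n) = (real n + 1) * falling i n" by (rule falling_Suc_shift)
  have 2: "falling (Suc i) n = (real n - real i) * falling i n" by (rule falling_Suc)
  show ?thesis unfolding Suc 1 2 by (simp add: algebra_simps)
qed simp

lemma falling_eq: "falling j n = fact j * real (n choose j)"
proof -
  have "real (n choose j) = real n gchoose j" by (rule binomial_gbinomial)
  then show ?thesis by (simp add: gbinomial_prod_rev falling_def atLeast0LessThan)
qed

lemma falling_nonneg: "0 \<le> falling j n"
  by (simp add: falling_eq)

text \<open>One term of the binomial expansion of \<open>((s - 1) + 1) ^ n\<close>.\<close>

lemma falling_le_power:
  assumes s: "1 < s"
  shows "falling j n \<le> fact j / (s - 1) ^ j * s ^ n"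
proof (cases "j \<le> n")
  case True
  have "real (n choose j) * (s - 1) ^ j \<le> (\<Sum>k\<le>n. real (n choose k) * (s - 1) ^ k)"
    by (rule member_le_sum) (use True s in auto)
  also have "\<dots> = s ^ n"
    using binomial_ring[of "s - 1" 1 n] by simp
  finally show ?thesis using s by (simp add: falling_eq field_simps)
next
  case False
  then show ?thesis using s by (simp add: falling_eq binomial_eq_0)
qed

context open_sip
begin

text \<open>Normalised so that \<open>site_dual x j\<close> has mean one under the stationary measure.\<close>

definition site_dual :: "'v \<Rightarrow> nat \<Rightarrow> nat \<Rightarrow> real" where
  "site_dual x j n = falling j n / (pochhammer (\<alpha> x) j * \<rho> ^ j)"

lemma poch_pos: "0 < pochhammer (\<alpha> x) j"
  by (rule pochhammer_pos[OF \<alpha>_pos])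

lemma site_dual_scale: "falling (Suc j) n / (pochhammer (\<alpha> x) j * \<rho> ^ j) = (\<alpha> x + real j) * \<rho> * site_dual x (Suc j) n"
proof -
  have nz: "\<alpha> x + real j \<noteq> 0" using \<alpha>_pos[of x] by linarith
  have gen: "X / (P * R) = A * t * (X / (P * A * (t * R)))" if "A \<noteq> 0" "t \<noteq> 0" for X P R A t :: real
    using that by simp
  show ?thesis
    unfolding site_dual_def pochhammer_Suc power_Suc by (rule gen[OF nz]) (use \<rho>_pos in simp)
qed

lemma site_dual_remove: "real n * site_dual x j (n - 1) = (\<alpha> x + real j) * \<rho> * site_dual x (Suc j) n"
  unfolding site_dual_scale[symmetric] falling_remove[symmetric] by (simp add: site_dual_def)

lemma site_dual_mult: "real n * site_dual x j n = (\<alpha> x + real j) * \<rho> * site_dual x (Suc j) n + real j * site_dual x j n"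
  unfolding site_dual_scale[symmetric] falling_Suc by (simp add: site_dual_def diff_divide_distrib left_diff_distrib)

lemma site_dual_lower: "real j * falling (j - 1) n / (pochhammer (\<alpha> x) j * \<rho> ^ j) * (\<alpha> x + real j - 1) = real j / \<rho> * site_dual x (j - 1) n"
proof (cases j)
  case (Suc i)
  have nz: "\<alpha> x + real i \<noteq> 0" using \<alpha>_pos[of x] by linarith
  have gen: "J * X / (P * A * (t * R)) * A = J / t * (X / (P * R))" if "A \<noteq> 0" for J X P R A t :: real
    using that by simp
  have i1: "\<alpha> x + real (Suc i) - 1 = \<alpha> x + real i" by simp
  show ?thesis
    unfolding site_dual_def Suc pochhammer_Suc power_Suc diff_Suc_1 i1 by (rule gen[OF nz])
qed simp

text \<open>Together with \<open>site_dual_remove\<close> and \<open>site_dual_mult\<close> this expresses removal of a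
  particle, multiplication by the occupation number, and addition of a particle through the index
  \<open>j\<close>. In \<open>j - 1\<close> the truncation at \<open>j = 0\<close> is harmless, as the
  coefficient vanishes.\<close>

lemma site_dual_add: "(\<alpha> x + real n) * site_dual x j (Suc n) =
    (\<alpha> x + real j) * \<rho> * site_dual x (Suc j) n + (\<alpha> x + 2 * real j) * site_dual x j n + real j / \<rho> * site_dual x (j - 1) n"
proof -
  have nf: "real n * falling (j - 1) n * real j = real j * (falling j n + (real j - 1) * falling (j - 1) n)"
    by (cases j) (simp_all add: falling_Suc algebra_simps)
  have "(\<alpha> x + real n) * falling j (Suc n) = falling (Suc j) n + (\<alpha> x + 2 * real j) * falling j n
      + real j * falling (j - 1) n * (\<alpha> x + real j - 1)"
    unfolding falling_add falling_Suc[of j] using nf by (simp add: algebra_simps)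
  then have "(\<alpha> x + real n) * site_dual x j (Suc n) = falling (Suc j) n / (pochhammer (\<alpha> x) j * \<rho> ^ j)
      + (\<alpha> x + 2 * real j) * site_dual x j n
      + real j * falling (j - 1) n / (pochhammer (\<alpha> x) j * \<rho> ^ j) * (\<alpha> x + real j - 1)"
    unfolding site_dual_def by (simp add: add_divide_distrib)
  then show ?thesis unfolding site_dual_scale site_dual_lower .
qed

lemma site_dual_nonneg: "0 \<le> site_dual x j n"
  unfolding site_dual_def using falling_nonneg poch_pos \<rho>_pos by (simp add: less_imp_le)

definition dual :: "('v \<Rightarrow> nat) \<Rightarrow> ('v \<Rightarrow> nat) \<Rightarrow> real" where
  "dual \<xi> \<eta> = (\<Prod>x\<in>UNIV. site_dual x (\<xi> x) (\<eta> x))"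

lemma dual_nonneg: "0 \<le> dual \<xi> \<eta>"
  unfolding dual_def by (intro prod_nonneg site_dual_nonneg)

lemma dual_split1: "dual \<xi> \<eta> = site_dual x (\<xi> x) (\<eta> x) * (\<Prod>z\<in>UNIV - {x}. site_dual z (\<xi> z) (\<eta> z))"
  unfolding dual_def by (subst prod.remove[of _ x]) auto

lemma dual_split2:
  assumes "x \<noteq> y"
  shows "dual \<xi> \<eta> = site_dual x (\<xi> x) (\<eta> x) * (site_dual y (\<xi> y) (\<eta> y) * (\<Prod>z\<in>UNIV - {x} - {y}. site_dual z (\<xi> z) (\<eta> z)))"
  unfolding dual_split1[of \<xi> \<eta> x] using assms by (subst prod.remove[of _ y]) auto

abbreviation transfer :: "'v \<Rightarrow> 'v \<Rightarrow> ('v \<Rightarrow> nat) \<Rightarrow> 'v \<Rightarrow> nat" where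
  "transfer x y \<eta> \<equiv> add_particle y (remove_particle x \<eta>)"

lemma transfer_values:
  assumes "x \<noteq> y"
  shows "transfer x y \<eta> x = \<eta> x - 1" "transfer x y \<eta> y = Suc (\<eta> y)"
    "z \<noteq> x \<Longrightarrow> z \<noteq> y \<Longrightarrow> transfer x y \<eta> z = \<eta> z"
  using assms by (auto simp: add_particle_def remove_particle_def)

text \<open>Only after adding both directions of an edge do the terms that raise the degree cancel.\<close>

lemma dual_edge:
  assumes "x \<noteq> y"
  shows "real (\<eta> x) * (\<alpha> y + real (\<eta> y)) * (dual \<xi> (transfer x y \<eta>) - dual \<xi> \<eta>)
       + real (\<eta> y) * (\<alpha> x + real (\<eta> x)) * (dual \<xi> (transfer y x \<eta>) - dual \<xi> \<eta>)
     = real (\<xi> x) * (\<alpha> y + real (\<xi> y)) * (dual (transfer x y \<xi>) \<eta> - dual \<xi> \<eta>)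
       + real (\<xi> y) * (\<alpha> x + real (\<xi> x)) * (dual (transfer y x \<xi>) \<eta> - dual \<xi> \<eta>)"
proof -
  let ?R = "\<Prod>z\<in>UNIV - {x} - {y}. site_dual z (\<xi> z) (\<eta> z)"
  have yx: "y \<noteq> x" using assms by simp
  have R: "(\<Prod>z\<in>UNIV - {x} - {y}. site_dual z (\<xi>' z) (\<eta>' z)) = ?R"
    if "\<And>z. z \<noteq> x \<Longrightarrow> z \<noteq> y \<Longrightarrow> \<xi>' z = \<xi> z \<and> \<eta>' z = \<eta> z" for \<xi>' \<eta>'
    by (rule prod.cong) (use that in auto)
  have d: "dual \<xi>' \<eta>' = site_dual x (\<xi>' x) (\<eta>' x) * (site_dual y (\<xi>' y) (\<eta>' y) * ?R)"
    if "\<And>z. z \<noteq> x \<Longrightarrow> z \<noteq> y \<Longrightarrow> \<xi>' z = \<xi> z \<and> \<eta>' z = \<eta> z" for \<xi>' \<eta>'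
    unfolding dual_split2[OF assms, of \<xi>' \<eta>'] using R[of \<xi>' \<eta>'] that by simp
  define X where "X j n = site_dual x j n" for j n
  define Y where "Y j n = site_dual y j n" for j n
  define i where "i = \<xi> x"
  define j where "j = \<xi> y"
  define m where "m = \<eta> x"
  define n where "n = \<eta> y"
  define RR where "RR = ?R"
  have D: "dual \<xi> \<eta> = X i m * (Y j n * RR)"
    "dual \<xi> (transfer x y \<eta>) = X i (m - 1) * (Y j (Suc n) * RR)"
    "dual \<xi> (transfer y x \<eta>) = X i (Suc m) * (Y j (n - 1) * RR)"
    "dual (transfer x y \<xi>) \<eta> = X (i - 1) m * (Y (Suc j) n * RR)"
    "dual (transfer y x \<xi>) \<eta> = X (Suc i) m * (Y (j - 1) n * RR)"
    by (subst d; simp add: transfer_values[OF assms] transfer_values[OF yx] X_def Y_def i_def j_def m_def n_def RR_def)+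
  define a where "a = \<alpha> x + real i"
  define b where "b = \<alpha> y + real j"
  note rel = site_dual_remove[of m x i] site_dual_mult[of m x i] site_dual_add[of x m i]
    site_dual_remove[of n y j] site_dual_mult[of n y j] site_dual_add[of y n j]
  have X1: "real m * X i (m - 1) = a * \<rho> * X (Suc i) m"
    and X2: "real m * X i m = a * \<rho> * X (Suc i) m + real i * X i m"
    and X3: "(\<alpha> x + real m) * X i (Suc m) = a * \<rho> * X (Suc i) m + (a + real i) * X i m + real i / \<rho> * X (i - 1) m"
    and Y1: "real n * Y j (n - 1) = b * \<rho> * Y (Suc j) n"
    and Y2: "real n * Y j n = b * \<rho> * Y (Suc j) n + real j * Y j n"
    and Y3: "(\<alpha> y + real n) * Y j (Suc n) = b * \<rho> * Y (Suc j) n + (b + real j) * Y j n + real j / \<rho> * Y (j - 1) n"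
    using rel by (simp_all add: X_def Y_def a_def b_def algebra_simps)
  have X4: "(\<alpha> x + real m) * X i m = a * \<rho> * X (Suc i) m + a * X i m"
    and Y4: "(\<alpha> y + real n) * Y j n = b * \<rho> * Y (Suc j) n + b * Y j n"
    using X2 Y2 by (simp_all add: a_def b_def algebra_simps)
  have "real m * (\<alpha> y + real n) * (X i (m - 1) * (Y j (Suc n) * RR) - X i m * (Y j n * RR))
       + real n * (\<alpha> x + real m) * (X i (Suc m) * (Y j (n - 1) * RR) - X i m * (Y j n * RR))
     = ((real m * X i (m - 1)) * ((\<alpha> y + real n) * Y j (Suc n)) - (real m * X i m) * ((\<alpha> y + real n) * Y j n)
       + ((\<alpha> x + real m) * X i (Suc m)) * (real n * Y j (n - 1)) - ((\<alpha> x + real m) * X i m) * (real n * Y j n)) * RR"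
    by (simp add: algebra_simps)
  also have "\<dots> = (a * X (Suc i) m * (real j * Y (j - 1) n) - real i * X i m * b * Y j n
      + real i * X (i - 1) m * b * Y (Suc j) n - a * X i m * real j * Y j n) * RR"
    unfolding X1 X2 X3 X4 Y1 Y2 Y3 Y4 using \<rho>_pos by (simp add: field_simps)
  also have "\<dots> = real i * b * (X (i - 1) m * (Y (Suc j) n * RR) - X i m * (Y j n * RR))
       + real j * a * (X (Suc i) m * (Y (j - 1) n * RR) - X i m * (Y j n * RR))"
    by (simp add: algebra_simps)
  finally show ?thesis
    unfolding D by (simp only: i_def[symmetric] j_def[symmetric] m_def[symmetric] n_def[symmetric] a_def[symmetric] b_def[symmetric])
qed

text \<open>The reservoir acts on the dual variable as pure absorption at rate one per particle.\<close>

lemma dual_site: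
  "real (\<eta> x) * (1 + \<rho>) * (dual \<xi> (remove_particle x \<eta>) - dual \<xi> \<eta>)
     + \<rho> * (\<alpha> x + real (\<eta> x)) * (dual \<xi> (add_particle x \<eta>) - dual \<xi> \<eta>)
   = real (\<xi> x) * (dual (remove_particle x \<xi>) \<eta> - dual \<xi> \<eta>)"
proof -
  let ?R = "\<Prod>z\<in>UNIV - {x}. site_dual z (\<xi> z) (\<eta> z)"
  have d: "dual \<xi>' \<eta>' = site_dual x (\<xi>' x) (\<eta>' x) * ?R"
    if "\<And>z. z \<noteq> x \<Longrightarrow> \<xi>' z = \<xi> z \<and> \<eta>' z = \<eta> z" for \<xi>' \<eta>'
  proof -
    have "(\<Prod>z\<in>UNIV - {x}. site_dual z (\<xi>' z) (\<eta>' z)) = ?R"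
      by (rule prod.cong) (use that in auto)
    then show ?thesis unfolding dual_split1[of \<xi>' \<eta>' x] by simp
  qed
  define i where "i = \<xi> x"
  define m where "m = \<eta> x"
  define RR where "RR = ?R"
  define X where "X j n = site_dual x j n" for j n
  define a where "a = \<alpha> x + real i"
  have D: "dual \<xi> \<eta> = X i m * RR" "dual \<xi> (remove_particle x \<eta>) = X i (m - 1) * RR"
    "dual \<xi> (add_particle x \<eta>) = X i (Suc m) * RR" "dual (remove_particle x \<xi>) \<eta> = X (i - 1) m * RR"
    by (subst d; simp add: add_particle_def remove_particle_def X_def i_def m_def RR_def)+
  have X1: "real m * X i (m - 1) = a * \<rho> * X (Suc i) m"
    and X2: "real m * X i m = a * \<rho> * X (Suc i) m + real i * X i m"
    and X3: "(\<alpha> x + real m) * X i (Suc m) = a * \<rho> * X (Suc i) m + (a + real i) * X i m + real i / \<rho> * X (i - 1) m"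
    using site_dual_remove[of m x i] site_dual_mult[of m x i] site_dual_add[of x m i] by (simp_all add: X_def a_def algebra_simps)
  have X4: "(\<alpha> x + real m) * X i m = a * \<rho> * X (Suc i) m + a * X i m"
    using X2 by (simp add: a_def algebra_simps)
  have "real m * (1 + \<rho>) * (X i (m - 1) * RR - X i m * RR) + \<rho> * (\<alpha> x + real m) * (X i (Suc m) * RR - X i m * RR)
     = ((1 + \<rho>) * (real m * X i (m - 1) - real m * X i m) + \<rho> * ((\<alpha> x + real m) * X i (Suc m) - (\<alpha> x + real m) * X i m)) * RR"
    by (simp add: algebra_simps)
  also have "\<dots> = real i * (X (i - 1) m * RR - X i m * RR)"
    unfolding X1 X2 X3 X4 using \<rho>_pos by (simp add: field_simps)
  finally show ?thesis unfolding D by (simp only: i_def[symmetric] m_def[symmetric])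
qed

lemma symmetrised_edge_sum:
  "2 * (\<Sum>x\<in>UNIV. \<Sum>y\<in>UNIV. c x y * T x y) = (\<Sum>x\<in>UNIV. \<Sum>y\<in>UNIV. c x y * (T x y + T y x))"
proof -
  have "(\<Sum>x\<in>UNIV. \<Sum>y\<in>UNIV. c x y * T x y) = (\<Sum>x\<in>UNIV. \<Sum>y\<in>UNIV. c x y * T y x)"
    by (subst sum.swap) (simp add: c_sym)
  then show ?thesis by (simp add: sum.distrib distrib_left)
qed

abbreviation dual_L :: "(('v \<Rightarrow> nat) \<Rightarrow> real) \<Rightarrow> ('v \<Rightarrow> nat) \<Rightarrow> real" where
  "dual_L \<equiv> sip_generator c \<alpha> \<omega> 0"

lemma duality: "L (dual \<xi>) \<eta> = dual_L (\<lambda>\<xi>. dual \<xi> \<eta>) \<xi>"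
proof -
  let ?T = "\<lambda>x y. real (\<eta> x) * (\<alpha> y + real (\<eta> y)) * (dual \<xi> (transfer x y \<eta>) - dual \<xi> \<eta>)"
  let ?S = "\<lambda>x y. real (\<xi> x) * (\<alpha> y + real (\<xi> y)) * (dual (transfer x y \<xi>) \<eta> - dual \<xi> \<eta>)"
  have "c x y * (?T x y + ?T y x) = c x y * (?S x y + ?S y x)" for x y
    using dual_edge[of x y \<eta> \<xi>] c_diag[of x] by (cases "x = y") auto
  then have "2 * (\<Sum>x\<in>UNIV. \<Sum>y\<in>UNIV. c x y * ?T x y) = 2 * (\<Sum>x\<in>UNIV. \<Sum>y\<in>UNIV. c x y * ?S x y)"
    unfolding symmetrised_edge_sum by (intro sum.cong refl)
  then have "(\<Sum>x\<in>UNIV. \<Sum>y\<in>UNIV. c x y * ?T x y) = (\<Sum>x\<in>UNIV. \<Sum>y\<in>UNIV. c x y * ?S x y)" by simp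
  then show ?thesis
    unfolding sip_generator_def using dual_site[of \<eta> _ \<xi>] by (simp add: mult.assoc[symmetric])
qed

text \<open>The interaction contributes terms that are antisymmetric in the two sites, so a linear function sees
  independent walkers with killing and a constant influx from the reservoirs.\<close>

lemma sip_generator_linear_fun:
  "sip_generator c \<alpha> \<omega> \<rho>' (\<lambda>\<eta>. \<Sum>x\<in>UNIV. real (\<eta> x) * \<psi> x) \<eta> =
     - (\<Sum>x\<in>UNIV. real (\<eta> x) * rw_neg_generator c \<alpha> \<omega> \<psi> x) + \<rho>' * (\<Sum>x\<in>UNIV. \<omega> x * \<alpha> x * \<psi> x)"
proof -
  let ?F = "\<lambda>\<eta>. \<Sum>x\<in>UNIV. real (\<eta> x) * \<psi> x"
  have add: "?F (add_particle x \<zeta>) = ?F \<zeta> + \<psi> x" for x \<zeta>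
    by (subst (1 2) sum.remove[of _ x]) (auto simp: add_particle_def algebra_simps)
  have rem: "real (\<zeta> x) * (?F (remove_particle x \<zeta>) - ?F \<zeta>) = - real (\<zeta> x) * \<psi> x" for x and \<zeta> :: "'v \<Rightarrow> nat"
  proof (cases "\<zeta> x = 0")
    case False
    then have "add_particle x (remove_particle x \<zeta>) = \<zeta>" by (auto simp: add_particle_def remove_particle_def)
    then show ?thesis using add[of x "remove_particle x \<zeta>"] by simp
  qed simp
  have tr: "real (\<eta> x) * (?F (transfer x y \<eta>) - ?F \<eta>) = real (\<eta> x) * (\<psi> y - \<psi> x)" for x y
  proof -
    have "?F (transfer x y \<eta>) = ?F (remove_particle x \<eta>) + \<psi> y" by (rule add)
    then show ?thesis using rem[of \<eta> x] by (simp only: right_diff_distrib distrib_left)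
  qed
  have e: "(\<Sum>x\<in>UNIV. \<Sum>y\<in>UNIV. c x y * real (\<eta> x) * (\<alpha> y + real (\<eta> y)) * (?F (transfer x y \<eta>) - ?F \<eta>)) =
     (\<Sum>x\<in>UNIV. real (\<eta> x) * (\<Sum>y\<in>UNIV. c x y * \<alpha> y * (\<psi> y - \<psi> x)))"
  proof -
    have "c x y * real (\<eta> x) * (\<alpha> y + real (\<eta> y)) * (?F (transfer x y \<eta>) - ?F \<eta>)
        = c x y * (real (\<eta> x) * \<alpha> y * (\<psi> y - \<psi> x)) + c x y * (real (\<eta> x) * real (\<eta> y) * (\<psi> y - \<psi> x))" for x y
    proof -
      have "c x y * real (\<eta> x) * (\<alpha> y + real (\<eta> y)) * (?F (transfer x y \<eta>) - ?F \<eta>)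
        = c x y * (\<alpha> y + real (\<eta> y)) * (real (\<eta> x) * (?F (transfer x y \<eta>) - ?F \<eta>))" by simp
      then show ?thesis unfolding tr by (simp add: algebra_simps)
    qed
    moreover have "(\<Sum>x\<in>UNIV. \<Sum>y\<in>UNIV. c x y * (real (\<eta> x) * real (\<eta> y) * (\<psi> y - \<psi> x))) = 0"
      using symmetrised_edge_sum[of "\<lambda>x y. real (\<eta> x) * real (\<eta> y) * (\<psi> y - \<psi> x)"] by (simp add: algebra_simps)
    ultimately show ?thesis
      by (simp add: sum.distrib) (simp add: sum_distrib_left mult_ac)
  qed
  have s: "\<omega> x * (real (\<eta> x) * (1 + \<rho>') * (?F (remove_particle x \<eta>) - ?F \<eta>) +
       \<rho>' * (\<alpha> x + real (\<eta> x)) * (?F (add_particle x \<eta>) - ?F \<eta>)) = - real (\<eta> x) * (\<omega> x * \<psi> x) + \<rho>' * (\<omega> x * \<alpha> x * \<psi> x)" for x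
  proof -
    have "real (\<eta> x) * (1 + \<rho>') * (?F (remove_particle x \<eta>) - ?F \<eta>) = (1 + \<rho>') * (real (\<eta> x) * (?F (remove_particle x \<eta>) - ?F \<eta>))"
      by simp
    then have A: "real (\<eta> x) * (1 + \<rho>') * (?F (remove_particle x \<eta>) - ?F \<eta>) = (1 + \<rho>') * (- real (\<eta> x) * \<psi> x)"
      unfolding rem .
    have B: "?F (add_particle x \<eta>) - ?F \<eta> = \<psi> x" unfolding add by simp
    show ?thesis unfolding A B by (simp add: algebra_simps)
  qed
  have "sip_generator c \<alpha> \<omega> \<rho>' ?F \<eta> = (\<Sum>x\<in>UNIV. real (\<eta> x) * (\<Sum>y\<in>UNIV. c x y * \<alpha> y * (\<psi> y - \<psi> x)))
      + (\<Sum>x\<in>UNIV. - real (\<eta> x) * (\<omega> x * \<psi> x) + \<rho>' * (\<omega> x * \<alpha> x * \<psi> x))"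
    unfolding sip_generator_def e s ..
  also have "\<dots> = - (\<Sum>x\<in>UNIV. real (\<eta> x) * rw_neg_generator c \<alpha> \<omega> \<psi> x) + \<rho>' * (\<Sum>x\<in>UNIV. \<omega> x * \<alpha> x * \<psi> x)"
    unfolding rw_neg_generator_def
    by (simp add: sum.distrib sum_distrib_left sum_negf sum_subtractf algebra_simps)
  finally show ?thesis .
qed

end

section \<open>Solutions of the backward equation as exponential series\<close>

lemma exp_series_bound:
  fixes d :: "nat \<Rightarrow> real"
  assumes d: "\<And>n. \<bar>d n\<bar> \<le> D * \<kappa> ^ n" and \<kappa>: "0 \<le> \<kappa>"
  shows "summable (\<lambda>n. d n / fact n * t ^ n)"
    and "0 \<le> t \<Longrightarrow> \<bar>\<Sum>n. d n / fact n * t ^ n\<bar> \<le> D * exp (\<kappa> * t)"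
proof -
  have bound: "norm (d n / fact n * t ^ n) \<le> D * ((\<kappa> * \<bar>t\<bar>) ^ n /\<^sub>R fact n)" for n
  proof -
    have "norm (d n / fact n * t ^ n) = \<bar>d n\<bar> * (\<bar>t\<bar> ^ n / fact n)" by (simp add: abs_mult power_abs)
    also have "\<dots> \<le> (D * \<kappa> ^ n) * (\<bar>t\<bar> ^ n / fact n)" by (intro mult_right_mono d) auto
    finally show ?thesis by (simp add: power_mult_distrib divide_inverse mult_ac)
  qed
  have sums: "(\<lambda>n. D * ((\<kappa> * \<bar>t\<bar>) ^ n /\<^sub>R fact n)) sums (D * exp (\<kappa> * \<bar>t\<bar>))"
    by (intro sums_mult exp_converges)
  show "summable (\<lambda>n. d n / fact n * t ^ n)"
    by (rule summable_comparison_test'[OF sums_summable[OF sums] bound])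
  have sn: "summable (\<lambda>n. norm (d n / fact n * t ^ n))"
    by (rule summable_comparison_test'[OF sums_summable[OF sums]]) (use bound in simp)
  assume t: "0 \<le> t"
  have "\<bar>\<Sum>n. d n / fact n * t ^ n\<bar> \<le> (\<Sum>n. norm (d n / fact n * t ^ n))"
    using summable_norm[OF sn] by simp
  also have "\<dots> \<le> (\<Sum>n. D * ((\<kappa> * \<bar>t\<bar>) ^ n /\<^sub>R fact n))"
    by (intro suminf_le bound sn sums_summable[OF sums])
  finally show "\<bar>\<Sum>n. d n / fact n * t ^ n\<bar> \<le> D * exp (\<kappa> * t)"
    using sums_unique[OF sums] t by simp
qed

lemma jump_op_linear: "jump_op a T (\<lambda>x. f x + k * g x) x = jump_op a T f x + k * jump_op a T g x"
  unfolding jump_op_def sum_distrib_left sum.distrib[symmetric]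
  by (intro sum.cong refl) (simp add: algebra_simps)

lemma jump_op_sums:
  assumes "\<And>x. (\<lambda>n. b n x) sums S x"
  shows "(\<lambda>n. jump_op a T (b n) x) sums jump_op a T S x"
  unfolding jump_op_def by (intro sums_sum sums_mult sums_diff assms)

text \<open>The factor \<open>exp (- k * t)\<close> undoes the shift of the generator by \<open>k\<close>. For
  \<open>k\<close> above the exit rates of the dual chain the coefficients \<open>b\<close> will be
  non-negative.\<close>

lemma series_solves_backward_equation:
  fixes b :: "nat \<Rightarrow> 's \<Rightarrow> real"
  assumes step: "\<And>n x. b (Suc n) x = jump_op a T (b n) x + k * b n x"
    and bound: "\<And>n x. \<bar>b n x\<bar> \<le> B x * \<kappa> ^ n" and \<kappa>: "0 \<le> \<kappa>"
  shows "((\<lambda>t. exp (- k * t) * (\<Sum>n. b n x / fact n * t ^ n)) has_real_derivative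
    jump_op a T (\<lambda>x. exp (- k * t) * (\<Sum>n. b n x / fact n * t ^ n)) x) (at t)"
proof -
  let ?S = "\<lambda>t x. \<Sum>n. b n x / fact n * t ^ n"
  have sm: "summable (\<lambda>n. b n x / fact n * t ^ n)" for x t
    by (rule exp_series_bound(1)[OF bound \<kappa>])
  have diffs: "diffs (\<lambda>n. b n x / fact n) n * t ^ n = b (Suc n) x / fact n * t ^ n" for n t x
    by (simp add: diffs_def)
  have d: "((\<lambda>t. ?S t x) has_real_derivative (\<Sum>n. b (Suc n) x / fact n * t ^ n)) (at t)"
    using termdiffs_strong_converges_everywhere[of "\<lambda>n. b n x / fact n" t] sm by (simp add: diffs)
  have j: "(\<lambda>n. jump_op a T (\<lambda>x. b n x / fact n * t ^ n) x) sums jump_op a T (?S t) x"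
    by (rule jump_op_sums) (rule summable_sums[OF sm])
  have "jump_op a T (\<lambda>x. b n x / fact n * t ^ n) x = b (Suc n) x / fact n * t ^ n - k * (b n x / fact n * t ^ n)" for n
  proof -
    have "jump_op a T (\<lambda>x. b n x / fact n * t ^ n) x = jump_op a T (b n) x / fact n * t ^ n"
      unfolding jump_op_def by (simp add: sum_distrib_left sum_distrib_right sum_divide_distrib algebra_simps diff_divide_distrib)
    then show ?thesis using step[of n x] by (simp add: algebra_simps diff_divide_distrib add_divide_distrib)
  qed
  then have "(\<lambda>n. b (Suc n) x / fact n * t ^ n - k * (b n x / fact n * t ^ n)) sums jump_op a T (?S t) x"
    using j by simp
  from sums_add[OF this sums_mult[OF summable_sums[OF sm[of x t]], of k]]
  have eq: "(\<Sum>n. b (Suc n) x / fact n * t ^ n) = jump_op a T (?S t) x + k * ?S t x"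
    by (simp add: sums_iff)
  have "((\<lambda>t. exp (- k * t)) has_real_derivative exp (- k * t) * (- k)) (at t)"
    by (auto intro!: derivative_eq_intros)
  from DERIV_mult[OF this d[unfolded eq]]
  have "((\<lambda>t. exp (- k * t) * ?S t x) has_real_derivative (exp (- k * t) * (- k)) * ?S t x + (jump_op a T (?S t) x + k * ?S t x) * exp (- k * t)) (at t)" .
  moreover have "jump_op a T (\<lambda>x. exp (- k * t) * ?S t x) x = exp (- k * t) * jump_op a T (?S t) x"
    using jump_op_linear[of a T "\<lambda>_. 0" "exp (- k * t)" "?S t" x] by (simp add: jump_op_def)
  ultimately show ?thesis by (simp add: algebra_simps)
qed

context reversible_chain
begin

text \<open>This identifies the semigroup, which is defined through the minimal transition function, on concrete initial
  values.\<close>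

lemma P_of_solution:
  fixes u :: "real \<Rightarrow> 's \<Rightarrow> real"
  assumes nonneg: "\<And>t x. 0 \<le> t \<Longrightarrow> 0 \<le> u t x"
    and deriv: "\<And>t x. ((\<lambda>t. u t x) has_real_derivative rate_apply q (u t) x) (at t)"
    and bound: "\<And>t x. 0 \<le> t \<Longrightarrow> u t x \<le> U x"
    and small: "\<And>\<epsilon>. 0 < \<epsilon> \<Longrightarrow> finite {x. \<epsilon> * V x < U x}"
    and t: "0 \<le> t"
  shows "P t (\<lambda>x. complex_of_real (u 0 x)) x = complex_of_real (u t x)"
proof -
  have "feller_apply q (\<lambda>x. ennreal (u 0 x)) t x = ennreal (u t x)"
  proof (rule backward_equation_unique[OF _ _ small t])
    show "ennreal (u t x) = ennreal (exp (q x x * t)) * ennreal (u 0 x) + first_jump q (\<lambda>t x. ennreal (u t x)) t x"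
      if "0 \<le> t" for t x by (rule first_jump_of_solution[OF nonneg deriv that])
    show "ennreal (u t x) \<le> ennreal (U x)" if "0 \<le> t" for t x
      by (intro ennreal_leI bound that)
  qed
  then have nn: "(\<integral>\<^sup>+y. ennreal (p t x y * u 0 y) \<partial>count_space UNIV) = ennreal (u t x)"
    using nonneg[of 0] by (simp add: feller_apply_def ennreal_p[OF t, symmetric] ennreal_mult)
  have "(\<integral>y. p t x y * u 0 y \<partial>count_space UNIV) = u t x"
    using nonneg t by (subst integral_eq_nn_integral) (auto simp: nn)
  moreover have "P t (\<lambda>x. complex_of_real (u 0 x)) x = complex_of_real (\<integral>y. p t x y * u 0 y \<partial>count_space UNIV)"
    unfolding markov_semigroup_def by (simp flip: of_real_mult)
  ultimately show ?thesis by simp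
qed

end

context open_sip
begin

text \<open>Any base \<open>s > 1\<close> with \<open>s ^ 4 < s0\<close> would serve: duality functions are bounded by
  multiples of \<open>s ^ size \<eta>\<close>, limits are dominated by the square of this bound, and the square
  has to be square integrable.\<close>

definition s1 :: real where "s1 = s0 powr (1 / 8)"

lemma s1: "1 < s1" "s1 ^ 4 * s1 ^ 4 = s0"
proof -
  show "1 < s1" unfolding s1_def using s0(1) by simp
  have "s1 ^ 8 = s0" unfolding s1_def using s0(1) by (simp add: powr_realpow[symmetric] powr_powr)
  then show "s1 ^ 4 * s1 ^ 4 = s0" by (simp flip: power_add)
qed

lemma s1_lt: "s1 ^ 4 < s0" "s1\<^sup>2 < s0" "s1 < s0"
proof -
  have 1: "1 < s1 ^ 4" using s1(1) by (rule one_less_power) simp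
  have "1 * s1 ^ 4 < s1 ^ 4 * s1 ^ 4" using 1 by (intro mult_strict_right_mono) auto
  then show 4: "s1 ^ 4 < s0" using s1(2) by simp
  have "s1\<^sup>2 \<le> s1 ^ 4" "s1 ^ 1 \<le> s1 ^ 4" using s1(1) by (intro power_increasing; simp)+
  then show "s1\<^sup>2 < s0" "s1 < s0" using 4 by auto
qed

lemma exp_size_L2:
  assumes s: "1 \<le> s" "s\<^sup>2 < s0"
  shows "(\<lambda>\<eta>. complex_of_real (C * s ^ size \<eta>)) \<in> L2 chain.M"
proof -
  have "s\<^sup>2 * r < s0 * r" using s r(1) by (intro mult_strict_right_mono) auto
  then have "integrable (count_space UNIV) (\<lambda>\<eta>. w \<eta> * (s\<^sup>2) ^ size \<eta>)"
    using s0(2) by (intro w_exp_integrable) auto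
  then have "(\<integral>\<^sup>+\<eta>. ennreal (norm (w \<eta> * (s\<^sup>2) ^ size \<eta>)) \<partial>count_space UNIV) < \<infinity>"
    by (simp only: integrable_iff_bounded)
  moreover have "ennreal (norm (w \<eta> * (s\<^sup>2) ^ size \<eta>)) = ennreal (w \<eta>) * ennreal ((cmod (complex_of_real (s ^ size \<eta>)))\<^sup>2)" for \<eta>
    using w_pos[of \<eta>] s by (simp add: abs_mult ennreal_mult' less_imp_le norm_power power_mult[symmetric] mult.commute)
  ultimately have "(\<lambda>\<eta>. complex_of_real (s ^ size \<eta>)) \<in> L2 chain.M"
    by (simp add: chain.L2_iff chain.nn_integral_M)
  from chain.L2_cmult(1)[OF this, of "complex_of_real C"] show ?thesis by simp
qed

lemma small_exp_size:
  assumes s: "1 \<le> s" "s < s0" and \<epsilon>: "0 < \<epsilon>"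
  shows "finite {\<eta>. \<epsilon> * s0 ^ size \<eta> < C * s ^ size \<eta>}"
proof -
  have "1 < s0 / s" using s by simp
  then obtain n where n: "\<bar>C\<bar> / \<epsilon> < (s0 / s) ^ n" using real_arch_pow by blast
  have "{\<eta>. \<epsilon> * s0 ^ size \<eta> < C * s ^ size \<eta>} \<subseteq> {\<eta>. size \<eta> \<le> n}"
  proof (safe, rule ccontr)
    fix \<eta> :: "'v \<Rightarrow> nat" assume *: "\<epsilon> * s0 ^ size \<eta> < C * s ^ size \<eta>" "\<not> size \<eta> \<le> n"
    have "(s0 / s) ^ n \<le> (s0 / s) ^ size \<eta>" using * s by (intro power_increasing) auto
    then have "\<bar>C\<bar> / \<epsilon> < (s0 / s) ^ size \<eta>" using n by linarith
    then have "\<bar>C\<bar> * s ^ size \<eta> < \<epsilon> * s0 ^ size \<eta>" using \<epsilon> s by (simp add: power_divide field_simps)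
    moreover have "C * s ^ size \<eta> \<le> \<bar>C\<bar> * s ^ size \<eta>" using s by (intro mult_right_mono) auto
    ultimately show False using * by linarith
  qed
  then show ?thesis using finite_size_le finite_subset by blast
qed

lemma dual_le_exp: "\<exists>C\<ge>0. \<forall>\<eta>. dual \<xi> \<eta> \<le> C * s1 ^ size \<eta>"
proof (intro exI conjI allI)
  let ?c = "\<lambda>x. fact (\<xi> x) / (s1 - 1) ^ \<xi> x / (pochhammer (\<alpha> x) (\<xi> x) * \<rho> ^ \<xi> x)"
  show "0 \<le> (\<Prod>x\<in>UNIV. ?c x)"
    using s1(1) poch_pos \<rho>_pos by (intro prod_nonneg) (auto simp: less_imp_le)
  fix \<eta>
  have "dual \<xi> \<eta> \<le> (\<Prod>x\<in>UNIV. ?c x * s1 ^ \<eta> x)"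
    unfolding dual_def
  proof (rule prod_mono, intro conjI site_dual_nonneg)
    fix x
    have "site_dual x (\<xi> x) (\<eta> x) \<le> (fact (\<xi> x) / (s1 - 1) ^ \<xi> x * s1 ^ \<eta> x) / (pochhammer (\<alpha> x) (\<xi> x) * \<rho> ^ \<xi> x)"
      unfolding site_dual_def using poch_pos[of x "\<xi> x"] \<rho>_pos
      by (intro divide_right_mono falling_le_power s1) (auto simp: less_imp_le)
    then show "site_dual x (\<xi> x) (\<eta> x) \<le> ?c x * s1 ^ \<eta> x" by simp
  qed
  then show "dual \<xi> \<eta> \<le> (\<Prod>x\<in>UNIV. ?c x) * s1 ^ size \<eta>"
    by (simp only: prod.distrib power_sum)
qed

lemma dual_le_exp_uniform: "\<exists>C\<ge>0. \<forall>\<xi> \<eta>. size \<xi> \<le> m \<longrightarrow> dual \<xi> \<eta> \<le> C * s1 ^ size \<eta>"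
proof -
  obtain C where C: "\<And>\<xi>. 0 \<le> C \<xi>" "\<And>\<xi> \<eta>. dual \<xi> \<eta> \<le> C \<xi> * s1 ^ size \<eta>"
    using dual_le_exp by metis
  let ?S = "{\<xi> :: 'v \<Rightarrow> nat. size \<xi> \<le> m}"
  show ?thesis
  proof (intro exI[of _ "\<Sum>\<xi>\<in>?S. C \<xi>"] conjI allI impI sum_nonneg C)
    fix \<xi> \<eta> :: "'v \<Rightarrow> nat" assume "size \<xi> \<le> m"
    then have "C \<xi> \<le> (\<Sum>\<xi>\<in>?S. C \<xi>)" by (intro member_le_sum C finite_size_le) auto
    then have "C \<xi> * s1 ^ size \<eta> \<le> (\<Sum>\<xi>\<in>?S. C \<xi>) * s1 ^ size \<eta>" using s1(1) by (intro mult_right_mono) auto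
    then show "dual \<xi> \<eta> \<le> (\<Sum>\<xi>\<in>?S. C \<xi>) * s1 ^ size \<eta>" using C(2)[of \<xi> \<eta>] by linarith
  qed
qed

text \<open>Since \<open>k\<close> will exceed all exit rates at a given level, this operator is positive there.\<close>

definition shifted_dual_L :: "real \<Rightarrow> (('v \<Rightarrow> nat) \<Rightarrow> real) \<Rightarrow> ('v \<Rightarrow> nat) \<Rightarrow> real" where
  "shifted_dual_L k g \<xi> = dual_L g \<xi> + k * g \<xi>"

definition exit_rate :: "('v \<Rightarrow> nat) \<Rightarrow> real" where
  "exit_rate \<xi> = (\<Sum>i\<in>UNIV. move_rate c \<alpha> \<omega> 0 i \<xi>)"

lemma size_dual_move:
  assumes "move_rate c \<alpha> \<omega> 0 i \<xi> \<noteq> 0"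
  shows "size (move i \<xi>) \<le> size \<xi>"
proof (cases i)
  case (Inl xy)
  obtain x y where i: "i = Inl (x, y)" using Inl by (cases xy) auto
  have "0 < \<xi> x" using assms by (auto simp: i)
  then show ?thesis using size_remove_particle[of \<xi> x] by (simp add: i size_add_particle)
next
  case (Inr xb)
  obtain x b where i: "i = Inr (x, b)" using Inr by (cases xb) auto
  have "b = False" using assms by (cases b) (auto simp: i)
  moreover from this have "0 < \<xi> x" using assms by (auto simp: i)
  ultimately show ?thesis using size_remove_particle[of \<xi> x] by (simp add: i)
qed

text \<open>The dual moves do not increase the number of particles, so only values at configurations of size at most
  \<open>m\<close> matter.\<close>

lemma shifted_dual_L_mono:
  assumes "exit_rate \<xi> \<le> k" "size \<xi> \<le> m" "\<And>\<zeta>. size \<zeta> \<le> m \<Longrightarrow> g \<zeta> \<le> g' \<zeta>"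
  shows "shifted_dual_L k g \<xi> \<le> shifted_dual_L k g' \<xi>"
proof -
  have eq: "shifted_dual_L k g \<xi> = (\<Sum>i\<in>UNIV. move_rate c \<alpha> \<omega> 0 i \<xi> * g (move i \<xi>)) + (k - exit_rate \<xi>) * g \<xi>" for g
    unfolding shifted_dual_L_def sip_generator_eq_jump_op jump_op_def exit_rate_def
    by (simp only: right_diff_distrib sum_subtractf sum_distrib_right[symmetric] left_diff_distrib)
  have "move_rate c \<alpha> \<omega> 0 i \<xi> * g (move i \<xi>) \<le> move_rate c \<alpha> \<omega> 0 i \<xi> * g' (move i \<xi>)" for i
  proof (cases "move_rate c \<alpha> \<omega> 0 i \<xi> = 0")
    case False
    then have "size (move i \<xi>) \<le> m" using size_dual_move[of i \<xi>] assms(2) by linarith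
    then show ?thesis using assms(3) move_rate_nonneg[of 0 i \<xi>] by (intro mult_left_mono) auto
  qed simp
  moreover have "(k - exit_rate \<xi>) * g \<xi> \<le> (k - exit_rate \<xi>) * g' \<xi>"
    using assms by (intro mult_left_mono) auto
  ultimately show ?thesis unfolding eq by (intro add_mono sum_mono)
qed

lemma shifted_dual_L_linear:
  "shifted_dual_L k (\<lambda>\<xi>. f \<xi> + d * g \<xi>) \<xi> = shifted_dual_L k f \<xi> + d * shifted_dual_L k g \<xi>"
  unfolding shifted_dual_L_def sip_generator_eq_jump_op jump_op_linear by (simp add: algebra_simps)

lemma shifted_dual_L_zero: "shifted_dual_L k (\<lambda>_. 0) \<xi> = 0"
  by (simp add: shifted_dual_L_def sip_generator_def)

lemma shifted_dual_L_one: "shifted_dual_L k (\<lambda>_. 1) \<xi> = k"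
  by (simp add: shifted_dual_L_def sip_generator_def)

definition iterate :: "real \<Rightarrow> nat \<Rightarrow> (('v \<Rightarrow> nat) \<Rightarrow> real) \<Rightarrow> ('v \<Rightarrow> nat) \<Rightarrow> real" where
  "iterate k n g = (shifted_dual_L k ^^ n) g"

lemma iterate_0 [simp]: "iterate k 0 g = g"
  and iterate_Suc: "iterate k (Suc n) g \<xi> = shifted_dual_L k (iterate k n g) \<xi>"
  by (simp_all add: iterate_def)

text \<open>Positivity propagates a bound by an eigenfunction \<open>G\<close>. It is used with \<open>G = 1\<close> for
  the size of the duality functions and with \<open>G = F\<close> for their decay.\<close>

lemma iterate_bound:
  assumes k: "\<And>\<xi>. size \<xi> \<le> m \<Longrightarrow> exit_rate \<xi> \<le> k"
    and G: "\<And>\<xi>. shifted_dual_L k G \<xi> = \<kappa> * G \<xi>"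
    and g: "\<And>\<xi>. size \<xi> \<le> m \<Longrightarrow> \<bar>g \<xi>\<bar> \<le> D * G \<xi>"
  shows "size \<xi> \<le> m \<Longrightarrow> \<bar>iterate k n g \<xi>\<bar> \<le> D * \<kappa> ^ n * G \<xi>"
proof (induction n arbitrary: \<xi>)
  case 0
  then show ?case using g by simp
next
  case (Suc n)
  have e: "shifted_dual_L k (\<lambda>\<xi>. d * G \<xi>) \<xi> = d * \<kappa> * G \<xi>" for d
    using shifted_dual_L_linear[of k "\<lambda>_. 0" d G \<xi>] by (simp add: shifted_dual_L_zero G)
  have "shifted_dual_L k (iterate k n g) \<xi> \<le> shifted_dual_L k (\<lambda>\<xi>. (D * \<kappa> ^ n) * G \<xi>) \<xi>"
    by (rule shifted_dual_L_mono[OF k[OF Suc.prems] Suc.prems]) (use Suc.IH in \<open>auto simp: abs_le_iff\<close>)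
  moreover have "shifted_dual_L k (\<lambda>\<xi>. (- (D * \<kappa> ^ n)) * G \<xi>) \<xi> \<le> shifted_dual_L k (iterate k n g) \<xi>"
  proof (rule shifted_dual_L_mono[OF k[OF Suc.prems] Suc.prems])
    show "- (D * \<kappa> ^ n) * G \<zeta> \<le> iterate k n g \<zeta>" if "size \<zeta> \<le> m" for \<zeta>
      using Suc.IH[OF that] by (simp add: abs_le_iff)
  qed
  ultimately show ?case unfolding iterate_Suc e by (simp add: abs_le_iff mult_ac)
qed

lemma iterate_nonneg:
  assumes k: "\<And>\<xi>. size \<xi> \<le> m \<Longrightarrow> exit_rate \<xi> \<le> k" and g: "\<And>\<xi>. 0 \<le> g \<xi>"
  shows "size \<xi> \<le> m \<Longrightarrow> 0 \<le> iterate k n g \<xi>"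
proof (induction n arbitrary: \<xi>)
  case (Suc n)
  have "shifted_dual_L k (\<lambda>_. 0) \<xi> \<le> shifted_dual_L k (iterate k n g) \<xi>"
    by (rule shifted_dual_L_mono[OF k[OF Suc.prems] Suc.prems]) (rule Suc.IH)
  then show ?case by (simp add: iterate_Suc shifted_dual_L_zero)
qed (simp add: g)

lemma iterate_minus_one: "iterate k n (\<lambda>\<xi>. g \<xi> - 1) \<xi> = iterate k n g \<xi> - k ^ n"
proof (induction n arbitrary: \<xi>)
  case (Suc n)
  have "iterate k n (\<lambda>\<xi>. g \<xi> - 1) = (\<lambda>\<xi>. iterate k n g \<xi> + (- (k ^ n)) * 1)"
    by (rule ext) (simp add: Suc.IH)
  then show ?case
    unfolding iterate_Suc by (simp only: shifted_dual_L_linear shifted_dual_L_one) simp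
qed simp

text \<open>The two generators act on different arguments and therefore commute, so duality passes to all iterates.\<close>

lemma iterate_duality:
  "L (\<lambda>\<eta>. iterate k n (\<lambda>\<xi>. dual \<xi> \<eta>) \<xi>) \<eta> = dual_L (\<lambda>\<xi>. iterate k n (\<lambda>\<xi>. dual \<xi> \<eta>) \<xi>) \<xi>"
proof (induction n arbitrary: \<xi> \<eta>)
  case 0
  show ?case by (simp add: duality)
next
  case (Suc n)
  let ?a = "\<lambda>\<xi> \<eta>. iterate k n (\<lambda>\<xi>. dual \<xi> \<eta>) \<xi>"
  have lin: "sip_generator c \<alpha> \<omega> \<rho>' (\<lambda>\<eta>. f \<eta> + k * g \<eta>) \<eta> = sip_generator c \<alpha> \<omega> \<rho>' f \<eta> + k * sip_generator c \<alpha> \<omega> \<rho>' g \<eta>"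
    for \<rho>' f g \<eta> unfolding sip_generator_eq_jump_op by (rule jump_op_linear)
  have "L (\<lambda>\<eta>. iterate k (Suc n) (\<lambda>\<xi>. dual \<xi> \<eta>) \<xi>) \<eta> = L (\<lambda>\<eta>. dual_L (\<lambda>\<xi>. ?a \<xi> \<eta>) \<xi>) \<eta> + k * L (\<lambda>\<eta>. ?a \<xi> \<eta>) \<eta>"
    by (simp only: iterate_Suc shifted_dual_L_def lin)
  also have "L (\<lambda>\<eta>. dual_L (\<lambda>\<xi>. ?a \<xi> \<eta>) \<xi>) \<eta> = dual_L (\<lambda>\<xi>. L (\<lambda>\<eta>. ?a \<xi> \<eta>) \<eta>) \<xi>"
    unfolding sip_generator_eq_jump_op by (rule jump_op_commute)
  also have "\<dots> + k * L (\<lambda>\<eta>. ?a \<xi> \<eta>) \<eta> = dual_L (\<lambda>\<xi>. dual_L (\<lambda>\<xi>. ?a \<xi> \<eta>) \<xi> + k * ?a \<xi> \<eta>) \<xi>"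
    by (simp only: Suc.IH lin)
  also have "\<dots> = dual_L (\<lambda>\<xi>. iterate k (Suc n) (\<lambda>\<xi>. dual \<xi> \<eta>) \<xi>) \<xi>"
    by (simp only: iterate_Suc shifted_dual_L_def)
  finally show ?case .
qed

end

section \<open>Decay of the duality functions and the eigenfunction\<close>

locale open_sip_principal = open_sip c \<alpha> \<omega> \<rho>
  for c :: "'v::finite \<Rightarrow> 'v \<Rightarrow> real" and \<alpha> \<omega> :: "'v \<Rightarrow> real" and \<rho> :: real +
  fixes \<psi> :: "'v \<Rightarrow> real" and l :: real
  assumes \<psi>_pos: "0 < \<psi> x"
    and \<psi>_eigen: "rw_neg_generator c \<alpha> \<omega> \<psi> = (\<lambda>x. l * \<psi> x)"
    and l_pos: "0 < l"
begin

definition F :: "('v \<Rightarrow> nat) \<Rightarrow> real" where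
  "F \<xi> = (\<Sum>x\<in>UNIV. real (\<xi> x) * \<psi> x)"

lemma F_nonneg: "0 \<le> F \<xi>"
  unfolding F_def using \<psi>_pos by (intro sum_nonneg mult_nonneg_nonneg) (auto simp: less_imp_le)

lemma sip_generator_F:
  "sip_generator c \<alpha> \<omega> \<rho>' F \<eta> = - l * F \<eta> + \<rho>' * (\<Sum>x\<in>UNIV. \<omega> x * \<alpha> x * \<psi> x)"
proof -
  have F_fun: "F = (\<lambda>\<eta>. \<Sum>x\<in>UNIV. real (\<eta> x) * \<psi> x)" by (rule ext) (rule F_def)
  have "(\<Sum>x\<in>UNIV. real (\<eta> x) * (l * \<psi> x)) = l * F \<eta>"
    by (simp add: F_def sum_distrib_left mult_ac)
  then show ?thesis
    unfolding F_fun sip_generator_linear_fun \<psi>_eigen by simp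
qed

lemma stationary_flux: "(\<Sum>x\<in>UNIV. \<omega> x * \<alpha> x * \<psi> x) = l * (\<Sum>x\<in>UNIV. \<alpha> x * \<psi> x)"
proof -
  have "rw_form c \<alpha> \<omega> (\<lambda>_. 1) \<psi> = l * (\<Sum>x\<in>UNIV. \<alpha> x * \<psi> x)"
    unfolding rw_form_def \<psi>_eigen by (simp add: sum_distrib_left mult_ac)
  moreover have "rw_form c \<alpha> \<omega> (\<lambda>_. 1) \<psi> = (\<Sum>x\<in>UNIV. \<alpha> x * \<omega> x * \<psi> x)"
    unfolding rw_form_eq by simp
  ultimately show ?thesis by (simp add: mult_ac)
qed

lemma dual_zero: "dual (\<lambda>_. 0) \<eta> = 1"
  by (simp add: dual_def site_dual_def)

text \<open>For \<open>\<xi> = 0\<close> both sides vanish, and every other \<open>\<xi>\<close> has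
  \<open>F \<xi> \<ge> Min (range \<psi>)\<close>.\<close>

lemma dual_minus_one_le: "\<exists>C\<ge>0. \<forall>\<xi> \<eta>. size \<xi> \<le> m \<longrightarrow> \<bar>dual \<xi> \<eta> - 1\<bar> \<le> C * s1 ^ size \<eta> * F \<xi>"
proof -
  obtain C where C: "0 \<le> C" "\<And>\<xi> \<eta>. size \<xi> \<le> m \<Longrightarrow> dual \<xi> \<eta> \<le> C * s1 ^ size \<eta>"
    using dual_le_exp_uniform by blast
  \<comment> \<open>The set of sites is finite, so \<open>\<psi>\<close> is bounded away from zero.\<close>
  define p where "p = Min (range \<psi>)"
  have p: "0 < p" "\<And>x. p \<le> \<psi> x" using \<psi>_pos by (auto simp: p_def)
  have F_ge: "p \<le> F \<xi>" if nz: "\<xi> \<noteq> (\<lambda>_. 0)" for \<xi>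
  proof -
    obtain x where "\<xi> x \<noteq> 0" using nz by auto
    then have "p \<le> real (\<xi> x) * \<psi> x"
      using p(2)[of x] p(1) mult_mono[of 1 "real (\<xi> x)" p "\<psi> x"] by simp
    also have "\<dots> \<le> F \<xi>"
      unfolding F_def using \<psi>_pos by (intro member_le_sum) (auto simp: less_imp_le)
    finally show ?thesis .
  qed
  show ?thesis
  proof (intro exI[of _ "(1 + C) / p"] conjI allI impI)
    show "0 \<le> (1 + C) / p" using C p by simp
    fix \<xi> \<eta> :: "'v \<Rightarrow> nat" assume m: "size \<xi> \<le> m"
    show "\<bar>dual \<xi> \<eta> - 1\<bar> \<le> (1 + C) / p * s1 ^ size \<eta> * F \<xi>"
    proof (cases "\<xi> = (\<lambda>_. 0)")
      case True
      then show ?thesis by (simp add: dual_zero F_def)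
    next
      case False
      have s: "1 \<le> s1 ^ size \<eta>" using s1(1) by (intro one_le_power) simp
      have "\<bar>dual \<xi> \<eta> - 1\<bar> \<le> dual \<xi> \<eta> + 1" using dual_nonneg[of \<xi> \<eta>] by linarith
      also have "\<dots> \<le> C * s1 ^ size \<eta> + s1 ^ size \<eta>" using C(2)[OF m] s by (intro add_mono) auto
      also have "\<dots> = (1 + C) / p * s1 ^ size \<eta> * p" using p by (simp add: field_simps)
      also have "\<dots> \<le> (1 + C) / p * s1 ^ size \<eta> * F \<xi>"
        using F_ge[OF False] p(1) C(1) s1(1) by (intro mult_left_mono mult_nonneg_nonneg) auto
      finally show ?thesis .
    qed
  qed
qed

text \<open>The function \<open>u\<close> is the semigroup of the dual chain applied to the dual argument. By duality it
  solves the backward equation of the process. The coefficients of its series are \<open>k ^ n\<close> up to an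
  error of order \<open>(k - l) ^ n\<close>, because \<open>F\<close> is an eigenfunction of the shifted dual
  generator with eigenvalue \<open>k - l\<close>; this yields \<open>u = 1 + O(exp (- l * t))\<close>.\<close>

lemma dual_decaying: "chain.decaying l (\<lambda>\<eta>. complex_of_real (dual \<xi> \<eta>))"
proof -
  define m where "m = size \<xi>"
  \<comment> \<open>Large enough to exceed all exit rates at this level, and also \<open>l\<close>, so that
    \<open>k - l\<close> is non-negative.\<close>
  define k where "k = l + (\<Sum>\<zeta>\<in>{\<zeta> :: 'v \<Rightarrow> nat. size \<zeta> \<le> m}. exit_rate \<zeta>)"
  have exit0: "0 \<le> exit_rate \<zeta>" for \<zeta>
    unfolding exit_rate_def by (intro sum_nonneg move_rate_nonneg) auto
  have k: "exit_rate \<zeta> \<le> k" if "size \<zeta> \<le> m" for \<zeta>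
  proof -
    have "exit_rate \<zeta> \<le> (\<Sum>\<zeta>\<in>{\<zeta> :: 'v \<Rightarrow> nat. size \<zeta> \<le> m}. exit_rate \<zeta>)"
      by (rule member_le_sum) (use that exit0 finite_size_le in auto)
    then show ?thesis using l_pos by (simp add: k_def)
  qed
  have kl: "l \<le> k" unfolding k_def using exit0 by (simp add: sum_nonneg)
  then have k0: "0 \<le> k" using l_pos by simp
  obtain C where C: "0 \<le> C" "\<And>\<zeta> \<eta>. size \<zeta> \<le> m \<Longrightarrow> dual \<zeta> \<eta> \<le> C * s1 ^ size \<eta>"
    using dual_le_exp_uniform by blast
  obtain D where D: "0 \<le> D" "\<And>\<zeta> \<eta>. size \<zeta> \<le> m \<Longrightarrow> \<bar>dual \<zeta> \<eta> - 1\<bar> \<le> D * s1 ^ size \<eta> * F \<zeta>"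
    using dual_minus_one_le by blast
  define a where "a n \<eta> = iterate k n (\<lambda>\<xi>. dual \<xi> \<eta>) \<xi>" for n \<eta>
  define u where "u t \<eta> = exp (- k * t) * (\<Sum>n. a n \<eta> / fact n * t ^ n)" for t \<eta>
  have a_bound: "\<bar>a n \<eta>\<bar> \<le> C * s1 ^ size \<eta> * k ^ n" for n \<eta>
    using iterate_bound[where m=m and k=k and G="\<lambda>_. 1" and \<kappa>=k and g="\<lambda>\<xi>. dual \<xi> \<eta>" and D="C * s1 ^ size \<eta>" and \<xi>=\<xi> and n=n]
      k C(2) dual_nonneg shifted_dual_L_one by (simp add: a_def m_def)
  have a_decay: "\<bar>a n \<eta> - k ^ n\<bar> \<le> (D * s1 ^ size \<eta> * F \<xi>) * (k - l) ^ n" for n \<eta>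
  proof -
    have G: "shifted_dual_L k F \<zeta> = (k - l) * F \<zeta>" for \<zeta>
      using sip_generator_F[of 0 \<zeta>] by (simp add: shifted_dual_L_def algebra_simps)
    have "\<bar>iterate k n (\<lambda>\<xi>. dual \<xi> \<eta> - 1) \<xi>\<bar> \<le> D * s1 ^ size \<eta> * (k - l) ^ n * F \<xi>"
      by (rule iterate_bound[where m=m, OF k G D(2)]) (simp_all add: m_def)
    then show ?thesis unfolding iterate_minus_one by (simp add: a_def mult_ac)
  qed
  have a_nonneg: "0 \<le> a n \<eta>" for n \<eta>
    unfolding a_def by (rule iterate_nonneg[where m=m, OF k dual_nonneg]) (simp_all add: m_def)
  have a_step: "a (Suc n) \<eta> = jump_op (move_rate c \<alpha> \<omega> \<rho>) move (a n) \<eta> + k * a n \<eta>" for n \<eta>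
    using iterate_duality[of k n \<xi> \<eta>]
    by (simp add: a_def[abs_def] iterate_Suc shifted_dual_L_def sip_generator_eq_jump_op)
  have u0: "u 0 \<eta> = dual \<xi> \<eta>" for \<eta>
  proof -
    have "(\<lambda>n. a n \<eta> / fact n * 0 ^ n) sums (a 0 \<eta> / fact 0)" by (rule powser_sums_zero)
    then show ?thesis by (simp add: u_def sums_iff a_def)
  qed
  have sm: "summable (\<lambda>n. a n \<eta> / fact n * t ^ n)" for \<eta> t
    by (rule exp_series_bound(1)[OF a_bound k0])
  have u_nonneg: "0 \<le> u t \<eta>" if "0 \<le> t" for t \<eta>
    unfolding u_def using that a_nonneg by (intro mult_nonneg_nonneg suminf_nonneg sm) auto
  have u_deriv: "((\<lambda>t. u t \<eta>) has_real_derivative rate_apply (rate_matrix L) (u t) \<eta>) (at t)" for t \<eta>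
    unfolding sip_generator_eq_jump_op rate_apply_jump_op u_def[abs_def]
    by (rule series_solves_backward_equation[OF a_step a_bound k0])
  have u_bound: "u t \<eta> \<le> C * s1 ^ size \<eta>" if "0 \<le> t" for t \<eta>
  proof -
    have "\<bar>\<Sum>n. a n \<eta> / fact n * t ^ n\<bar> \<le> C * s1 ^ size \<eta> * exp (k * t)"
      by (rule exp_series_bound(2)[OF a_bound k0 that])
    then have "u t \<eta> \<le> exp (- k * t) * (C * s1 ^ size \<eta> * exp (k * t))"
      unfolding u_def by (intro mult_left_mono) auto
    then show ?thesis by (simp add: exp_minus field_simps)
  qed
  have u_decay: "\<bar>u t \<eta> - 1\<bar> \<le> D * F \<xi> * exp (- l * t) * s1 ^ size \<eta>" if t: "0 \<le> t" for t \<eta>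
  proof -
    have ek: "(\<lambda>n. k ^ n / fact n * t ^ n) sums exp (k * t)"
      using exp_converges[of "k * t"] by (simp add: power_mult_distrib divide_inverse mult_ac)
    have "(\<lambda>n. a n \<eta> / fact n * t ^ n - k ^ n / fact n * t ^ n) sums ((\<Sum>n. a n \<eta> / fact n * t ^ n) - exp (k * t))"
      by (rule sums_diff[OF summable_sums[OF sm] ek])
    then have eq: "(\<Sum>n. (a n \<eta> - k ^ n) / fact n * t ^ n) = (\<Sum>n. a n \<eta> / fact n * t ^ n) - exp (k * t)"
      by (simp add: sums_iff diff_divide_distrib left_diff_distrib)
    have "u t \<eta> - 1 = exp (- k * t) * (\<Sum>n. (a n \<eta> - k ^ n) / fact n * t ^ n)"
      unfolding eq u_def by (simp add: right_diff_distrib exp_minus)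
    moreover have "\<bar>\<Sum>n. (a n \<eta> - k ^ n) / fact n * t ^ n\<bar> \<le> D * s1 ^ size \<eta> * F \<xi> * exp ((k - l) * t)"
      by (rule exp_series_bound(2)[OF a_decay _ t]) (use kl in simp)
    ultimately have "\<bar>u t \<eta> - 1\<bar> \<le> exp (- k * t) * (D * s1 ^ size \<eta> * F \<xi> * exp ((k - l) * t))"
      by (simp add: abs_mult)
    also have "\<dots> = D * F \<xi> * (exp (- k * t) * exp ((k - l) * t)) * s1 ^ size \<eta>" by simp
    also have "exp (- k * t) * exp ((k - l) * t) = exp (- l * t)" by (simp add: exp_add[symmetric] algebra_simps)
    finally show ?thesis .
  qed
  have Pu: "chain.P t (\<lambda>\<eta>. complex_of_real (dual \<xi> \<eta>)) \<eta> = complex_of_real (u t \<eta>)" if "0 \<le> t" for t \<eta>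
    using chain.P_of_solution[OF u_nonneg u_deriv u_bound _ that, of \<eta>] small_exp_size[of s1 _ C] s1 s1_lt
    by (simp add: u0)
  have s1L: "(\<lambda>\<eta>. complex_of_real (B * s1 ^ size \<eta>)) \<in> L2 chain.M" for B
    using s1 s1_lt by (intro exp_size_L2) auto
  show ?thesis
  proof (rule chain.decayingI[OF _ l_pos])
    show "(\<lambda>\<eta>. complex_of_real (dual \<xi> \<eta>)) \<in> L2 chain.M"
      by (rule chain.L2_dominated(1)[OF s1L[of C]])
        (use C dual_nonneg s1 in \<open>auto simp: m_def norm_mult norm_power\<close>)
    fix t :: real assume t: "0 \<le> t"
    let ?B = "D * F \<xi> * exp (- l * t)"
    have B0: "0 \<le> ?B" using D(1) F_nonneg by simp
    have "L2_norm chain.M (\<lambda>\<eta>. chain.P t (\<lambda>\<eta>. complex_of_real (dual \<xi> \<eta>)) \<eta> - 1) \<le>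
        L2_norm chain.M (\<lambda>\<eta>. complex_of_real (?B * s1 ^ size \<eta>))"
    proof (rule chain.L2_dominated(2)[OF s1L])
      fix \<eta>
      have "chain.P t (\<lambda>\<eta>. complex_of_real (dual \<xi> \<eta>)) \<eta> - 1 = complex_of_real (u t \<eta> - 1)"
        by (simp add: Pu t)
      then have "cmod (chain.P t (\<lambda>\<eta>. complex_of_real (dual \<xi> \<eta>)) \<eta> - 1) = \<bar>u t \<eta> - 1\<bar>"
        by (simp only: norm_of_real)
      also have "\<dots> \<le> \<bar>?B * s1 ^ size \<eta>\<bar>" using u_decay[OF t, of \<eta>] by linarith
      finally show "cmod (chain.P t (\<lambda>\<eta>. complex_of_real (dual \<xi> \<eta>)) \<eta> - 1) \<le> cmod (complex_of_real (?B * s1 ^ size \<eta>))"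
        by (simp only: norm_of_real)
    qed
    also have "\<dots> = ?B * L2_norm chain.M (\<lambda>\<eta>. complex_of_real (1 * s1 ^ size \<eta>))"
      using chain.L2_cmult(2)[OF s1L[of 1], of "complex_of_real ?B"] D(1) F_nonneg[of \<xi>] by (simp add: norm_mult abs_mult)
    finally show "L2_norm chain.M (\<lambda>\<eta>. chain.P t (\<lambda>\<eta>. complex_of_real (dual \<xi> \<eta>)) \<eta> - 1) \<le>
        (D * F \<xi> * L2_norm chain.M (\<lambda>\<eta>. complex_of_real (1 * s1 ^ size \<eta>))) * exp (- l * t)"
      by (simp add: mult_ac)
  qed
qed

text \<open>The candidate solution \<open>exp (- l * t) * (F \<eta> - \<kappa>) + \<kappa>\<close> starting from
  \<open>F\<close> is non-negative, so uniqueness applies to it although the centred function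
  \<open>F - \<kappa>\<close> changes sign.\<close>

lemma F_eigenfunction:
  defines "\<kappa> \<equiv> \<rho> * (\<Sum>x\<in>UNIV. \<alpha> x * \<psi> x)"
  shows "(\<lambda>\<eta>. complex_of_real (F \<eta> - \<kappa>)) \<in> L2 chain.M"
    and "0 \<le> t \<Longrightarrow> chain.P t (\<lambda>\<eta>. complex_of_real (F \<eta> - \<kappa>)) = (\<lambda>\<eta>. complex_of_real (exp (- l * t)) * complex_of_real (F \<eta> - \<kappa>))"
    and "F (\<lambda>_. 0) - \<kappa> \<noteq> 0"
proof -
  have \<kappa>: "0 < \<kappa>" unfolding \<kappa>_def using \<rho>_pos \<alpha>_pos \<psi>_pos by (intro mult_pos_pos sum_pos) auto
  show "F (\<lambda>_. 0) - \<kappa> \<noteq> 0" using \<kappa> by (simp add: F_def)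
  define C where "C = (\<Sum>x\<in>UNIV. \<psi> x) / (s1 - 1) + \<kappa>"
  have S0: "0 \<le> (\<Sum>x\<in>UNIV. \<psi> x)" using \<psi>_pos by (intro sum_nonneg) (auto simp: less_imp_le)
  have C0: "0 \<le> C" unfolding C_def using S0 s1(1) \<kappa> by simp
  have pw: "1 \<le> s1 ^ n" for n :: nat using s1(1) by (intro one_le_power) simp
  have F_le: "F \<eta> + \<kappa> \<le> C * s1 ^ size \<eta>" for \<eta>
  proof -
    have "F \<eta> \<le> (\<Sum>x\<in>UNIV. (s1 ^ size \<eta> / (s1 - 1)) * \<psi> x)"
      unfolding F_def
    proof (intro sum_mono mult_right_mono)
      fix x
      have "\<eta> x \<le> size \<eta>" by (rule member_le_sum) auto
      then have "real (\<eta> x) \<le> real (size \<eta>)" by (simp only: of_nat_le_iff)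
      moreover have "1 + real (size \<eta>) * (s1 - 1) \<le> s1 ^ size \<eta>"
        using Bernoulli_inequality[of "s1 - 1" "size \<eta>"] s1(1) by simp
      ultimately show "real (\<eta> x) \<le> s1 ^ size \<eta> / (s1 - 1)"
        using s1(1) by (simp add: pos_le_divide_eq) (smt (verit) mult_right_mono)
      show "0 \<le> \<psi> x" using \<psi>_pos[of x] by simp
    qed
    also have "\<dots> = (\<Sum>x\<in>UNIV. \<psi> x) / (s1 - 1) * s1 ^ size \<eta>"
      by (subst sum_distrib_left[symmetric]) simp
    finally have "F \<eta> \<le> (\<Sum>x\<in>UNIV. \<psi> x) / (s1 - 1) * s1 ^ size \<eta>" .
    moreover have "\<kappa> * 1 \<le> \<kappa> * s1 ^ size \<eta>" using \<kappa> pw by (intro mult_left_mono) auto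
    ultimately show ?thesis by (simp add: C_def distrib_right)
  qed
  have CL: "(\<lambda>\<eta>. complex_of_real (C * s1 ^ size \<eta>)) \<in> L2 chain.M"
    using s1 s1_lt by (intro exp_size_L2) auto
  have FL: "(\<lambda>\<eta>. complex_of_real (F \<eta>)) \<in> L2 chain.M"
  proof (rule chain.L2_dominated(1)[OF CL])
    fix \<eta>
    show "cmod (complex_of_real (F \<eta>)) \<le> cmod (complex_of_real (C * s1 ^ size \<eta>))"
      unfolding norm_of_real using F_le[of \<eta>] F_nonneg[of \<eta>] \<kappa> by linarith
  qed
  from chain.L2_diff(1)[OF this chain.L2_const[of "complex_of_real \<kappa>"]]
  show L: "(\<lambda>\<eta>. complex_of_real (F \<eta> - \<kappa>)) \<in> L2 chain.M" by simp
  assume t: "0 \<le> t"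
  define u where "u t \<eta> = exp (- l * t) * (F \<eta> - \<kappa>) + \<kappa>" for t \<eta>
  have e01: "exp (- l * t) \<le> 1" if "0 \<le> t" for t using that l_pos by simp
  have "chain.P t (\<lambda>\<eta>. complex_of_real (u 0 \<eta>)) \<eta> = complex_of_real (u t \<eta>)" for \<eta>
  proof (rule chain.P_of_solution[OF _ _ _ _ t])
    fix t \<eta>
    show "((\<lambda>t. u t \<eta>) has_real_derivative rate_apply (rate_matrix L) (u t) \<eta>) (at t)"
    proof -
      have "L (u t) \<eta> = exp (- l * t) * L F \<eta>"
        unfolding sip_generator_def u_def by (simp add: sum_distrib_left algebra_simps)
      also have "\<dots> = exp (- l * t) * (- l * (F \<eta> - \<kappa>))"
        unfolding sip_generator_F stationary_flux \<kappa>_def by (simp add: algebra_simps)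
      finally have "rate_apply (rate_matrix L) (u t) \<eta> = exp (- l * t) * (- l * (F \<eta> - \<kappa>))"
        unfolding sip_generator_eq_jump_op rate_apply_jump_op .
      then show ?thesis unfolding u_def by (auto intro!: derivative_eq_intros)
    qed
  next
    fix t :: real and \<eta> assume t: "0 \<le> t"
    have eq: "u t \<eta> = exp (- l * t) * F \<eta> + (1 - exp (- l * t)) * \<kappa>" by (simp add: u_def algebra_simps)
    show "0 \<le> u t \<eta>" unfolding eq using e01[OF t] F_nonneg \<kappa> by (intro add_nonneg_nonneg mult_nonneg_nonneg) auto
    have "exp (- l * t) * F \<eta> \<le> 1 * F \<eta>" "(1 - exp (- l * t)) * \<kappa> \<le> 1 * \<kappa>"
      using e01[OF t] F_nonneg[of \<eta>] \<kappa> by (intro mult_right_mono; simp)+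
    then show "u t \<eta> \<le> C * s1 ^ size \<eta>" unfolding eq using F_le[of \<eta>] by linarith
  qed (use small_exp_size[of s1 _ C] s1 s1_lt in auto)
  moreover have "u 0 = F" by (rule ext) (simp add: u_def)
  ultimately have "chain.P t (\<lambda>\<eta>. complex_of_real (F \<eta>)) = (\<lambda>\<eta>. complex_of_real (u t \<eta>))"
    by (intro ext) simp
  moreover have "chain.P t (\<lambda>\<eta>. complex_of_real (F \<eta>) - complex_of_real \<kappa>) =
      (\<lambda>\<eta>. chain.P t (\<lambda>\<eta>. complex_of_real (F \<eta>)) \<eta> - complex_of_real \<kappa>)"
    by (simp add: chain.P_diff t FL chain.L2_const chain.P_const)
  ultimately show "chain.P t (\<lambda>\<eta>. complex_of_real (F \<eta> - \<kappa>)) = (\<lambda>\<eta>. complex_of_real (exp (- l * t)) * complex_of_real (F \<eta> - \<kappa>))"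
    by (simp add: u_def)
qed

end

section \<open>Density of the duality functions and the spectral gap\<close>

context open_sip
begin

inductive_set duality_span :: "(('v \<Rightarrow> nat) \<Rightarrow> real) set" where
  dual: "dual \<xi> \<in> duality_span"
| lincomb: "f \<in> duality_span \<Longrightarrow> g \<in> duality_span \<Longrightarrow> (\<lambda>\<eta>. d * f \<eta> + g \<eta>) \<in> duality_span"

lemma duality_span_zero: "(\<lambda>_. 0) \<in> duality_span"
  using duality_span.lincomb[of "dual (\<lambda>_. 0)" "dual (\<lambda>_. 0)" "-1"] duality_span.dual by simp

lemma duality_span_scale: "f \<in> duality_span \<Longrightarrow> (\<lambda>\<eta>. d * f \<eta>) \<in> duality_span"
  using duality_span.lincomb[OF _ duality_span_zero, of f d] by simp

lemma duality_span_add: "f \<in> duality_span \<Longrightarrow> g \<in> duality_span \<Longrightarrow> (\<lambda>\<eta>. f \<eta> + g \<eta>) \<in> duality_span"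
  using duality_span.lincomb[of f g 1] by simp

lemma duality_span_sum:
  "finite A \<Longrightarrow> (\<And>x. x \<in> A \<Longrightarrow> f x \<in> duality_span) \<Longrightarrow> (\<lambda>\<eta>. \<Sum>x\<in>A. f x \<eta>) \<in> duality_span"
  by (induction A rule: finite_induct) (auto intro: duality_span_zero duality_span_add)

lemma dual_times_site:
  "real (\<eta> x) * dual \<xi> \<eta> = (\<alpha> x + real (\<xi> x)) * \<rho> * dual (add_particle x \<xi>) \<eta> + real (\<xi> x) * dual \<xi> \<eta>"
proof -
  let ?R = "\<Prod>z\<in>UNIV - {x}. site_dual z (\<xi> z) (\<eta> z)"
  have "(\<Prod>z\<in>UNIV - {x}. site_dual z (add_particle x \<xi> z) (\<eta> z)) = ?R"
    by (rule prod.cong) (auto simp: add_particle_def)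
  then have "dual (add_particle x \<xi>) \<eta> = site_dual x (Suc (\<xi> x)) (\<eta> x) * ?R"
    unfolding dual_split1[of "add_particle x \<xi>" \<eta> x] by (simp add: add_particle_def)
  moreover have "real (\<eta> x) * dual \<xi> \<eta> = (real (\<eta> x) * site_dual x (\<xi> x) (\<eta> x)) * ?R"
    unfolding dual_split1[of \<xi> \<eta> x] by simp
  ultimately show ?thesis
    unfolding site_dual_mult dual_split1[of \<xi> \<eta> x] by (simp add: algebra_simps)
qed

text \<open>By \<open>dual_times_site\<close> the span is even closed under multiplication by each occupation number, so
  it contains all polynomials. Powers of the total number of particles are what the Taylor expansion of
  \<open>exp (- h * size \<eta>)\<close> requires.\<close>

lemma duality_span_times_size:
  assumes "f \<in> duality_span" shows "(\<lambda>\<eta>. real (size \<eta>) * f \<eta>) \<in> duality_span"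
  using assms
proof induction
  case (dual \<xi>)
  have "(\<lambda>\<eta>. real (size \<eta>) * dual \<xi> \<eta>) =
     (\<lambda>\<eta>. \<Sum>x\<in>UNIV. ((\<alpha> x + real (\<xi> x)) * \<rho>) * dual (add_particle x \<xi>) \<eta> + real (\<xi> x) * dual \<xi> \<eta>)"
    by (rule ext) (simp add: sum_distrib_right dual_times_site)
  moreover have "\<dots> \<in> duality_span"
    by (intro duality_span_sum duality_span_add duality_span_scale duality_span.dual) auto
  ultimately show ?case by simp
next
  case (lincomb f g d)
  have "(\<lambda>\<eta>. real (size \<eta>) * (d * f \<eta> + g \<eta>)) = (\<lambda>\<eta>. d * (real (size \<eta>) * f \<eta>) + real (size \<eta>) * g \<eta>)"
    by (simp add: algebra_simps)
  then show ?case using duality_span.lincomb[OF lincomb.IH, of d] by simp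
qed

lemma duality_span_times_power:
  "f \<in> duality_span \<Longrightarrow> (\<lambda>\<eta>. real (size \<eta>) ^ n * f \<eta>) \<in> duality_span"
proof (induction n)
  case (Suc n)
  then have "(\<lambda>\<eta>. real (size \<eta>) * (real (size \<eta>) ^ n * f \<eta>)) \<in> duality_span"
    by (intro duality_span_times_size) auto
  then show ?case by (simp add: mult.assoc)
qed simp

lemma duality_span_bound:
  assumes "f \<in> duality_span" shows "\<exists>C\<ge>0. \<forall>\<eta>. \<bar>f \<eta>\<bar> \<le> C * s1 ^ size \<eta>"
  using assms
proof induction
  case (dual \<xi>)
  then show ?case using dual_le_exp[of \<xi>] dual_nonneg by simp
next
  case (lincomb f g d)
  then obtain C D where C: "0 \<le> C" "\<And>\<eta>. \<bar>f \<eta>\<bar> \<le> C * s1 ^ size \<eta>" and D: "0 \<le> D" "\<And>\<eta>. \<bar>g \<eta>\<bar> \<le> D * s1 ^ size \<eta>"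
    by blast
  show ?case
  proof (intro exI[of _ "\<bar>d\<bar> * C + D"] conjI allI)
    show "0 \<le> \<bar>d\<bar> * C + D" using C(1) D(1) by simp
    fix \<eta>
    have "\<bar>d * f \<eta> + g \<eta>\<bar> \<le> \<bar>d\<bar> * \<bar>f \<eta>\<bar> + \<bar>g \<eta>\<bar>" by (metis abs_mult abs_triangle_ineq)
    also have "\<dots> \<le> \<bar>d\<bar> * (C * s1 ^ size \<eta>) + D * s1 ^ size \<eta>"
      by (intro add_mono mult_left_mono C D) auto
    finally show "\<bar>d * f \<eta> + g \<eta>\<bar> \<le> (\<bar>d\<bar> * C + D) * s1 ^ size \<eta>" by (simp add: algebra_simps)
  qed
qed

text \<open>First \<open>f * exp (- m * h * size \<eta>)\<close> is reached for every polynomial \<open>f\<close> by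
  induction on \<open>m\<close>: the Taylor series of one more factor \<open>exp (- h * size \<eta>)\<close> has
  polynomial coefficients and is dominated by \<open>exp (h * size \<eta>)\<close>, for the small step
  \<open>h = ln s1\<close>. Then \<open>f = dual \<zeta>\<close> is multiplied by
  \<open>exp (- m * h * (size \<eta> - size \<zeta>))\<close> and \<open>m\<close> goes to infinity. Since
  \<open>dual \<zeta> \<eta>\<close> vanishes unless \<open>\<eta> \<ge> \<zeta>\<close>, only the value at
  \<open>\<zeta>\<close> survives.\<close>

lemma dominated_closure_contains_indicators:
  assumes base: "\<And>\<xi>. Q (dual \<xi>)"
    and add: "\<And>f g. Q f \<Longrightarrow> Q g \<Longrightarrow> Q (\<lambda>\<eta>. f \<eta> + g \<eta>)"
    and scale: "\<And>f d. Q f \<Longrightarrow> Q (\<lambda>\<eta>. d * f \<eta>)"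
    and limit: "\<And>f g C. (\<And>n. Q (f n)) \<Longrightarrow> (\<And>n \<eta>. \<bar>f n \<eta>\<bar> \<le> C * (s1\<^sup>2) ^ size \<eta>) \<Longrightarrow>
      (\<And>\<eta>. (\<lambda>n. f n \<eta>) \<longlonglongrightarrow> g \<eta>) \<Longrightarrow> Q g"
  shows "Q (indicator {\<zeta>})"
proof -
  define h where "h = ln s1"
  have h: "0 < h" "exp h = s1" using s1(1) by (auto simp: h_def)
  define E where "E m \<eta> = exp (- (real m * h * real (size \<eta>)))" for m \<eta>
  have E1: "0 < E m \<eta>" "E m \<eta> \<le> 1" for m \<eta> using h(1) by (auto simp: E_def simp del: of_nat_sum)
  have eh: "exp (h * real n) = s1 ^ n" for n
    using exp_of_nat_mult[of n h] h(2) by (simp add: mult.commute)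
  have Q_exp: "Q (\<lambda>\<eta>. f \<eta> * E m \<eta>)" if "f \<in> duality_span" for f m
    using that
  proof (induction m arbitrary: f)
    case 0
    have "Q f" using 0 by induction (auto intro: base add scale)
    then show ?case by (simp add: E_def)
  next
    case (Suc m)
    obtain C where C: "0 \<le> C" "\<And>\<eta>. \<bar>f \<eta>\<bar> \<le> C * s1 ^ size \<eta>"
      using duality_span_bound[OF Suc.prems] by blast
    let ?term = "\<lambda>j \<eta>. ((- h) ^ j / fact j) * (real (size \<eta>) ^ j * f \<eta> * E m \<eta>)"
    have Qt: "Q (?term j)" for j
      by (intro scale Suc.IH duality_span_times_power Suc.prems)
    show ?case
    proof (rule limit)
      show "Q (\<lambda>\<eta>. \<Sum>j<n. ?term j \<eta>)" for n
      proof (induction n)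
        case 0
        show ?case using scale[OF base[of "\<lambda>_. 0"], of 0] by simp
      next
        case (Suc n)
        show ?case using add[OF Suc.IH Qt[of n]] by simp
      qed
      fix \<eta>
      let ?N = "real (size \<eta>)"
      \<comment> \<open>The series converges absolutely to one more factor \<open>exp (- h * ?N)\<close>.\<close>
      have term_eq: "?term j \<eta> = f \<eta> * E m \<eta> * ((- (h * ?N)) ^ j /\<^sub>R fact j)" for j
        by (simp add: power_mult_distrib[symmetric] divide_inverse)
      have "(\<lambda>j. ?term j \<eta>) sums (f \<eta> * E m \<eta> * exp (- (h * ?N)))"
        unfolding term_eq by (intro sums_mult exp_converges)
      moreover have "f \<eta> * E m \<eta> * exp (- (h * ?N)) = f \<eta> * E (Suc m) \<eta>"
        by (simp add: E_def exp_add[symmetric] algebra_simps)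
      ultimately show "(\<lambda>n. \<Sum>j<n. ?term j \<eta>) \<longlonglongrightarrow> f \<eta> * E (Suc m) \<eta>"
        unfolding sums_def by (simp only:)
      fix n
      have "\<bar>\<Sum>j<n. ?term j \<eta>\<bar> \<le> (\<Sum>j<n. \<bar>f \<eta>\<bar> * ((h * ?N) ^ j /\<^sub>R fact j))"
      proof (rule order_trans[OF sum_abs sum_mono])
        fix j
        have "\<bar>?term j \<eta>\<bar> = \<bar>f \<eta>\<bar> * E m \<eta> * ((h * ?N) ^ j /\<^sub>R fact j)"
          unfolding term_eq using E1(1)[of m \<eta>] h(1) by (simp add: abs_mult power_abs del: of_nat_sum)
        also have "\<dots> \<le> \<bar>f \<eta>\<bar> * 1 * ((h * ?N) ^ j /\<^sub>R fact j)"
          using E1 h(1) by (intro mult_right_mono mult_left_mono) (auto simp del: of_nat_sum)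
        finally show "\<bar>?term j \<eta>\<bar> \<le> \<bar>f \<eta>\<bar> * ((h * ?N) ^ j /\<^sub>R fact j)" by simp
      qed
      also have "\<dots> \<le> \<bar>f \<eta>\<bar> * exp (h * ?N)"
      proof -
        have "(\<lambda>j. \<bar>f \<eta>\<bar> * ((h * ?N) ^ j /\<^sub>R fact j)) sums (\<bar>f \<eta>\<bar> * exp (h * ?N))"
          by (intro sums_mult exp_converges)
        then show ?thesis
          using sum_le_suminf[of "\<lambda>j. \<bar>f \<eta>\<bar> * ((h * ?N) ^ j /\<^sub>R fact j)" "{..<n}"] h(1) by (simp add: sums_iff del: of_nat_sum)
      qed
      also have "\<dots> \<le> (C * s1 ^ size \<eta>) * s1 ^ size \<eta>"
        unfolding eh using C s1(1) by (intro mult_right_mono) auto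
      also have "\<dots> = C * (s1\<^sup>2) ^ size \<eta>"
        by (simp add: power_mult[symmetric] power_add[symmetric] mult.assoc mult_2)
      finally show "\<bar>\<Sum>j<n. ?term j \<eta>\<bar> \<le> C * (s1\<^sup>2) ^ size \<eta>" .
    qed
  qed
  have dual_0: "dual \<zeta> \<eta> = 0" if "\<eta> x < \<zeta> x" for \<eta> x
    unfolding dual_split1[of \<zeta> \<eta> x] using that by (simp add: site_dual_def falling_eq binomial_eq_0)
  have dual_pos: "0 < dual \<zeta> \<zeta>"
    unfolding dual_def site_dual_def falling_eq using poch_pos \<rho>_pos by (intro prod_pos) auto
  obtain C where C: "0 \<le> C" "\<And>\<eta>. \<bar>dual \<zeta> \<eta>\<bar> \<le> C * s1 ^ size \<eta>"
    using duality_span_bound[OF duality_span.dual] by blast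
  define g where "g m \<eta> = s1 ^ (m * size \<zeta>) * (dual \<zeta> \<eta> * E m \<eta>)" for m \<eta>
  have E_eq: "s1 ^ (m * size \<zeta>) * E m \<eta> = exp (- h * (real (size \<eta>) - real (size \<zeta>))) ^ m" for m \<eta>
    unfolding E_def eh[symmetric] by (simp add: exp_add[symmetric] exp_of_nat_mult[symmetric] algebra_simps)
  have size_less: "size \<zeta> < size \<eta>" if nz: "dual \<zeta> \<eta> \<noteq> 0" and ne: "\<eta> \<noteq> \<zeta>" for \<eta>
  proof -
    have le: "\<zeta> x \<le> \<eta> x" for x using dual_0[of \<eta> x] nz by (cases "\<eta> x < \<zeta> x") auto
    obtain x where "\<eta> x \<noteq> \<zeta> x" using ne by auto
    then have "\<zeta> x < \<eta> x" using le[of x] by simp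
    then show ?thesis using le by (intro sum_strict_mono_ex1) auto
  qed
  have "Q (\<lambda>\<eta>. dual \<zeta> \<zeta> * indicator {\<zeta>} \<eta>)"
  proof (rule limit)
    show "Q (g m)" for m unfolding g_def[abs_def] by (intro scale Q_exp duality_span.dual)
    fix \<eta>
    show "\<bar>g m \<eta>\<bar> \<le> C * (s1\<^sup>2) ^ size \<eta>" for m
    proof (cases "dual \<zeta> \<eta> = 0")
      case True
      then show ?thesis using C s1(1) by (simp add: g_def)
    next
      case False
      have "size \<zeta> \<le> size \<eta>" using size_less[OF False] by (cases "\<eta> = \<zeta>") auto
      then have x: "exp (- h * (real (size \<eta>) - real (size \<zeta>))) \<le> 1"
        using h(1) by (simp del: of_nat_sum)
      have "g m \<eta> = dual \<zeta> \<eta> * (s1 ^ (m * size \<zeta>) * E m \<eta>)" by (simp add: g_def)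
      then have "\<bar>g m \<eta>\<bar> = dual \<zeta> \<eta> * exp (- h * (real (size \<eta>) - real (size \<zeta>))) ^ m"
        unfolding E_eq using dual_nonneg[of \<zeta> \<eta>] by (simp add: abs_mult)
      also have "\<dots> \<le> dual \<zeta> \<eta> * 1"
        using x dual_nonneg by (intro mult_left_mono power_le_one) auto
      also have "\<dots> \<le> C * s1 ^ size \<eta>" using C(2)[of \<eta>] by simp
      also have "\<dots> \<le> C * (s1\<^sup>2) ^ size \<eta>"
        using C(1) s1(1) by (intro mult_left_mono power_mono) (auto simp: power2_eq_square)
      finally show ?thesis .
    qed
    show "(\<lambda>m. g m \<eta>) \<longlonglongrightarrow> dual \<zeta> \<zeta> * indicator {\<zeta>} \<eta>"
    proof (cases "\<eta> = \<zeta>")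
      case True
      have "g m \<zeta> = dual \<zeta> \<zeta>" for m
        using E_eq[of m \<zeta>] by (simp add: g_def)
      then show ?thesis using True by simp
    next
      case False
      show ?thesis
      proof (cases "dual \<zeta> \<eta> = 0")
        case True
        then show ?thesis using False by (simp add: g_def)
      next
        case nz: False
        have "0 < h * (real (size \<eta>) - real (size \<zeta>))"
          using h(1) size_less[OF nz False] by (intro mult_pos_pos) (simp_all del: of_nat_sum)
        then have "(\<lambda>m. exp (- h * (real (size \<eta>) - real (size \<zeta>))) ^ m) \<longlonglongrightarrow> 0"
          by (intro LIMSEQ_realpow_zero) auto
        then have "(\<lambda>m. dual \<zeta> \<eta> * exp (- h * (real (size \<eta>) - real (size \<zeta>))) ^ m) \<longlonglongrightarrow> dual \<zeta> \<eta> * 0"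
          by (intro tendsto_mult tendsto_const)
        moreover have "g m \<eta> = dual \<zeta> \<eta> * exp (- h * (real (size \<eta>) - real (size \<zeta>))) ^ m" for m
          unfolding E_eq[symmetric] by (simp add: g_def)
        ultimately show ?thesis using False by simp
      qed
    qed
  qed
  from scale[OF this, of "1 / dual \<zeta> \<zeta>"] show ?thesis using dual_pos by simp
qed

end

context open_sip_principal
begin

text \<open>The decaying functions form a closed subspace of \<open>L\<^sup>2\<close> that contains the duality functions.\<close>

lemma all_decaying:
  assumes "f \<in> L2 chain.M" shows "chain.decaying l f"
  using assms
proof (induction f rule: chain.L2_induct)
  case (indicator y)
  have "chain.decaying l (\<lambda>\<eta>. complex_of_real (indicator {y} \<eta>))"
  proof (rule dominated_closure_contains_indicators[where Q="\<lambda>f. chain.decaying l (\<lambda>\<eta>. complex_of_real (f \<eta>))"])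
    show "chain.decaying l (\<lambda>\<eta>. complex_of_real (dual \<xi> \<eta>))" for \<xi> by (rule dual_decaying)
    show "chain.decaying l (\<lambda>\<eta>. complex_of_real (f \<eta> + g \<eta>))"
      if "chain.decaying l (\<lambda>\<eta>. complex_of_real (f \<eta>))" "chain.decaying l (\<lambda>\<eta>. complex_of_real (g \<eta>))" for f g
      using chain.decaying_add[OF l_pos that] by simp
    show "chain.decaying l (\<lambda>\<eta>. complex_of_real (d * f \<eta>))"
      if "chain.decaying l (\<lambda>\<eta>. complex_of_real (f \<eta>))" for f d
      using chain.decaying_cmult[OF l_pos that, of "complex_of_real d"] by simp
    fix f :: "nat \<Rightarrow> ('v \<Rightarrow> nat) \<Rightarrow> real" and g C
    assume f: "\<And>n. chain.decaying l (\<lambda>\<eta>. complex_of_real (f n \<eta>))"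
      and dom: "\<And>n \<eta>. \<bar>f n \<eta>\<bar> \<le> C * (s1\<^sup>2) ^ size \<eta>" and lim: "\<And>\<eta>. (\<lambda>n. f n \<eta>) \<longlonglongrightarrow> g \<eta>"
    have GL: "(\<lambda>\<eta>. complex_of_real (C * (s1\<^sup>2) ^ size \<eta>)) \<in> L2 chain.M"
      using s1(1) s1_lt(1) by (intro exp_size_L2) (auto simp: one_le_power power_mult[symmetric])
    note conv = chain.L2_dominated_convergence[where f="\<lambda>n \<eta>. complex_of_real (f n \<eta>)" and f'="\<lambda>\<eta>. complex_of_real (g \<eta>)", OF GL]
    have gL: "(\<lambda>\<eta>. complex_of_real (g \<eta>)) \<in> L2 chain.M"
      and gc: "(\<lambda>n. L2_norm chain.M (\<lambda>\<eta>. complex_of_real (f n \<eta>) - complex_of_real (g \<eta>))) \<longlonglongrightarrow> 0"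
      by (rule conv; use dom lim in \<open>simp add: tendsto_of_real\<close>)+
    show "chain.decaying l (\<lambda>\<eta>. complex_of_real (g \<eta>))"
    proof (rule chain.decaying_limit[OF gL _ l_pos])
      fix e :: real assume "0 < e"
      then have "\<forall>\<^sub>F n in sequentially. L2_norm chain.M (\<lambda>\<eta>. complex_of_real (f n \<eta>) - complex_of_real (g \<eta>)) < e"
        using gc by (intro order_tendstoD)
      then obtain n where "L2_norm chain.M (\<lambda>\<eta>. complex_of_real (f n \<eta>) - complex_of_real (g \<eta>)) < e"
        by (auto simp: eventually_sequentially)
      then have "L2_norm chain.M (\<lambda>\<eta>. complex_of_real (g \<eta>) - complex_of_real (f n \<eta>)) < e"
        by (subst chain.L2_norm_minus_commute)
      then show "\<exists>h. chain.decaying l h \<and> L2_norm chain.M (\<lambda>\<eta>. complex_of_real (g \<eta>) - h \<eta>) < e"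
        using f[of n] by blast
    qed
  qed
  moreover have "(\<lambda>\<eta>. complex_of_real (indicator {y} \<eta>)) = indicator {y}"
    by (auto simp: indicator_def)
  ultimately show ?case by simp
next
  case (add f g)
  then show ?case by (intro chain.decaying_add l_pos)
next
  case (cmult f c)
  then show ?case by (intro chain.decaying_cmult l_pos)
next
  case (limit f)
  then show ?case by (intro chain.decaying_limit l_pos) blast+
qed

theorem gap_SIP_eq: "gap_SIP c \<alpha> \<omega> \<rho> = l"
proof -
  let ?S = "L2_spectrum (sip_stationary \<alpha> \<rho>) (neg_graph (sip_L2_generator c \<alpha> \<omega> \<rho>))"
  have S: "?S = L2_spectrum chain.M (neg_graph (L2_generator chain.M chain.P))"
    by (simp add: sip_L2_generator_def sip_stationary_eq)
  have "complex_of_real l \<in> ?S"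
    unfolding S by (rule chain.eigenvalue_in_spectrum[OF F_eigenfunction(1), of "\<lambda>_. 0"])
      (use F_eigenfunction in \<open>simp_all del: of_real_diff\<close>)
  then have mem: "l \<in> Re ` (?S - {0})"
    using l_pos by (intro image_eqI[where x="complex_of_real l"]) auto
  have low: "l \<le> a" if a: "a \<in> Re ` (?S - {0})" for a
  proof (rule ccontr)
    assume less: "\<not> l \<le> a"
    from a obtain z where z: "z \<in> ?S - {0}" "a = Re z" by blast
    then have "z \<in> ?S" "z \<noteq> 0" "Re z < l" using less by simp_all
    then show False
      using chain.spectral_gap_resolvent[OF all_decaying, of z] unfolding S by (simp add: L2_spectrum_def)
  qed
  show ?thesis unfolding gap_SIP_def by (rule cInf_eq_minimum[OF mem low])
qed

end

theorem corollary6p4: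
  fixes c :: "'v::finite \<Rightarrow> 'v \<Rightarrow> real"
    and \<alpha> \<omega> :: "'v \<Rightarrow> real"
    and \<rho> :: real
  assumes "connected_conductances c"
    and "\<And>x. 0 < \<alpha> x"
    and "\<And>x. 0 \<le> \<omega> x"
    and "\<exists>x. \<omega> x \<noteq> 0"
    and "0 < \<rho>"
  shows "gap_SIP c \<alpha> \<omega> \<rho> = gap_RW c \<alpha> \<omega>"
proof -
  interpret killed_walk c \<alpha> \<omega> by unfold_locales (use assms in auto)
  obtain \<psi> l where \<psi>: "\<And>x. 0 < \<psi> x" "rw_neg_generator c \<alpha> \<omega> \<psi> = (\<lambda>x. l * \<psi> x)" "0 < l"
    "\<And>g. l * (\<Sum>x\<in>UNIV. \<alpha> x * (g x)\<^sup>2) \<le> rw_form c \<alpha> \<omega> g g"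
    using principal_eigenfunction by blast
  interpret open_sip_principal c \<alpha> \<omega> \<rho> \<psi> l by unfold_locales (use assms \<psi> in auto)
  show ?thesis using gap_SIP_eq gap_RW_principal[OF \<psi>(1,2,4)] by simp
qed

end
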